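(* Let $\Theta=(\Gamma,(x_{k,i}))$ be a patch framework with $\Gamma$ connected and let $S\in\mathbb{O}(d)^m$ be a non-degenerate alignment. Define $c_1=\max_{1\le k\le m}\sigma_{\max}(C_{k,:})$, where $C_{k,:}$ is the $k$th $d\times md$ row block of $C$, $c_2(S)=\max_{1\le i\le m}\sigma_{\max}([CS]_i)$, $c_3(S)=\sigma_{\max}(L(S))$, $\lambda_-(S)=\lambda_{d(d-1)/2+1}(\mathbb{L}(S))>0$ and $\lambda_+(S)=\lambda_{md(d-1)/2}(\mathbb{L}(S))>0$. These functions take the same value at $SQ$ as at $S$ for all $Q\in\mathbb{O}(d)$. Let $\zeta\in(0,1)$ be fixed and define $$\delta(S)=\frac{\lambda_-(S)}{2\,(c_1+c_2(S)+2c_3(S))}.$$ If $O\in\mathbb{O}(d)^m$ satisfies $\min_{Q\in\mathbb{O}(d)}\|O-SQ\|_F\le\zeta\,\delta(S)$, then, with $\widetilde O=\pi(O)$, for all $\widetilde Z\in T_{\widetilde O}\mathbb{O}(d)^m/_\sim$, $$(1-\zeta)\lambda_-(S)\,\widetilde g(\widetilde Z,\widetilde Z)\le\widetilde g(\mathrm{Hess}\,\widetilde F(\widetilde O)[\widetilde Z],\widetilde Z)\le(\lambda_+(S)+\zeta\lambda_-(S))\,\widetilde g(\widetilde Z,\widetilde Z).$$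
   Context: Notation. $\mathbb{O}(d)$ is the group of orthogonal $d\times d$ matrices, $\mathrm{Skew}(d)$ the space of skew-symmetric $d\times d$ matrices. $[A_i]_1^m$ is the vertical stack of $A_1,\dots,A_m$; $[A]_i$ is the $i$th $d$-row block of $A$; $M_{ij}$ is the $(i,j)$ block of size $d\times d$ of an $md\times md$ matrix $M$. $\lambda_i(A)$ is the $i$th smallest eigenvalue of a symmetric matrix; $\sigma_{\max}$ is the largest singular value; $A^\dagger$ is the Moore–Penrose pseudoinverse. Patch framework. $\Gamma$ is a bipartite graph on $n+m$ vertices; vertex $k\in\{1,\dots,n\}$ represents the $k$th point and vertex $n+i$, $i\in\{1,\dots,m\}$, the $i$th view; $(k,i)\in E(\Gamma)$ means that point $k$ is in view $i$, with local coordinates $x_{k,i}\in\mathbb{R}^d$. The tuple $\Theta=(\Gamma,(x_{k,i}))$ is a patch framework. Put $e_{ki}=e_k-e_{n+i}\in\mathbb{R}^{n+m}$, $\varepsilon_i$ the $i$th standard basis vector of $\mathbb{R}^m$, $\mathcal{L}_\Gamma=\sum_{(k,i)\in E(\Gamma)}e_{ki}e_{ki}^T$, $B=\sum_{(k,i)\in E(\Gamma)}(\varepsilon_i\otimes I_d)x_{k,i}e_{ki}^T$, $D=\sum_{(k,i)\in E(\Gamma)}(\varepsilon_i\otimes I_d)x_{k,i}x_{k,i}^T(\varepsilon_i\otimes I_d)^T$, and $C=D-B\mathcal{L}_\Gamma^\dagger B^T\in\mathbb{R}^{md\times md}$ (patch-stress matrix, positive semi-definite). An alignment is an element $S=[S_i]_1^m\in\mathbb{O}(d)^m\subseteq\mathbb{R}^{md\times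 d}$, and $F(S)=\mathrm{Tr}(CSS^T)$. Quotient. $S\sim SQ$ for $Q\in\mathbb{O}(d)$. The quotient $\mathbb{O}(d)^m/_\sim$ is identified with $\mathbb{O}(d)^{m-1}$ via $\pi(S)=[S_{i+1}S_1^T]_{i=1}^{m-1}$. Define $\widetilde F(\widetilde S)=\mathrm{Tr}\left(C\begin{bmatrix}I_d\\ \widetilde S\end{bmatrix}\begin{bmatrix}I_d\\ \widetilde S\end{bmatrix}^T\right)$, so $F=\widetilde F\circ\pi$. On $\mathbb{O}(d)^m$ use $g(Z,W)=\mathrm{Tr}(Z^TW)$. The horizontal space at $S$ is $\mathcal{H}_S=\{[S_i\Omega_i]_1^m:\Omega_i\in\mathrm{Skew}(d),\sum_i\Omega_i=0\}$; the horizontal lift at $S\in\pi^{-1}(\widetilde S)$ of a tangent vector $\widetilde Z$ at $\widetilde S$ is the unique $Z\in\mathcal{H}_S$ with $D\pi(S)[Z]=\widetilde Z$. The metric on the quotient is $\widetilde g(\widetilde Z,\widetilde W)=g(Z,W)$ for horizontal lifts $Z,W$ (independent of the choice of $S\in\pi^{-1}(\widetilde S)$). $\mathrm{Hess}\,\widetilde F$ is the Riemannian Hessian operator with respect to $\widetilde g$. An alignment $S$ is non-degenerate if $\pi(S)$ is a local minimizer of $\widetilde F$ at which the Hessian is non-singular. Matrices. $C(S)=\mathrm{blockdiag}(S_1,\dots,S_m)^T\,C\,\mathrm{blockdiag}(S_1,\dots,S_m)$; $\widehat C(S)$ is block-diagonal with $i$th diagonal block $\sum_{j=1}^mC(S)_{ij}$;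 $L(S)=C(S)-\widehat C(S)$. $P$ is the $md\times md$ permutation matrix such that row $(p-1)m+i$ of $PX$ is row $(i-1)d+p$ of $X$, and $\mathcal{L}(S)=PL(S)P^T$. $\overline P$ is the block matrix with $m\times m$ blocks, block-rows indexed by $(r,s)$, $1\le r<s\le d$ (column-major order), block-columns indexed by $(p,q)\in\{1,\dots,d\}^2$ (column-major order), whose $((r,s),(p,q))$ block is $0$ if $p=q$, $\delta_{pr}\delta_{qs}I_m$ if $p<q$, and $-\delta_{ps}\delta_{qr}I_m$ if $p>q$. $\mathbb{L}(S)=\overline P(I_d\otimes\mathcal{L}(S))\overline P^T$, of size $md(d-1)/2$. *)

theory Defs
  imports "HOL-Analysis.Analysis" "HOL-Library.Cardinality" "HOL-Library.Multiset"
begin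

section \<open>Conventions\<close>

text \<open>
  Dimensions are finite index types: points \<open>'n\<close>, views \<open>'m\<close>, coordinates \<open>'d\<close>.
  An \<open>md \<times> md\<close> matrix is indexed by \<open>'m \<times> 'd\<close>, so that its \<open>(i,j)\<close> block
  consists of the entries at \<open>((i,p),(j,q))\<close>.  A tuple \<open>[S\<^sub>i]\<^sub>1\<^sup>m\<close> of \<open>d \<times> d\<close> matrices has type
  \<open>real^'d^'d^'m\<close>; the norm of that type is the Frobenius norm.
  Where the first view plays a special role, the type of views is \<open>'k option\<close>: the first view is
  \<open>None\<close> and the remaining \<open>m - 1\<close> views are \<open>Some i\<close>, so that \<open>m = CARD('k) + 1\<close> ranges
  over all integers at least 2.  The sort \<open>{card2, linorder}\<close> means that \<open>d\<close> is at least 2 and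
  that the coordinates are ordered.  For \<open>m = 1\<close> or \<open>d = 1\<close> the eigenvalue
  \<open>\<lambda>\<^sub>-\<close> below does not exist.
\<close>

type_synonym ('m, 'd) tuple = "real^'d^'d^'m"
type_synonym ('m, 'd) block_mat = "real^('m \<times> 'd)^('m \<times> 'd)"


section \<open>Matrices\<close>

definition outer :: "real^'a \<Rightarrow> real^'b \<Rightarrow> real^'b^'a" where
  "outer u v = (\<chi> r c. u $ r * v $ c)"

definition kron :: "real^'b^'a \<Rightarrow> real^'e^'c \<Rightarrow> real^('b::finite \<times> 'e::finite)^('a::finite \<times> 'c::finite)" where
  "kron A B = (\<chi> r c. A $ fst r $ fst c * B $ snd r $ snd c)"

definition pinv :: "real^'b^'a \<Rightarrow> real^'a^'b" where
  "pinv A = (THE X. A ** X ** A = A \<and> X ** A ** X = X \<and>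
                    transpose (A ** X) = A ** X \<and> transpose (X ** A) = X ** A)"

definition eigenspace :: "real^'a^'a \<Rightarrow> real \<Rightarrow> (real^'a) set" where
  "eigenspace A l = {v. A *v v = l *\<^sub>R v}"

definition eigenvalues :: "real^'a^'a \<Rightarrow> real set" where
  "eigenvalues A = {l. \<exists>v. v \<noteq> 0 \<and> A *v v = l *\<^sub>R v}"

text \<open>
  The eigenvalues of a symmetric matrix, each repeated according to the dimension of its
  eigenspace; \<open>eig i A\<close> is the \<open>i\<close>th smallest of them, counting from 1.
\<close>

definition eigenvalue_mset :: "real^'a^'a \<Rightarrow> real multiset" where
  "eigenvalue_mset A = (\<Sum>l\<in>eigenvalues A. replicate_mset (dim (eigenspace A l)) l)"

definition eig :: "nat \<Rightarrow> real^'a^'a \<Rightarrow> real" where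
  "eig i A = sorted_list_of_multiset (eigenvalue_mset A) ! (i - 1)"

definition sigma_max :: "real^'b^'a \<Rightarrow> real" where
  "sigma_max A = Max (sqrt ` eigenvalues (transpose A ** A))"

definition stack :: "real^'c^'d^'m \<Rightarrow> real^'c^('m::finite \<times> 'd::finite)" where
  "stack S = (\<chi> r c. S $ fst r $ snd r $ c)"

definition row_block :: "real^'c^('m::finite \<times> 'd::finite) \<Rightarrow> 'm \<Rightarrow> real^'c^'d" where
  "row_block A i = (\<chi> p c. A $ (i, p) $ c)"

definition block :: "('m::finite, 'd::finite) block_mat \<Rightarrow> 'm \<Rightarrow> 'm \<Rightarrow> real^'d^'d" where
  "block A i j = (\<chi> p q. A $ (i, p) $ (j, q))"

definition blockdiag :: "real^'d^'d^'m \<Rightarrow> ('m::finite, 'd::finite) block_mat" where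
  "blockdiag S = (\<chi> r c. if fst r = fst c then S $ fst r $ snd r $ snd c else 0)"


section \<open>Patch frameworks\<close>

text \<open>
  The bipartite graph \<open>\<Gamma>\<close> on \<open>'n + 'm\<close> is given by its edge set \<open>E\<close> of pairs (point, view).
  The local coordinates \<open>x k i\<close> are only used for \<open>(k, i) \<in> E\<close>.
\<close>

definition graph_adj :: "('n \<times> 'm) set \<Rightarrow> (('n + 'm) \<times> ('n + 'm)) set" where
  "graph_adj E = {(Inl k, Inr i) | k i. (k, i) \<in> E} \<union> {(Inr i, Inl k) | k i. (k, i) \<in> E}"

definition graph_connected :: "('n \<times> 'm) set \<Rightarrow> bool" where
  "graph_connected E \<longleftrightarrow> (\<forall>u v. (u, v) \<in> (graph_adj E)\<^sup>*)"

definition edge_vec :: "'n::finite \<Rightarrow> 'm::finite \<Rightarrow> real^('n + 'm)" where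
  "edge_vec k i = axis (Inl k) 1 - axis (Inr i) 1"

definition eps_I :: "'m::finite \<Rightarrow> real^'d^('m \<times> 'd::finite)"  \<comment> \<open>\<open>\<epsilon>\<^sub>i \<otimes> I\<^sub>d\<close>\<close> where
  "eps_I i = (\<chi> r c. axis i 1 $ fst r * mat 1 $ snd r $ c)"

definition graph_laplacian :: "('n::finite \<times> 'm::finite) set \<Rightarrow> real^('n + 'm)^('n + 'm)" where
  "graph_laplacian E = (\<Sum>(k, i)\<in>E. outer (edge_vec k i) (edge_vec k i))"

definition patch_B ::
  "('n::finite \<times> 'm::finite) set \<Rightarrow> ('n \<Rightarrow> 'm \<Rightarrow> real^'d) \<Rightarrow> real^('n + 'm)^('m \<times> 'd::finite)" where
  "patch_B E x = (\<Sum>(k, i)\<in>E. eps_I i ** outer (x k i) (edge_vec k i))"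

definition patch_D ::
  "('n::finite \<times> 'm::finite) set \<Rightarrow> ('n \<Rightarrow> 'm \<Rightarrow> real^'d) \<Rightarrow> ('m, 'd::finite) block_mat" where
  "patch_D E x = (\<Sum>(k, i)\<in>E. eps_I i ** outer (x k i) (x k i) ** transpose (eps_I i))"

definition patch_stress ::
  "('n::finite \<times> 'm::finite) set \<Rightarrow> ('n \<Rightarrow> 'm \<Rightarrow> real^'d) \<Rightarrow> ('m, 'd::finite) block_mat" where
  "patch_stress E x =
     patch_D E x - patch_B E x ** pinv (graph_laplacian E) ** transpose (patch_B E x)"


section \<open>Riemannian Hessian on a submanifold of a Euclidean space\<close>

text \<open>
  \<open>M\<close> is a submanifold, given as a set, of a Euclidean space, and \<open>g x\<close> is the
  metric on the tangent space at \<open>x\<close>, which need not be the restriction of the ambient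
  inner product.  Only values on \<open>M\<close> of functions and vector fields on \<open>M\<close> matter.
\<close>

primrec Ck_on :: "nat \<Rightarrow> 'a::real_normed_vector set \<Rightarrow> ('a \<Rightarrow> 'b::real_normed_vector) \<Rightarrow> bool" where
  "Ck_on 0 U f \<longleftrightarrow> continuous_on U f"
| "Ck_on (Suc k) U f \<longleftrightarrow>
     (\<forall>x\<in>U. f differentiable (at x)) \<and> (\<forall>v. Ck_on k U (\<lambda>x. frechet_derivative f (at x) v))"

definition smooth_on :: "'a::real_normed_vector set \<Rightarrow> ('a \<Rightarrow> 'b::real_normed_vector) \<Rightarrow> bool" where
  "smooth_on U f \<longleftrightarrow> (\<forall>k. Ck_on k U f)"

definition smooth_map :: "'a::euclidean_space set \<Rightarrow> ('a \<Rightarrow> 'b::real_normed_vector) \<Rightarrow> bool" where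
  "smooth_map M f \<longleftrightarrow> (\<exists>U h. open U \<and> M \<subseteq> U \<and> smooth_on U h \<and> (\<forall>x\<in>M. f x = h x))"

definition tangent_space :: "'a::euclidean_space set \<Rightarrow> 'a \<Rightarrow> 'a set" where
  "tangent_space M x =
     {v. \<exists>e>0. \<exists>c :: real \<Rightarrow> 'a. smooth_on {-e<..<e} c \<and> c ` {-e<..<e} \<subseteq> M \<and> c 0 = x \<and>
           (c has_vector_derivative v) (at 0)}"

text \<open>
  The differential of \<open>f\<close> on \<open>M\<close>.  The derivative within \<open>M\<close> is a linear map on the
  whole ambient space which is not unique, but its restriction to the tangent space is;
  it is only ever applied to tangent vectors.
\<close>

definition mderiv :: "'a::euclidean_space set \<Rightarrow> ('a \<Rightarrow> 'b::real_normed_vector) \<Rightarrow> 'a \<Rightarrow> 'a \<Rightarrow> 'b" where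
  "mderiv M f x v = frechet_derivative f (at x within M) v"

definition vector_field :: "'a::euclidean_space set \<Rightarrow> ('a \<Rightarrow> 'a) \<Rightarrow> bool" where
  "vector_field M X \<longleftrightarrow> smooth_map M X \<and> (\<forall>x\<in>M. X x \<in> tangent_space M x)"

text \<open>Below, \<open>nab x u Y\<close> stands for \<open>\<nabla>\<^sub>u Y\<close> with \<open>u\<close> a tangent vector at \<open>x\<close>.\<close>

definition affine_connection ::
  "'a::euclidean_space set \<Rightarrow> ('a \<Rightarrow> 'a \<Rightarrow> ('a \<Rightarrow> 'a) \<Rightarrow> 'a) \<Rightarrow> bool" where
  "affine_connection M nab \<longleftrightarrow>
     (\<forall>Y. vector_field M Y \<longrightarrow>
        (\<forall>x\<in>M. \<forall>u\<in>tangent_space M x. nab x u Y \<in> tangent_space M x)) \<and>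
     (\<forall>X Y. vector_field M X \<longrightarrow> vector_field M Y \<longrightarrow>
        vector_field M (\<lambda>x. nab x (X x) Y)) \<and>
     (\<forall>Y. vector_field M Y \<longrightarrow>
        (\<forall>x\<in>M. \<forall>u\<in>tangent_space M x. \<forall>v\<in>tangent_space M x. \<forall>a b.
           nab x (a *\<^sub>R u + b *\<^sub>R v) Y = a *\<^sub>R nab x u Y + b *\<^sub>R nab x v Y)) \<and>
     (\<forall>Y Z. vector_field M Y \<longrightarrow> vector_field M Z \<longrightarrow>
        (\<forall>x\<in>M. \<forall>u\<in>tangent_space M x. \<forall>a b.
           nab x u (\<lambda>y. a *\<^sub>R Y y + b *\<^sub>R Z y) = a *\<^sub>R nab x u Y + b *\<^sub>R nab x u Z)) \<and>
     (\<forall>(f :: 'a \<Rightarrow> real) Y. smooth_map M f \<longrightarrow> vector_field M Y \<longrightarrow>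
        (\<forall>x\<in>M. \<forall>u\<in>tangent_space M x.
           nab x u (\<lambda>y. f y *\<^sub>R Y y) = mderiv M f x u *\<^sub>R Y x + f x *\<^sub>R nab x u Y))"

text \<open>
  The last two conjuncts are vanishing torsion, \<open>(\<nabla>\<^sub>X Y - \<nabla>\<^sub>Y X) f = X (Y f) - Y (X f)\<close>,
  and compatibility with the metric.
\<close>

definition is_levi_civita ::
  "'a::euclidean_space set \<Rightarrow> ('a \<Rightarrow> 'a \<Rightarrow> 'a \<Rightarrow> real) \<Rightarrow> ('a \<Rightarrow> 'a \<Rightarrow> ('a \<Rightarrow> 'a) \<Rightarrow> 'a) \<Rightarrow> bool" where
  "is_levi_civita M g nab \<longleftrightarrow>
     affine_connection M nab \<and>
     (\<forall>X Y. \<forall>f :: 'a \<Rightarrow> real. vector_field M X \<longrightarrow> vector_field M Y \<longrightarrow> smooth_map M f \<longrightarrow>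
        (\<forall>x\<in>M. mderiv M f x (nab x (X x) Y - nab x (Y x) X) =
                 mderiv M (\<lambda>y. mderiv M f y (Y y)) x (X x)
                 - mderiv M (\<lambda>y. mderiv M f y (X y)) x (Y x))) \<and>
     (\<forall>Y Z. vector_field M Y \<longrightarrow> vector_field M Z \<longrightarrow>
        (\<forall>x\<in>M. \<forall>u\<in>tangent_space M x.
           mderiv M (\<lambda>y. g y (Y y) (Z y)) x u = g x (nab x u Y) (Z x) + g x (Y x) (nab x u Z)))"

text \<open>
  By the fundamental theorem of Riemannian geometry such a connection exists, and it is unique
  on \<open>x \<in> M\<close>, \<open>u\<close> tangent at \<open>x\<close> and \<open>Y\<close> a vector field on \<open>M\<close>.  The choice
  operator only serves to fix the irrelevant values at other arguments.
\<close>

definition levi_civita ::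
  "'a::euclidean_space set \<Rightarrow> ('a \<Rightarrow> 'a \<Rightarrow> 'a \<Rightarrow> real) \<Rightarrow> ('a \<Rightarrow> 'a \<Rightarrow> ('a \<Rightarrow> 'a) \<Rightarrow> 'a)" where
  "levi_civita M g = (SOME nab. is_levi_civita M g nab)"

definition riem_grad ::
  "'a::euclidean_space set \<Rightarrow> ('a \<Rightarrow> 'a \<Rightarrow> 'a \<Rightarrow> real) \<Rightarrow> ('a \<Rightarrow> real) \<Rightarrow> 'a \<Rightarrow> 'a" where
  "riem_grad M g f x =
     (THE v. v \<in> tangent_space M x \<and> (\<forall>w\<in>tangent_space M x. g x v w = mderiv M f x w))"

definition riem_hess ::
  "'a::euclidean_space set \<Rightarrow> ('a \<Rightarrow> 'a \<Rightarrow> 'a \<Rightarrow> real) \<Rightarrow> ('a \<Rightarrow> real) \<Rightarrow> 'a \<Rightarrow> 'a \<Rightarrow> 'a" where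
  "riem_hess M g f x u = levi_civita M g x u (riem_grad M g f)"


section \<open>Alignments and their quotient\<close>

definition orthogonal_tuples :: "(('m::finite, 'd::finite) tuple) set" where
  "orthogonal_tuples = {S. \<forall>i. orthogonal_matrix (S $ i)}"

definition skew :: "(real^'d::finite^'d) set" where
  "skew = {A. transpose A = - A}"

definition right_mult :: "('m::finite, 'd::finite) tuple \<Rightarrow> real^'d^'d \<Rightarrow> ('m, 'd) tuple" where
  "right_mult S Q = (\<chi> i. S $ i ** Q)"

definition quot_map :: "('k::finite option, 'd::finite) tuple \<Rightarrow> ('k, 'd) tuple" where
  "quot_map S = (\<chi> i. S $ Some i ** transpose (S $ None))"

definition with_identity :: "('k, 'd::finite) tuple \<Rightarrow> ('k::finite option, 'd) tuple" where
  "with_identity T = (\<chi> v. case v of None \<Rightarrow> mat 1 | Some i \<Rightarrow> T $ i)"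

definition F_quot ::
  "('k::finite option, 'd::finite) block_mat \<Rightarrow> ('k, 'd) tuple \<Rightarrow> real" where
  "F_quot C T =
     trace (C ** (stack (with_identity T) ** transpose (stack (with_identity T))))"

definition g_total :: "('m::finite, 'd::finite) tuple \<Rightarrow> ('m, 'd) tuple \<Rightarrow> real" where
  "g_total Z W = trace (transpose (stack Z) ** stack W)"

definition horizontal_space :: "('m::finite, 'd::finite) tuple \<Rightarrow> (('m, 'd) tuple) set" where
  "horizontal_space S =
     {(\<chi> i. S $ i ** \<Omega> i) | \<Omega>. (\<forall>i. \<Omega> i \<in> skew) \<and> (\<Sum>i\<in>UNIV. \<Omega> i) = 0}"

definition horizontal_lift ::
  "('k::finite option, 'd::finite) tuple \<Rightarrow> ('k, 'd) tuple \<Rightarrow> ('k option, 'd) tuple" where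
  "horizontal_lift S Z' =
     (THE Z. Z \<in> horizontal_space S \<and> mderiv orthogonal_tuples quot_map S Z = Z')"

text \<open>The value does not depend on the chosen preimage \<open>S\<close> of \<open>T\<close>.\<close>

definition g_quot :: "('k::finite, 'd::finite) tuple \<Rightarrow> ('k, 'd) tuple \<Rightarrow> ('k, 'd) tuple \<Rightarrow> real" where
  "g_quot T Z' W' =
     (let S = (SOME S. S \<in> orthogonal_tuples \<and> quot_map S = T)
      in g_total (horizontal_lift S Z') (horizontal_lift S W'))"

definition hess_F_quot ::
  "('k::finite option, 'd::finite) block_mat \<Rightarrow>
   ('k, 'd) tuple \<Rightarrow> ('k, 'd) tuple \<Rightarrow> ('k, 'd) tuple" where
  "hess_F_quot C = riem_hess orthogonal_tuples g_quot (F_quot C)"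

definition nondegenerate ::
  "('k::finite option, 'd::finite) block_mat \<Rightarrow> ('k option, 'd) tuple \<Rightarrow> bool" where
  "nondegenerate C S \<longleftrightarrow>
     (\<exists>e>0. \<forall>T\<in>orthogonal_tuples.
        dist T (quot_map S) < e \<longrightarrow> F_quot C (quot_map S) \<le> F_quot C T) \<and>
     (\<forall>Z\<in>tangent_space orthogonal_tuples (quot_map S).
        hess_F_quot C (quot_map S) Z = 0 \<longrightarrow> Z = 0)"


section \<open>The matrices \<open>L(S)\<close> and \<open>\<bbbL>(S)\<close>\<close>

definition C_conj ::
  "('m::finite, 'd::finite) block_mat \<Rightarrow> ('m, 'd) tuple \<Rightarrow> ('m, 'd) block_mat" where
  "C_conj C S = transpose (blockdiag S) ** C ** blockdiag S"

definition C_hat ::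
  "('m::finite, 'd::finite) block_mat \<Rightarrow> ('m, 'd) tuple \<Rightarrow> ('m, 'd) block_mat" where
  "C_hat C S = blockdiag (\<chi> i. \<Sum>j\<in>UNIV. block (C_conj C S) i j)"

definition L_mat ::
  "('m::finite, 'd::finite) block_mat \<Rightarrow> ('m, 'd) tuple \<Rightarrow> ('m, 'd) block_mat" where
  "L_mat C S = C_conj C S - C_hat C S"

text \<open>
  Row number \<open>(p - 1) m + i\<close> is the row \<open>(p, i)\<close>, and row number \<open>(i - 1) d + p\<close> is
  the row \<open>(i, p)\<close>.
\<close>

definition P_mat :: "real^('m::finite \<times> 'd)^('d::finite \<times> 'm)" where
  "P_mat = (\<chi> r c. if r = (snd c, fst c) then 1 else 0)"

definition L_perm ::
  "('m::finite, 'd) block_mat \<Rightarrow> ('m, 'd) tuple \<Rightarrow> ('d::finite, 'm) block_mat" where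
  "L_perm C S = P_mat ** L_mat C S ** transpose P_mat"

text \<open>The index type of the block rows of \<open>P_bar\<close>; it has \<open>d (d - 1) / 2\<close> elements.\<close>

typedef (overloaded) 'd lt_pair = "{(r :: 'd::{card2, linorder}, s). r < s}"
proof -
  have "\<not> is_singleton (UNIV :: 'd set)"
    using two_le_card[where 'a='d] by (auto simp: is_singleton_altdef)
  then obtain a b :: 'd where "a \<noteq> b"
    by (metis UNIV_I empty_iff is_singletonI')
  then show ?thesis
    by (metis (mono_tags, lifting) case_prodI linorder_neqE mem_Collect_eq)
qed

instance lt_pair :: ("{card2, linorder}") finite
proof
  have "inj (Rep_lt_pair :: 'a lt_pair \<Rightarrow> _)"
    by (simp add: Rep_lt_pair_inject inj_def)
  then show "finite (UNIV :: 'a lt_pair set)"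
    using finite_imageD[of Rep_lt_pair UNIV] by simp
qed

text \<open>
  In column-major order \<open>p\<close> varies faster than \<open>q\<close>, so the column of block
  column \<open>(p, q)\<close> with inner index \<open>j\<close> is indexed by \<open>(q, (p, j))\<close>.  This matches the indexing of
  \<open>kron (mat 1) (L_perm C S)\<close>.
\<close>

definition P_bar :: "real^('d \<times> ('d \<times> 'm::finite))^('d::{card2, linorder} lt_pair \<times> 'm)" where
  "P_bar = (\<chi> row col.
     case (row, col) of ((rs, i), (q, (p, j))) \<Rightarrow>
       case Rep_lt_pair rs of (r, s) \<Rightarrow>
         if i \<noteq> j then 0
         else if p < q then (if p = r \<and> q = s then 1 else 0)
         else if q < p then (if p = s \<and> q = r then - 1 else 0)
         else 0)"

definition LL_mat ::
  "('m::finite, 'd) block_mat \<Rightarrow> ('m, 'd) tuple \<Rightarrow>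
   ('d::{card2, linorder} lt_pair, 'm) block_mat" where
  "LL_mat C S = P_bar ** kron (mat 1) (L_perm C S) ** transpose P_bar"


section \<open>The constants\<close>

definition c1 :: "('m::finite, 'd::finite) block_mat \<Rightarrow> real" where
  "c1 C = Max (range (\<lambda>k. sigma_max (row_block C k)))"

definition c2 :: "('m::finite, 'd::finite) block_mat \<Rightarrow> ('m, 'd) tuple \<Rightarrow> real" where
  "c2 C S = Max (range (\<lambda>i. sigma_max (row_block (C ** stack S) i)))"

definition c3 :: "('m::finite, 'd::finite) block_mat \<Rightarrow> ('m, 'd) tuple \<Rightarrow> real" where
  "c3 C S = sigma_max (L_mat C S)"

definition lambda_minus ::
  "('m::finite, 'd) block_mat \<Rightarrow> ('m, 'd::{card2, linorder}) tuple \<Rightarrow> real" where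
  "lambda_minus C S = eig (CARD('d) * (CARD('d) - 1) div 2 + 1) (LL_mat C S)"

definition lambda_plus ::
  "('m::finite, 'd) block_mat \<Rightarrow> ('m, 'd::{card2, linorder}) tuple \<Rightarrow> real" where
  "lambda_plus C S = eig (CARD('m) * CARD('d) * (CARD('d) - 1) div 2) (LL_mat C S)"

definition delta ::
  "('m::finite, 'd) block_mat \<Rightarrow> ('m, 'd::{card2, linorder}) tuple \<Rightarrow> real" where
  "delta C S = lambda_minus C S / (2 * (c1 C + c2 C S + 2 * c3 C S))"

end

theory Submission
  imports Defs
begin

text \<open>
  Writing tangent vectors of the quotient at \<open>T\<close> as \<open>T a\<close> with \<open>a\<close> a tuple of \<open>m - 1\<close> skew matrices, the
  quotient metric is left-invariant, \<open>a \<bullet> b - (\<Sum>a) \<bullet> (\<Sum>b) / m\<close>, so Koszul's formula makes its Levi-Civita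
  connection explicit.  It follows that the Hessian form of the objective at \<open>\<pi>(S)\<close> is \<open>2 tr (\<Omega>\<^sup>T L(S) \<Omega>)\<close>,
  where \<open>S \<Omega>\<close> is the horizontal lift, while the metric is \<open>tr (\<Omega>\<^sup>T \<Omega>)\<close>.  If \<open>\<omega>\<close> collects the entries of
  \<open>\<Omega>\<close> above the diagonal, then \<open>tr (\<Omega>\<^sup>T L(S) \<Omega>) = \<omega>\<^sup>T \<bbbL>(S) \<omega>\<close> and \<open>tr (\<Omega>\<^sup>T \<Omega>) = 2 \<omega>\<^sup>T \<omega>\<close>.

  At a non-degenerate \<open>S\<close> the first-order condition makes \<open>L(S)\<close> symmetric, and the second-order condition makes
  the form positive definite on the tuples with \<open>\<Sum>\<Omega> = 0\<close>.  It vanishes on constant tuples, so the kernel of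
  \<open>\<bbbL>(S)\<close> consists of the \<open>d (d - 1) / 2\<close>-dimensional space of constant tuples and its orthogonal complement is
  the horizontal space.  Hence \<open>\<lambda>\<^sub>-\<close> is the minimum of the form on horizontal vectors and \<open>\<lambda>\<^sub>+\<close> its
  maximum.  The bounds at \<open>O\<close> follow because the forms of \<open>L(O)\<close> and \<open>L(S)\<close> differ by at most
  \<open>(c\<^sub>1 + c\<^sub>2 + 2 c\<^sub>3) |O - S| |\<Omega>|\<^sup>2\<close>.
\<close>

text \<open>The obstacle is that \<open>riem_hess\<close> rests on a connection picked by a choice
  operator, so only the Levi-Civita axioms are available. The explicit \<open>lc_conn\<close> shows
  that they can be met; the chosen connection is then computed on left-invariant fields alone. That
  is enough: compatibility with the metric, applied to the gradient and a left-invariant field,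
  moves the derivative off the gradient. The two factors 2 cancel: the Hessian form over the metric
  is the Rayleigh quotient of \<open>LL_mat\<close>, so its eigenvalues bound the Hessian directly.
  In the perturbation the factor stays: the Hessian form changes by at most 2 (c1 + c2 + 2 c3) |O -
  S| |Omega|^2, and the 2 in the denominator of \<open>delta\<close> makes this at most \<zeta>
  times \<open>lambda_minus\<close> times |Omega|^2. The hypothesis concerns the nearest S Q rather
  than S, so all estimates are applied at S Q and the invariance of the constants is part of the
  proof. For the eigenvalues it comes from their variational description.\<close>

section \<open>Symmetric matrices\<close>

lemma inner_matrix_transpose: "(A *v x) \<bullet> y = x \<bullet> (transpose A *v (y :: real^'a))"
  for A :: "real^'b^'a"
  by (metis dot_lmul_matrix transpose_matrix_vector transpose_transpose)

text \<open>A nonnegative quadratic without constant term is minimal at 0, so its slope there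
  vanishes. This yields the eigenvector equation for a minimizer of the Rayleigh quotient, and later
  that a null vector of the semidefinite Hessian form pairs to zero with every direction.\<close>

lemma quadratic_nonneg_imp_linear_zero:
  fixes p q :: real
  assumes q0: "0 \<le> q" and key: "\<And>t::real. 0 \<le> 2 * t * p + t\<^sup>2 * q"
  shows "p = 0"
proof (rule ccontr)
  assume "p \<noteq> 0"
  then have pp: "p * p > 0" using not_real_square_gt_zero by blast
  \<comment> \<open>The minimizing t would be -p/q; the denominator 1 + q avoids a separate case q =
    0 and still makes the value negative.\<close>
  have "0 \<le> 2 * (- p / (1 + q)) * p + (- p / (1 + q))\<^sup>2 * q" by (rule key)
  also have "\<dots> = (p * p) * (- 2 * (1 + q) + q) / (1 + q)\<^sup>2"
    using q0 by (simp add: divide_simps power2_eq_square) (simp add: algebra_simps)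
  finally have "0 \<le> (p * p) * (- 2 * (1 + q) + q)"
    using q0 by (simp add: zero_le_divide_iff)
  then show False using pp q0 by (simp add: zero_le_mult_iff)
qed

text \<open>Compactness of the unit sphere of \<open>V\<close> gives a minimizer \<open>v\<close>.
  The first variation makes \<open>A *v v - l *\<^sub>R v\<close> orthogonal to \<open>V\<close>,
  and invariance puts this vector into \<open>V\<close>, so it is zero.\<close>

lemma rayleigh_minimum:
  fixes A :: "real^'a^'a"
  assumes sym: "transpose A = A" and V: "subspace V" and inv: "\<And>v. v \<in> V \<Longrightarrow> A *v v \<in> V"
    and ne: "V \<noteq> {0}"
  obtains v l where "v \<in> V" "norm v = 1" "A *v v = l *\<^sub>R v"
    "\<And>w. w \<in> V \<Longrightarrow> l * (w \<bullet> w) \<le> w \<bullet> (A *v w)"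
proof -
  have sA: "(A *v x) \<bullet> y = x \<bullet> (A *v y)" for x y
    by (metis inner_matrix_transpose sym)
  have sA': "x \<bullet> (A *v y) = y \<bullet> (A *v x)" for x y
    by (metis sA inner_commute)
  let ?K = "V \<inter> sphere 0 1"
  have "compact ?K"
    using closed_subspace[OF V] by (simp add: closed_Int_compact)
  moreover have "?K \<noteq> {}"
  proof -
    obtain z where "z \<in> V" "z \<noteq> 0" using ne V subspace_0 by blast
    then have "(1 / norm z) *\<^sub>R z \<in> ?K"
      using V by (auto simp: subspace_scale)
    then show ?thesis by blast
  qed
  moreover have "continuous_on ?K (\<lambda>w. w \<bullet> (A *v w))"
    by (intro continuous_intros)
  ultimately obtain v where v: "v \<in> ?K" and vmin: "\<forall>w\<in>?K. v \<bullet> (A *v v) \<le> w \<bullet> (A *v w)"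
    using continuous_attains_inf by blast
  define l where "l = v \<bullet> (A *v v)"
  have vV: "v \<in> V" and nv: "norm v = 1" and vv: "v \<bullet> v = 1"
    using v by (auto simp: norm_eq_1)
  have ray: "l * (w \<bullet> w) \<le> w \<bullet> (A *v w)" if w: "w \<in> V" for w
  proof (cases "w = 0")
    case False
    have "(1 / norm w) *\<^sub>R w \<in> ?K" using False w V by (auto simp: subspace_scale)
    then have "l \<le> ((1 / norm w) *\<^sub>R w) \<bullet> (A *v ((1 / norm w) *\<^sub>R w))"
      using vmin l_def by blast
    also have "\<dots> = w \<bullet> (A *v w) / (w \<bullet> w)"
      by (simp add: matrix_vector_mult_scaleR power2_norm_eq_inner[symmetric] power2_eq_square)
    finally show ?thesis using False by (simp add: field_simps)
  qed simp
  have orth: "(A *v v - l *\<^sub>R v) \<bullet> w = 0" if w: "w \<in> V" for w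
  proof -
    define p where "p = (A *v v - l *\<^sub>R v) \<bullet> w"
    define q where "q = w \<bullet> (A *v w) - l * (w \<bullet> w)"
    have q0: "q \<ge> 0" using ray[OF w] by (simp add: q_def)
    have key: "0 \<le> 2 * t * p + t\<^sup>2 * q" for t :: real
    proof -
      have "v + t *\<^sub>R w \<in> V" using V vV w by (simp add: subspace_add subspace_scale)
      from ray[OF this] show ?thesis
        unfolding p_def q_def
        using sA'[of v w]
        by (simp add: l_def matrix_vector_right_distrib matrix_vector_mult_scaleR sA algebra_simps
            inner_commute vv power2_eq_square)
    qed
    have "p = 0" using q0 key by (rule quadratic_nonneg_imp_linear_zero)
    then show ?thesis by (simp add: p_def)
  qed
  have "A *v v - l *\<^sub>R v \<in> V"
    using V vV inv by (simp add: subspace_diff subspace_scale)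
  from orth[OF this] have "A *v v = l *\<^sub>R v" by simp
  then show ?thesis using that vV nv ray by blast
qed

lemma eigenvectors_orthogonal:
  fixes A :: "real^'a^'a"
  assumes sym: "transpose A = A" and "v \<in> eigenspace A l" "w \<in> eigenspace A k" "l \<noteq> k"
  shows "v \<bullet> w = 0"
proof -
  have "l * (v \<bullet> w) = k * (v \<bullet> w)"
    using inner_matrix_transpose[of A v w] assms by (simp add: eigenspace_def)
  then show ?thesis using assms(4) by simp
qed

lemma subspace_eigenspace: "subspace (eigenspace A l)"
  by (auto simp: subspace_def eigenspace_def matrix_vector_right_distrib
      matrix_vector_mult_scaleR scaleR_right_distrib)

lemma eigenvaluesI:
  assumes "A *v v = l *\<^sub>R v" "v \<noteq> 0"
  shows "l \<in> eigenvalues A"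
  using assms by (auto simp: eigenvalues_def)

lemma eigenvalues_alt: "eigenvalues A = {l. eigenspace A l \<noteq> {0}}"
  by (auto simp: eigenvalues_def eigenspace_def)

text \<open>Orthonormal bases of the eigenspaces are put together. If they failed to span, the
  orthogonal complement would be a nonzero invariant subspace and contain an eigenvector, which
  already lies in the span.\<close>

lemma spectral_basis:
  fixes A :: "real^'a^'a"
  assumes sym: "transpose A = A"
  obtains B ev where "pairwise orthogonal B" "\<forall>b\<in>B. norm b = 1"
    "\<forall>b\<in>B. A *v b = ev b *\<^sub>R b" "independent B" "span B = UNIV" "finite B"
    "card B = CARD('a)" "ev ` B = eigenvalues A"
    "\<forall>l. card {b \<in> B. ev b = l} = dim (eigenspace A l)"
proof -
  have "\<exists>E. E \<subseteq> eigenspace A l \<and> pairwise orthogonal E \<and> (\<forall>x\<in>E. norm x = 1) \<and>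
      independent E \<and> card E = dim (eigenspace A l) \<and> span E = eigenspace A l" for l
    using orthonormal_basis_subspace[OF subspace_eigenspace[of A l]] by metis
  then obtain E where E: "\<And>l. E l \<subseteq> eigenspace A l" "\<And>l. pairwise orthogonal (E l)"
      "\<And>l x. x \<in> E l \<Longrightarrow> norm x = 1" "\<And>l. independent (E l)"
      "\<And>l. card (E l) = dim (eigenspace A l)" "\<And>l. span (E l) = eigenspace A l"
    by metis
  \<comment> \<open>The union runs over all reals; \<open>E l\<close> is empty unless
    \<open>l\<close> is an eigenvalue, because its members are unit vectors of the
    eigenspace.\<close>
  define B where "B = (\<Union>l. E l)"
  define ev where "ev b = (THE l. b \<in> E l)" for b
  have Enz: "x \<noteq> 0" if "x \<in> E l" for x l using E(3)[OF that] by auto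
  have Euniq: "l = k" if "b \<in> E l" "b \<in> E k" for b l k
    using eigenvectors_orthogonal[OF sym, of b l b k] E(1) that Enz by fastforce
  have evE: "ev b = l" if "b \<in> E l" for b l
    unfolding ev_def using that Euniq by blast
  have po: "pairwise orthogonal B"
    unfolding pairwise_def B_def
  proof safe
    fix x y l k assume "x \<in> E l" "y \<in> E k" "x \<noteq> y"
    then show "orthogonal x y"
      using E(1,2) eigenvectors_orthogonal[OF sym, of x l y k]
      by (cases "l = k") (auto simp: pairwise_def orthogonal_def)
  qed
  have n1: "norm b = 1" if "b \<in> B" for b using that E(3) by (auto simp: B_def)
  have ind: "independent B"
    using po n1 by (intro pairwise_orthogonal_independent) force+
  have Aev: "A *v b = ev b *\<^sub>R b" if "b \<in> B" for b
    using that E(1) evE by (fastforce simp: B_def eigenspace_def)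
  have fin: "finite B" using ind independent_bound by blast
  have spn: "span B = UNIV"
  proof (rule ccontr)
    assume "span B \<noteq> UNIV"
    define V where "V = {v. \<forall>b\<in>B. b \<bullet> v = 0}"
    have sV: "subspace V" unfolding V_def
      by (auto simp: subspace_def inner_add_right)
    have "A *v v \<in> V" if "v \<in> V" for v
      unfolding V_def
    proof safe
      fix b assume b: "b \<in> B"
      have "b \<bullet> (A *v v) = (A *v b) \<bullet> v" by (metis inner_matrix_transpose sym)
      then show "b \<bullet> (A *v v) = 0" using Aev[OF b] that b by (simp add: V_def)
    qed
    moreover have "V \<noteq> {0}"
    proof -
      obtain a where a: "a \<noteq> 0" "\<And>x. x \<in> span B \<Longrightarrow> orthogonal a x"
        using orthogonal_to_subspace_exists_gen[of B UNIV] \<open>span B \<noteq> UNIV\<close> by auto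
      then have "a \<in> V"
        by (auto simp: V_def orthogonal_def inner_commute span_base)
      then show ?thesis using a by blast
    qed
    ultimately obtain v l where v: "v \<in> V" "norm v = 1" "A *v v = l *\<^sub>R v"
      using rayleigh_minimum[OF sym sV] by metis
    then have "v \<in> span (E l)" by (simp add: E(6) eigenspace_def)
    also have "\<dots> \<subseteq> span B" by (intro span_mono) (auto simp: B_def)
    finally have "orthogonal v v"
      using v(1) orthogonal_to_span[of v B v] by (auto simp: V_def orthogonal_def inner_commute)
    then show False using v(2) by (auto simp: orthogonal_def)
  qed
  have cardB: "card B = CARD('a)"
    using ind spn by (metis basis_card_eq_dim dim_UNIV DIM_cart DIM_real mult.right_neutral top_greatest)
  have Eset: "{b \<in> B. ev b = l} = E l" for l
    using evE by (auto simp: B_def)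
  have evB: "ev ` B = eigenvalues A"
  proof safe
    fix b assume "b \<in> B"
    then show "ev b \<in> eigenvalues A"
      using Aev n1 by (intro eigenvaluesI[of A b]) force+
  next
    fix l assume "l \<in> eigenvalues A"
    then have "E l \<noteq> {}" using E(6)[of l] by (auto simp: eigenvalues_alt)
    then show "l \<in> ev ` B" using evE by (force simp: B_def)
  qed
  show ?thesis
    using that[of B ev] po n1 Aev ind spn fin cardB evB by (simp add: Eset E(5))
qed

lemma finite_eigenvalues:
  fixes A :: "real^'a^'a"
  assumes "transpose A = A"
  shows "finite (eigenvalues A)"
proof -
  obtain B ev where "pairwise orthogonal B" "\<forall>b\<in>B. norm b = 1"
    "\<forall>b\<in>B. A *v b = ev b *\<^sub>R b" "independent B" "span B = UNIV" "finite B"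
    "card B = CARD('a)" "ev ` B = eigenvalues A"
    "\<forall>l. card {b \<in> B. ev b = l} = dim (eigenspace A l)"
    by (rule spectral_basis[OF assms])
  then show ?thesis by (metis finite_imageI)
qed

lemma
  fixes A :: "real^'a^'a"
  assumes sym: "transpose A = A"
  shows size_eigenvalue_mset: "size (eigenvalue_mset A) = CARD('a)"
    and count_eigenvalue_mset: "count (eigenvalue_mset A) l = dim (eigenspace A l)"
    and set_eigenvalue_mset: "set_mset (eigenvalue_mset A) = eigenvalues A"
proof -
  obtain B ev where "pairwise orthogonal B" "\<forall>b\<in>B. norm b = 1"
    "\<forall>b\<in>B. A *v b = ev b *\<^sub>R b" "independent B" "span B = UNIV" "finite B"
    "card B = CARD('a)" "ev ` B = eigenvalues A"
    "\<forall>l. card {b \<in> B. ev b = l} = dim (eigenspace A l)"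
    by (rule spectral_basis[OF sym])
  then have B: "finite B" "card B = CARD('a)" "ev ` B = eigenvalues A"
    "\<And>l. card {b \<in> B. ev b = l} = dim (eigenspace A l)"
    by auto
  have fin: "finite (eigenvalues A)" by (rule finite_eigenvalues[OF sym])
  show cnt: "count (eigenvalue_mset A) l = dim (eigenspace A l)" for l
  proof -
    have "count (eigenvalue_mset A) l = (\<Sum>k\<in>eigenvalues A. if k = l then dim (eigenspace A k) else 0)"
      unfolding eigenvalue_mset_def count_sum by (intro sum.cong) auto
    also have "\<dots> = (if l \<in> eigenvalues A then dim (eigenspace A l) else 0)"
      using fin by (simp add: sum.delta')
    also have "\<dots> = dim (eigenspace A l)"
      by (auto simp: eigenvalues_alt)
    finally show ?thesis .
  qed
  have "size (eigenvalue_mset A) = (\<Sum>l\<in>eigenvalues A. card {b \<in> B. ev b = l})"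
    unfolding eigenvalue_mset_def by (simp add: size_multiset_sum B(4))
  also have "\<dots> = card B"
    using card_image B(1,3) sum.group[of B "eigenvalues A" ev "\<lambda>_. 1::nat"] fin by auto
  finally show "size (eigenvalue_mset A) = CARD('a)" by (simp add: B)
  have "l \<in># eigenvalue_mset A \<longleftrightarrow> l \<in> eigenvalues A" for l
  proof -
    have "l \<in># eigenvalue_mset A \<longleftrightarrow> \<not> eigenspace A l \<subseteq> {0}"
      using cnt[of l] by (metis count_eq_zero_iff dim_eq_0)
    then show ?thesis
      using subspace_0[OF subspace_eigenspace[of A l]] by (auto simp: eigenvalues_alt)
  qed
  then show "set_mset (eigenvalue_mset A) = eigenvalues A" by blast
qed

text \<open>For semidefinite \<open>A\<close> the sorted list of eigenvalues starts with exactly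
  \<open>N\<close> zeros, so the next entry is the least positive eigenvalue. On the complement of
  the kernel the minimum of the Rayleigh quotient is a nonzero eigenvalue, hence at least that
  entry.\<close>

lemma eig_after_kernel:
  fixes A :: "real^'a^'a"
  assumes sym: "transpose A = A" and psd: "\<And>w. 0 \<le> w \<bullet> (A *v w)"
    and ker: "dim (eigenspace A 0) = N" and N: "N < CARD('a)"
  obtains v where "0 < eig (N + 1) A" "norm v = 1" "A *v v = eig (N + 1) A *\<^sub>R v"
    "\<And>u. A *v u = 0 \<Longrightarrow> u \<bullet> v = 0"
    "\<And>w. (\<And>u. A *v u = 0 \<Longrightarrow> u \<bullet> w = 0) \<Longrightarrow> eig (N + 1) A * (w \<bullet> w) \<le> w \<bullet> (A *v w)"
proof -
  let ?M = "eigenvalue_mset A"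
  let ?xs = "sorted_list_of_multiset ?M"
  define l where "l = eig (N + 1) A"
  have mset: "mset ?xs = ?M" by simp
  have len: "length ?xs = CARD('a)"
    using size_eigenvalue_mset[OF sym] by (metis mset size_mset)
  have srt: "sorted ?xs" by simp
  have nonneg: "0 \<le> k" if k: "k \<in> eigenvalues A" for k
  proof -
    obtain v where v: "v \<noteq> 0" "A *v v = k *\<^sub>R v" using k by (auto simp: eigenvalues_def)
    then have "0 \<le> k * (v \<bullet> v)" using psd[of v] by simp
    moreover have "0 < v \<bullet> v" using v(1) by simp
    ultimately show ?thesis by (simp add: zero_le_mult_iff del: inner_gt_zero_iff)
  qed
  have setxs: "set ?xs = eigenvalues A" using set_eigenvalue_mset[OF sym] by simp
  \<comment> \<open>\<open>eig\<close> counts from 1, list positions start at 0.\<close>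
  have l_xs: "l = ?xs ! N" by (simp add: l_def eig_def)
  have lin: "l \<in> eigenvalues A" using l_xs N len setxs nth_mem by metis
  have cnt: "card {i. i < length ?xs \<and> ?xs ! i = 0} = N"
  proof -
    have "{i. i < length ?xs \<and> ?xs ! i = 0} = {i. i < length ?xs \<and> 0 = ?xs ! i}" by auto
    also have "card \<dots> = count (mset ?xs) 0"
      by (simp only: count_mset count_list_eq_length_filter length_filter_conv_card)
    finally show ?thesis
      using count_eigenvalue_mset[OF sym, of 0] ker mset by simp
  qed
  have lpos: "0 < l"
  proof (rule ccontr)
    assume "\<not> 0 < l"
    then have l0: "l = 0" using nonneg[OF lin] by simp
    have "?xs ! i = 0" if "i \<le> N" for i
    proof -
      have "?xs ! i \<le> ?xs ! N" using that N len srt by (intro sorted_nth_mono) auto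
      moreover have "?xs ! i \<ge> 0" using nonneg setxs that N len nth_mem by (metis le_less_trans)
      ultimately show ?thesis using l0 l_xs by simp
    qed
    then have "{..N} \<subseteq> {i. i < length ?xs \<and> ?xs ! i = 0}" using N len by auto
    then have "card {..N} \<le> N" using cnt by (metis (no_types, lifting) card_mono finite_nat_set_iff_bounded mem_Collect_eq)
    then show False by simp
  qed
  have lmin: "l \<le> k" if k: "k \<in> eigenvalues A" "0 < k" for k
  proof -
    obtain i where i: "i < length ?xs" "?xs ! i = k" using k setxs by (metis in_set_conv_nth)
    show ?thesis
    proof (cases "N \<le> i")
      case True
      then show ?thesis using i srt l_xs sorted_nth_mono by metis
    next
      case False
      have "{j. j < length ?xs \<and> ?xs ! j = 0} \<subseteq> {..<i}"
      proof safe
        fix j assume j: "j < length ?xs" "?xs ! j = 0"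
        show "j < i"
        proof (rule ccontr)
          assume "\<not> j < i"
          then have "?xs ! i \<le> ?xs ! j" using j srt by (intro sorted_nth_mono) auto
          then show False using j i k by simp
        qed
      qed
      then have "N \<le> i" using cnt by (metis card_lessThan card_mono finite_lessThan)
      with False show ?thesis by simp
    qed
  qed
  obtain v0 where v0: "v0 \<noteq> 0" "A *v v0 = l *\<^sub>R v0" using lin by (auto simp: eigenvalues_def)
  define v where "v = (1 / norm v0) *\<^sub>R v0"
  have v: "norm v = 1" "A *v v = l *\<^sub>R v"
    using v0 by (simp_all add: v_def matrix_vector_mult_scaleR)
  have kerorth: "u \<bullet> v = 0" if "A *v u = 0" for u
    using eigenvectors_orthogonal[OF sym, of u 0 v l] that v lpos by (simp add: eigenspace_def)
  have bound: "l * (w \<bullet> w) \<le> w \<bullet> (A *v w)" if w: "\<And>u. A *v u = 0 \<Longrightarrow> u \<bullet> w = 0" for w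
  proof -
    define V where "V = {w. \<forall>u. A *v u = 0 \<longrightarrow> u \<bullet> w = 0}"
    have sV: "subspace V" by (auto simp: V_def subspace_def inner_add_right)
    have inv: "A *v z \<in> V" if "z \<in> V" for z
      unfolding V_def
    proof safe
      fix u assume "A *v u = 0"
      then show "u \<bullet> (A *v z) = 0" using inner_matrix_transpose[of A u z] sym by simp
    qed
    have "v \<in> V" using kerorth by (simp add: V_def)
    then have ne: "V \<noteq> {0}" using v by auto
    obtain z k where z: "z \<in> V" "norm z = 1" "A *v z = k *\<^sub>R z"
      and zmin: "\<And>w. w \<in> V \<Longrightarrow> k * (w \<bullet> w) \<le> w \<bullet> (A *v w)"
      using rayleigh_minimum[OF sym sV inv ne] by metis
    have ke: "k \<in> eigenvalues A" using z by (intro eigenvaluesI[of A z]) auto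
    have "k \<noteq> 0"
    proof
      assume "k = 0"
      then have "z \<bullet> z = 0" using z by (auto simp: V_def)
      then show False using z by simp
    qed
    then have "l \<le> k" using lmin[OF ke] nonneg[OF ke] by simp
    then have "l * (w \<bullet> w) \<le> k * (w \<bullet> w)" by (simp add: mult_right_mono)
    also have "\<dots> \<le> w \<bullet> (A *v w)" using zmin w by (simp add: V_def)
    finally show ?thesis .
  qed
  show ?thesis
    using that lpos v kerorth bound unfolding l_def by blast
qed

text \<open>\<open>rayleigh_minimum\<close> is applied to \<open>- A\<close> on the whole space: the
  minimum is minus an eigenvalue of \<open>A\<close>, and no eigenvalue exceeds the last entry of
  the sorted list.\<close>

lemma eig_last:
  fixes A :: "real^'a^'a"
  assumes sym: "transpose A = A"
  obtains v where "norm v = 1" "A *v v = eig CARD('a) A *\<^sub>R v"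
    "\<And>w. w \<bullet> (A *v w) \<le> eig CARD('a) A * (w \<bullet> w)"
proof -
  let ?M = "eigenvalue_mset A"
  let ?xs = "sorted_list_of_multiset ?M"
  define l where "l = eig CARD('a) A"
  have len: "length ?xs = CARD('a)"
    using size_eigenvalue_mset[OF sym] by (metis mset_sorted_list_of_multiset size_mset)
  have setxs: "set ?xs = eigenvalues A" using set_eigenvalue_mset[OF sym] by simp
  have last: "CARD('a) - 1 < length ?xs" using len by simp
  have l_xs: "l = ?xs ! (CARD('a) - 1)" by (simp add: l_def eig_def)
  have lin: "l \<in> eigenvalues A" using l_xs last setxs nth_mem by metis
  have lmax: "k \<le> l" if k: "k \<in> eigenvalues A" for k
  proof -
    obtain i where i: "i < length ?xs" "?xs ! i = k" using k setxs by (metis in_set_conv_nth)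
    then have "?xs ! i \<le> ?xs ! (CARD('a) - 1)"
      using last len by (intro sorted_nth_mono) auto
    then show ?thesis using i l_xs by simp
  qed
  obtain v0 where v0: "v0 \<noteq> 0" "A *v v0 = l *\<^sub>R v0" using lin by (auto simp: eigenvalues_def)
  define v where "v = (1 / norm v0) *\<^sub>R v0"
  have v: "norm v = 1" "A *v v = l *\<^sub>R v"
    using v0 by (simp_all add: v_def matrix_vector_mult_scaleR)
  have symm: "transpose (- A) = - A"
    using sym by (simp add: transpose_def vec_eq_iff)
  obtain z k where z: "norm z = 1" "(- A) *v z = k *\<^sub>R z"
    and zmin: "\<And>w. k * (w \<bullet> w) \<le> w \<bullet> ((- A) *v w)"
    using rayleigh_minimum[OF symm subspace_UNIV]
    by (metis UNIV_I UNIV_not_singleton)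
  have neg: "(- A) *v w = - (A *v w)" for w
    by (simp add: matrix_vector_mult_def vec_eq_iff sum_negf)
  have "A *v z = (- k) *\<^sub>R z" using z(2) by (metis neg minus_minus scaleR_minus_left)
  then have "- k \<in> eigenvalues A" using z(1) by (intro eigenvaluesI[of A z]) auto
  then have "- k \<le> l" by (rule lmax)
  have "w \<bullet> (A *v w) \<le> l * (w \<bullet> w)" for w
  proof -
    have "w \<bullet> (A *v w) \<le> (- k) * (w \<bullet> w)" using zmin[of w] by (simp add: neg)
    also have "\<dots> \<le> l * (w \<bullet> w)" using \<open>- k \<le> l\<close> by (simp only: mult_right_mono inner_ge_zero)
    finally show ?thesis .
  qed
  then show ?thesis using that v unfolding l_def by blast
qed

section \<open>Singular values\<close>

text \<open>The largest eigenvalue of the Gram matrix bounds its quadratic form, which is the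
  squared norm of \<open>A *v v\<close>; its root is one of the numbers whose maximum is
  \<open>sigma_max A\<close>.\<close>

lemma sigma_max_bound:
  fixes A :: "real^'b^'a"
  shows "norm (A *v v) \<le> sigma_max A * norm v"
    and "0 \<le> sigma_max A"
proof -
  let ?G = "transpose A ** A"
  have sym: "transpose ?G = ?G" by (simp add: matrix_transpose_mul)
  have quad: "w \<bullet> (?G *v w) = (norm (A *v w))\<^sup>2" for w
    by (metis inner_matrix_transpose matrix_vector_mul_assoc power2_norm_eq_inner)
  have fin: "finite (eigenvalues ?G)" by (rule finite_eigenvalues[OF sym])
  obtain z where z: "norm z = 1" "?G *v z = eig CARD('b) ?G *\<^sub>R z"
    and zmax: "\<And>w. w \<bullet> (?G *v w) \<le> eig CARD('b) ?G * (w \<bullet> w)"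
    using eig_last[OF sym] by metis
  let ?l = "eig CARD('b) ?G"
  have lin: "?l \<in> eigenvalues ?G" using z by (intro eigenvaluesI[of _ z]) auto
  have l0: "0 \<le> ?l"
  proof -
    have "z \<bullet> (?G *v z) = ?l" using z by (simp add: norm_eq_1)
    then show ?thesis using quad[of z] zero_le_power2[of "norm (A *v z)"] by linarith
  qed
  have le: "sqrt ?l \<le> sigma_max A"
    unfolding sigma_max_def using fin lin by (intro Max_ge) auto
  show "0 \<le> sigma_max A" using le l0 by (meson order_trans real_sqrt_ge_zero)
  have "norm (A *v v) = sqrt (v \<bullet> (?G *v v))" by (simp add: quad)
  also have "\<dots> \<le> sqrt (?l * (v \<bullet> v))" using zmax by simp
  also have "\<dots> = sqrt ?l * norm v" by (simp add: real_sqrt_mult norm_eq_sqrt_inner)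
  also have "\<dots> \<le> sigma_max A * norm v" using le by (simp add: mult_right_mono)
  finally show "norm (A *v v) \<le> sigma_max A * norm v" .
qed

lemma eigenvalues_similar:
  fixes A Q :: "real^'a^'a"
  assumes Q: "orthogonal_matrix Q"
  shows "eigenvalues (transpose Q ** A ** Q) = eigenvalues A"
proof -
  have QQ: "Q ** transpose Q = mat 1" "transpose Q ** Q = mat 1"
    using Q by (auto simp: orthogonal_matrix_def)
  have sub: "eigenvalues (transpose P ** B ** P) \<subseteq> eigenvalues B"
    if P: "P ** transpose P = mat 1" "transpose P ** P = mat 1" for P B :: "real^'a^'a"
  proof
    fix l assume "l \<in> eigenvalues (transpose P ** B ** P)"
    then obtain v where v: "v \<noteq> 0" "(transpose P ** B ** P) *v v = l *\<^sub>R v"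
      by (auto simp: eigenvalues_def)
    have "B *v (P *v v) = (P ** transpose P) *v (B *v (P *v v))" by (simp add: P)
    also have "\<dots> = P *v ((transpose P ** B ** P) *v v)"
      by (simp add: matrix_vector_mul_assoc matrix_mul_assoc)
    also have "\<dots> = l *\<^sub>R (P *v v)" by (simp add: v matrix_vector_mult_scaleR)
    finally have "B *v (P *v v) = l *\<^sub>R (P *v v)" .
    moreover have "P *v v \<noteq> 0"
    proof
      assume "P *v v = 0"
      then have "transpose P *v (P *v v) = 0" by simp
      then show False using v(1) P by (simp add: matrix_vector_mul_assoc)
    qed
    ultimately show "l \<in> eigenvalues B" by (auto simp: eigenvalues_def)
  qed
  have "A = transpose (transpose Q) ** (transpose Q ** A ** Q) ** transpose Q"
    using QQ by (metis matrix_mul_assoc matrix_mul_lid matrix_mul_rid transpose_transpose)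
  then show ?thesis
    using sub[OF QQ, of A] sub[of "transpose Q" "transpose Q ** A ** Q"] QQ
    by (metis subset_antisym transpose_transpose)
qed

lemma sigma_max_mult_orthogonal_right:
  fixes A :: "real^'b^'a" and Q :: "real^'b^'b"
  assumes "orthogonal_matrix Q"
  shows "sigma_max (A ** Q) = sigma_max A"
  using eigenvalues_similar[OF assms, of "transpose A ** A"]
  by (simp add: sigma_max_def matrix_transpose_mul matrix_mul_assoc)

lemma sigma_max_mult_orthogonal_left:
  fixes A :: "real^'b^'a" and Q :: "real^'a^'a"
  assumes "orthogonal_matrix Q"
  shows "sigma_max (Q ** A) = sigma_max A"
proof -
  have "transpose (Q ** A) ** (Q ** A) = transpose A ** (transpose Q ** Q) ** A"
    by (simp add: matrix_transpose_mul matrix_mul_assoc)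
  then show ?thesis
    using assms by (simp add: sigma_max_def orthogonal_matrix_def)
qed

section \<open>The patch-stress matrix is symmetric\<close>

definition is_pinv :: "real^'b^'a \<Rightarrow> real^'a^'b \<Rightarrow> bool" where
  "is_pinv A X \<longleftrightarrow> A ** X ** A = A \<and> X ** A ** X = X \<and>
     transpose (A ** X) = A ** X \<and> transpose (X ** A) = X ** A"

text \<open>Penrose's argument: symmetry of the projections gives \<open>A ** X = A ** Y\<close> and
  \<open>Y ** A = X ** A\<close>, and so both inverses equal \<open>X ** A ** Y\<close>.\<close>

lemma is_pinv_unique:
  assumes X: "is_pinv A X" and Y: "is_pinv A Y"
  shows "X = Y"
proof -
  have "X = X ** (A ** X)" using X by (simp add: is_pinv_def matrix_mul_assoc)
  also have "A ** X = A ** Y ** (A ** X)" using Y by (simp add: is_pinv_def matrix_mul_assoc)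
  also have "\<dots> = transpose (A ** X ** (A ** Y))"
    using X Y by (simp add: is_pinv_def matrix_transpose_mul[of "A ** X" "A ** Y"])
  also have "A ** X ** (A ** Y) = A ** Y" using X by (simp add: is_pinv_def matrix_mul_assoc)
  also have "transpose (A ** Y) = A ** Y" using Y by (simp add: is_pinv_def)
  finally have 1: "X = X ** A ** Y" by (simp add: matrix_mul_assoc)
  have "Y = (Y ** A) ** Y" using Y by (simp add: is_pinv_def)
  also have "Y ** A = Y ** A ** (X ** A)" using X by (simp add: is_pinv_def matrix_mul_assoc[symmetric])
  also have "\<dots> = transpose (X ** A ** (Y ** A))"
    using X Y by (simp add: is_pinv_def matrix_transpose_mul[of "X ** A" "Y ** A"])
  also have "X ** A ** (Y ** A) = X ** A" using Y by (simp add: is_pinv_def matrix_mul_assoc[symmetric])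
  also have "transpose (X ** A) = X ** A" using X by (simp add: is_pinv_def)
  finally show ?thesis using 1 by simp
qed

lemma is_pinv_exists:
  fixes A :: "real^'a^'a"
  assumes sym: "transpose A = A"
  obtains X where "is_pinv A X"
proof -
  obtain B ev where "pairwise orthogonal B" "\<forall>b\<in>B. norm b = 1"
    "\<forall>b\<in>B. A *v b = ev b *\<^sub>R b" "independent B" "span B = UNIV" "finite B"
    "card B = CARD('a)" "ev ` B = eigenvalues A"
    "\<forall>l. card {b \<in> B. ev b = l} = dim (eigenspace A l)"
    by (rule spectral_basis[OF sym])
  then have B: "pairwise orthogonal B" "\<And>b. b \<in> B \<Longrightarrow> norm b = 1"
    "\<And>b. b \<in> B \<Longrightarrow> A *v b = ev b *\<^sub>R b" "span B = UNIV" "finite B"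
    by auto
  define D where "D f = (\<Sum>b\<in>B. f b *\<^sub>R outer b b)" for f :: "_ \<Rightarrow> real"
  have outer_v: "outer b b *v v = (b \<bullet> v) *\<^sub>R b" for b v :: "real^'a"
    by (simp add: outer_def matrix_vector_mult_def vec_eq_iff inner_vec_def sum_distrib_left
        sum_distrib_right mult_ac)
  have sum_v: "(\<Sum>b\<in>B. h b) *v v = (\<Sum>b\<in>B. h b *v v)" for h :: "_ \<Rightarrow> real^'a^'a" and v
    using B(5) by (induction rule: finite_induct) (simp_all add: matrix_vector_mult_add_rdistrib)
  have sc: "(r *\<^sub>R (M :: real^'a^'a)) *v v = r *\<^sub>R (M *v v)" for r M v
    by (simp add: scaleR_matrix_vector_assoc)
  have Db: "D f *v b = f b *\<^sub>R b" if b: "b \<in> B" for f b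
  proof -
    have "D f *v b = (\<Sum>c\<in>B. (f c * (c \<bullet> b)) *\<^sub>R c)"
      by (simp add: D_def sum_v sc outer_v)
    also have "\<dots> = (\<Sum>c\<in>B. if c = b then f b *\<^sub>R b else 0)"
    proof (rule sum.cong[OF refl])
      fix c assume c: "c \<in> B"
      show "(f c * (c \<bullet> b)) *\<^sub>R c = (if c = b then f b *\<^sub>R b else 0)"
        using B(1) B(2)[OF b] b c
        by (auto simp: pairwise_def orthogonal_def norm_eq_1)
    qed
    finally show ?thesis using b B(5) by simp
  qed
  have ext: "M = N" if "\<And>b. b \<in> B \<Longrightarrow> M *v b = N *v b" for M N :: "real^'a^'a"
  proof -
    have "M *v v = N *v v" for v
    proof -
      have "v \<in> span B" using B(4) by simp
      then show ?thesis
        by (induction rule: span_induct_alt)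
          (simp_all add: matrix_vector_right_distrib matrix_vector_mult_scaleR that)
    qed
    then show ?thesis by (simp add: matrix_eq)
  qed
  have mulb: "(M ** N) *v b = M *v (N *v b)" for M N :: "real^'a^'a" and b
    by (simp add: matrix_vector_mul_assoc)
  have AD: "A = D ev" by (rule ext) (simp add: B(3) Db)
  have DD: "D f ** D g = D (\<lambda>b. f b * g b)" for f g
    by (rule ext) (simp add: mulb Db matrix_vector_mult_scaleR)
  have Dsym: "transpose (D f) = D f" for f
    by (simp add: D_def transpose_def vec_eq_iff outer_def mult.commute)
  \<comment> \<open>With the convention \<open>inverse 0 = 0\<close> these identities also hold in
    the kernel directions, which is what a pseudoinverse needs.\<close>
  have inv: "r * inverse r * r = r" "inverse r * r * inverse r = inverse r" for r :: real
    by (cases "r = 0"; simp)+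
  have "is_pinv A (D (\<lambda>b. inverse (ev b)))"
    unfolding is_pinv_def AD DD Dsym by (simp add: inv)
  then show ?thesis using that by blast
qed

text \<open>For symmetric \<open>A\<close> transposition carries the Penrose conditions to
  themselves, so uniqueness forces the inverse to be symmetric.\<close>

lemma transpose_pinv:
  fixes A :: "real^'a^'a"
  assumes sym: "transpose A = A"
  shows "transpose (pinv A) = pinv A"
proof -
  obtain X where X: "is_pinv A X" using is_pinv_exists[OF sym] .
  have pX: "pinv A = X"
    unfolding pinv_def is_pinv_def[symmetric]
    using X is_pinv_unique[OF _ X] by (rule the_equality)
  have t: "transpose X ** A = transpose (A ** X)" "A ** transpose X = transpose (X ** A)"
    by (simp_all add: matrix_transpose_mul sym)
  have "is_pinv A (transpose X)"
    unfolding is_pinv_def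
  proof (intro conjI)
    show "A ** transpose X ** A = A"
    proof -
      have "A ** transpose X ** A = transpose (A ** X ** A)"
        by (simp add: matrix_transpose_mul sym matrix_mul_assoc)
      then show ?thesis using X sym by (simp add: is_pinv_def)
    qed
    show "transpose X ** A ** transpose X = transpose X"
    proof -
      have "transpose X ** A ** transpose X = transpose (X ** A ** X)"
        by (simp add: matrix_transpose_mul sym matrix_mul_assoc)
      then show ?thesis using X by (simp add: is_pinv_def)
    qed
    show "transpose (A ** transpose X) = A ** transpose X"
      using X by (simp add: t is_pinv_def)
    show "transpose (transpose X ** A) = transpose X ** A"
      using X by (simp add: t is_pinv_def)
  qed
  then show ?thesis using is_pinv_unique X pX by metis
qed

lemma transpose_sum: "transpose (\<Sum>e\<in>E. h e) = (\<Sum>e\<in>E. transpose (h e))"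
  by (simp add: transpose_def vec_eq_iff)

lemma transpose_patch_stress: "transpose (patch_stress E x) = patch_stress E x"
proof -
  have oT: "transpose (outer u u) = outer u u" for u :: "real^'e"
    by (simp add: transpose_def outer_def mult.commute)
  have D: "transpose (patch_D E x) = patch_D E x"
    by (simp add: patch_D_def transpose_sum split_def matrix_transpose_mul oT matrix_mul_assoc)
  have L: "transpose (graph_laplacian E) = graph_laplacian E"
    by (simp add: graph_laplacian_def transpose_sum split_def oT)
  have diff: "transpose (M - N) = transpose M - transpose N" for M N :: "real^'e^'e"
    by (simp add: transpose_def vec_eq_iff)
  show ?thesis
    by (simp add: patch_stress_def diff D matrix_transpose_mul transpose_pinv[OF L] matrix_mul_assoc)
qed

section \<open>Smooth maps\<close>

lemma Ck_on_cong:
  assumes "open U" "\<And>x. x \<in> U \<Longrightarrow> f x = g x" "Ck_on k U f"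
  shows "Ck_on k U g"
  using assms(2,3)
proof (induction k arbitrary: f g)
  case 0
  then show ?case by (metis Ck_on.simps(1) continuous_on_eq)
next
  case (Suc k)
  have D: "(g has_derivative frechet_derivative f (at x)) (at x)" if "x \<in> U" for x
    using Suc.prems that \<open>open U\<close> has_derivative_transform_within_open[of f _ x UNIV U g]
    by (auto simp: frechet_derivative_works)
  have "g differentiable (at x)" if "x \<in> U" for x
    using D[OF that] by (auto simp: differentiable_def)
  moreover have "Ck_on k U (\<lambda>x. frechet_derivative g (at x) v)" for v
    by (rule Suc.IH[of "\<lambda>x. frechet_derivative f (at x) v"])
      (use Suc.prems frechet_derivative_at[OF D] in auto)
  ultimately show ?case by simp
qed

text \<open>\<open>Ck_on\<close> refers to \<open>frechet_derivative\<close>; this rule lets an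
  explicit derivative be supplied instead, and each closure property becomes an induction on the
  order that is general in the functions.\<close>

lemma Ck_on_SucI:
  assumes "open U" "\<And>x. x \<in> U \<Longrightarrow> (f has_derivative D x) (at x)" "\<And>v. Ck_on k U (\<lambda>x. D x v)"
  shows "Ck_on (Suc k) U f"
proof -
  have "frechet_derivative f (at x) = D x" if "x \<in> U" for x
    using frechet_derivative_at assms(2) that by metis
  then show ?thesis
    using assms Ck_on_cong[OF \<open>open U\<close>, of "\<lambda>x. D x v" "\<lambda>x. frechet_derivative f (at x) v" k for v]
    by (auto simp: differentiable_def)
qed

lemma Ck_on_SucD: "Ck_on (Suc k) U f \<Longrightarrow> Ck_on k U f"
proof (induction k arbitrary: f)
  case 0
  then show ?case
    by (auto intro!: continuous_at_imp_continuous_on differentiable_imp_continuous_within)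
next
  case (Suc k)
  then show ?case by (metis Ck_on.simps(2))
qed

lemma Ck_on_derivative:
  assumes "Ck_on (Suc k) U f" "x \<in> U"
  shows "(f has_derivative frechet_derivative f (at x)) (at x)"
  using assms by (simp add: frechet_derivative_works[symmetric])

lemma Ck_on_subset: "Ck_on k U f \<Longrightarrow> V \<subseteq> U \<Longrightarrow> Ck_on k V f"
  by (induction k arbitrary: f) (auto intro: continuous_on_subset)

lemma Ck_on_const: "Ck_on k U (\<lambda>x. c)"
  by (induction k arbitrary: c) auto

lemma Ck_on_add:
  assumes "open U" "Ck_on k U f" "Ck_on k U g"
  shows "Ck_on k U (\<lambda>x. f x + g x)"
  using assms(2,3)
proof (induction k arbitrary: f g)
  case 0
  then show ?case by (auto intro: continuous_intros)
next
  case (Suc k)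
  show ?case
    by (rule Ck_on_SucI[OF \<open>open U\<close> has_derivative_add[OF Suc.prems[THEN Ck_on_derivative]]])
      (use Suc in auto)
qed

lemma Ck_on_bounded_linear:
  assumes "bounded_linear h" "open U" "Ck_on k U f"
  shows "Ck_on k U (\<lambda>x. h (f x))"
  using assms(3)
proof (induction k arbitrary: f)
  case 0
  then show ?case
    using assms(1) by (auto intro: linear_continuous_on_compose bounded_linear.continuous_on)
next
  case (Suc k)
  show ?case
    by (rule Ck_on_SucI[OF \<open>open U\<close> bounded_linear.has_derivative[OF assms(1) Suc.prems[THEN Ck_on_derivative]]])
      (use Suc in auto)
qed

lemma Ck_on_bounded_bilinear:
  assumes "bounded_bilinear h" "open U" "Ck_on k U f" "Ck_on k U g"
  shows "Ck_on k U (\<lambda>x. h (f x) (g x))"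
  using assms(3,4)
proof (induction k arbitrary: f g)
  case 0
  then show ?case
    using bounded_bilinear.continuous_on[OF assms(1)] by auto
next
  case (Suc k)
  have 1: "((\<lambda>x. h (f x) (g x)) has_derivative
      (\<lambda>v. h (f x) (frechet_derivative g (at x) v) + h (frechet_derivative f (at x) v) (g x))) (at x)"
    if "x \<in> U" for x
    using bounded_bilinear.FDERIV[OF assms(1) Suc.prems[THEN Ck_on_derivative, OF that]] .
  show ?case
    by (rule Ck_on_SucI[OF \<open>open U\<close> 1])
      (use Suc Suc.prems[THEN Ck_on_SucD] in \<open>auto intro!: Ck_on_add[OF \<open>open U\<close>]\<close>)
qed

lemma Ck_on_ident: "open U \<Longrightarrow> Ck_on k U (\<lambda>x. x)"
  by (cases k) (auto intro!: Ck_on_SucI[of U _ "\<lambda>x v. v"] Ck_on_const)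

lemma smooth_on_differentiable:
  assumes "smooth_on U f" "x \<in> U"
  shows "(f has_derivative frechet_derivative f (at x)) (at x)"
  using assms Ck_on_derivative[of 0 U f] unfolding smooth_on_def by blast

lemma smooth_on_derivative: "smooth_on U f \<Longrightarrow> smooth_on U (\<lambda>x. frechet_derivative f (at x) v)"
  unfolding smooth_on_def using Ck_on.simps(2) by blast

lemma smooth_on_const: "smooth_on U (\<lambda>x. c)"
  by (simp add: smooth_on_def Ck_on_const)

lemma smooth_on_ident: "open U \<Longrightarrow> smooth_on U (\<lambda>x. x)"
  by (simp add: smooth_on_def Ck_on_ident)

lemma smooth_on_add:
  "open U \<Longrightarrow> smooth_on U f \<Longrightarrow> smooth_on U g \<Longrightarrow> smooth_on U (\<lambda>x. f x + g x)"
  by (simp add: smooth_on_def Ck_on_add)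

lemma smooth_on_bounded_linear:
  "bounded_linear h \<Longrightarrow> open U \<Longrightarrow> smooth_on U f \<Longrightarrow> smooth_on U (\<lambda>x. h (f x))"
  by (simp add: smooth_on_def Ck_on_bounded_linear)

lemma smooth_on_bounded_bilinear:
  "bounded_bilinear h \<Longrightarrow> open U \<Longrightarrow> smooth_on U f \<Longrightarrow> smooth_on U g \<Longrightarrow> smooth_on U (\<lambda>x. h (f x) (g x))"
  by (simp add: smooth_on_def Ck_on_bounded_bilinear)

lemma smooth_on_subset: "smooth_on U f \<Longrightarrow> V \<subseteq> U \<Longrightarrow> smooth_on V f"
  unfolding smooth_on_def using Ck_on_subset by blast

lemma smooth_mapI:
  assumes "smooth_on UNIV h" "\<And>x. x \<in> M \<Longrightarrow> f x = h x"
  shows "smooth_map M f"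
  using assms unfolding smooth_map_def by blast

lemma smooth_map_cong:
  "smooth_map M f \<Longrightarrow> (\<And>x. x \<in> M \<Longrightarrow> f x = g x) \<Longrightarrow> smooth_map M g"
  unfolding smooth_map_def by metis

lemma smooth_map_const: "smooth_map M (\<lambda>x. c)"
  by (rule smooth_mapI[OF smooth_on_const]) simp

lemma smooth_map_ident: "smooth_map M (\<lambda>x. x)"
  by (rule smooth_mapI[OF smooth_on_ident]) simp_all

lemma smooth_map_bounded_linear:
  assumes h: "bounded_linear h" and f: "smooth_map M f"
  shows "smooth_map M (\<lambda>x. h (f x))"
proof -
  obtain U e where "open U" "M \<subseteq> U" "smooth_on U e" "\<And>x. x \<in> M \<Longrightarrow> f x = e x"
    using f unfolding smooth_map_def by blast
  then show ?thesis unfolding smooth_map_def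
    by (intro exI[of _ U] exI[of _ "\<lambda>x. h (e x)"]) (simp add: smooth_on_bounded_linear[OF h])
qed

lemma smooth_map_bounded_bilinear:
  assumes h: "bounded_bilinear h" and f: "smooth_map M f" and g: "smooth_map M g"
  shows "smooth_map M (\<lambda>x. h (f x) (g x))"
proof -
  obtain U a where a: "open U" "M \<subseteq> U" "smooth_on U a" "\<And>x. x \<in> M \<Longrightarrow> f x = a x"
    using f unfolding smooth_map_def by blast
  obtain V b where b: "open V" "M \<subseteq> V" "smooth_on V b" "\<And>x. x \<in> M \<Longrightarrow> g x = b x"
    using g unfolding smooth_map_def by blast
  have "smooth_on (U \<inter> V) (\<lambda>x. h (a x) (b x))"
    using a b by (intro smooth_on_bounded_bilinear[OF h]) (auto intro: smooth_on_subset)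
  then show ?thesis unfolding smooth_map_def
    using a b by (intro exI[of _ "U \<inter> V"] exI[of _ "\<lambda>x. h (a x) (b x)"]) auto
qed

lemma smooth_map_add:
  assumes f: "smooth_map M f" and g: "smooth_map M g"
  shows "smooth_map M (\<lambda>x. f x + g x)"
proof -
  obtain U a where a: "open U" "M \<subseteq> U" "smooth_on U a" "\<And>x. x \<in> M \<Longrightarrow> f x = a x"
    using f unfolding smooth_map_def by blast
  obtain V b where b: "open V" "M \<subseteq> V" "smooth_on V b" "\<And>x. x \<in> M \<Longrightarrow> g x = b x"
    using g unfolding smooth_map_def by blast
  have "smooth_on (U \<inter> V) (\<lambda>x. a x + b x)"
    using a b by (intro smooth_on_add) (auto intro: smooth_on_subset)
  then show ?thesis unfolding smooth_map_def
    using a b by (intro exI[of _ "U \<inter> V"] exI[of _ "\<lambda>x. a x + b x"]) auto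
qed

lemma smooth_map_scaleR_const: "smooth_map M f \<Longrightarrow> smooth_map M (\<lambda>x. c *\<^sub>R f x)"
  by (rule smooth_map_bounded_linear[OF bounded_linear_scaleR_right])

lemma smooth_map_diff: "smooth_map M f \<Longrightarrow> smooth_map M g \<Longrightarrow> smooth_map M (\<lambda>x. f x - g x)"
  using smooth_map_add[of M f "\<lambda>x. (- 1) *\<^sub>R g x"] smooth_map_scaleR_const[of M g "- 1"] by simp

lemma smooth_map_sum:
  assumes "\<And>i. i \<in> I \<Longrightarrow> smooth_map M (f i)"
  shows "smooth_map M (\<lambda>x. \<Sum>i\<in>I. f i x)"
  using assms
  by (induction I rule: infinite_finite_induct) (auto intro: smooth_map_const smooth_map_add)

section \<open>Symmetry of second derivatives\<close>

text \<open>The mean value theorem is used twice: in direction \<open>b\<close> for the difference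
  of \<open>h\<close> between two parallel segments, then in direction \<open>c\<close> for the
  derivative found there.\<close>

lemma mixed_second_difference:
  fixes h :: "'a::real_normed_vector \<Rightarrow> real"
  assumes h: "\<And>y. y \<in> ball x r \<Longrightarrow> (h has_derivative h' y) (at y)"
    and k: "\<And>y. y \<in> ball x r \<Longrightarrow> ((\<lambda>y. h' y b) has_derivative k y) (at y)"
    and t: "0 < t" "t * (norm b + norm c) < r"
  obtains y where "y \<in> ball x r"
    "h (x + t *\<^sub>R b + t *\<^sub>R c) - h (x + t *\<^sub>R b) - h (x + t *\<^sub>R c) + h x = t * t * k y c"
proof -
  have inb: "x + s *\<^sub>R b + q *\<^sub>R c \<in> ball x r" if "0 \<le> s" "s \<le> t" "0 \<le> q" "q \<le> t" for s q
  proof -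
    have "norm (s *\<^sub>R b + q *\<^sub>R c) \<le> s * norm b + q * norm c"
      using that by (intro norm_triangle_le) simp
    also have "\<dots> \<le> t * norm b + t * norm c"
      using that by (intro add_mono mult_right_mono) auto
    also have "\<dots> < r" using t by (simp add: algebra_simps)
    finally have "norm (s *\<^sub>R b + q *\<^sub>R c) < r" .
    moreover have "dist x (x + s *\<^sub>R b + q *\<^sub>R c) = norm (s *\<^sub>R b + q *\<^sub>R c)"
      by (metis add.assoc add_diff_cancel_left' dist_commute dist_norm)
    ultimately show ?thesis by simp
  qed
  have lin: "h' y (s *\<^sub>R v) = s * h' y v" "k y (s *\<^sub>R v) = s * k y v" if "y \<in> ball x r" for y s v
    using has_derivative_linear[OF h[OF that]] has_derivative_linear[OF k[OF that]]
    by (simp_all add: linear_cmul)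
  have d1: "((\<lambda>s. h (x + s *\<^sub>R b + q *\<^sub>R c)) has_real_derivative h' (x + s *\<^sub>R b + q *\<^sub>R c) b) (at s)"
    if "0 \<le> s" "s \<le> t" "0 \<le> q" "q \<le> t" for s q
  proof -
    have "((\<lambda>s. x + s *\<^sub>R b + q *\<^sub>R c) has_derivative (\<lambda>s. s *\<^sub>R b)) (at s)"
      by (auto intro!: derivative_eq_intros)
    from has_derivative_compose[OF this h[OF inb[OF that]]]
    show ?thesis unfolding has_field_derivative_def
      by (rule has_derivative_eq_rhs) (simp add: fun_eq_iff lin(1)[OF inb[OF that]])
  qed
  have d2: "((\<lambda>q. h' (x + s *\<^sub>R b + q *\<^sub>R c) b) has_real_derivative k (x + s *\<^sub>R b + q *\<^sub>R c) c) (at q)"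
    if "0 \<le> s" "s \<le> t" "0 \<le> q" "q \<le> t" for s q
  proof -
    have "((\<lambda>q. x + s *\<^sub>R b + q *\<^sub>R c) has_derivative (\<lambda>q. q *\<^sub>R c)) (at q)"
      by (auto intro!: derivative_eq_intros)
    from has_derivative_compose[OF this k[OF inb[OF that]]]
    show ?thesis unfolding has_field_derivative_def
      by (rule has_derivative_eq_rhs) (simp add: fun_eq_iff lin(2)[OF inb[OF that]])
  qed
  define u where "u s = h (x + s *\<^sub>R b + t *\<^sub>R c) - h (x + s *\<^sub>R b + 0 *\<^sub>R c)" for s
  have "\<exists>z. 0 < z \<and> z < t \<and>
      u t - u 0 = (t - 0) * (h' (x + z *\<^sub>R b + t *\<^sub>R c) b - h' (x + z *\<^sub>R b + 0 *\<^sub>R c) b)"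
    unfolding u_def using t by (intro MVT2 DERIV_diff d1) auto
  then obtain z where z: "0 < z" "z < t"
    "u t - u 0 = t * (h' (x + z *\<^sub>R b + t *\<^sub>R c) b - h' (x + z *\<^sub>R b + 0 *\<^sub>R c) b)" by auto
  have "\<exists>q. 0 < q \<and> q < t \<and>
      h' (x + z *\<^sub>R b + t *\<^sub>R c) b - h' (x + z *\<^sub>R b + 0 *\<^sub>R c) b = (t - 0) * k (x + z *\<^sub>R b + q *\<^sub>R c) c"
    using t z by (intro MVT2[of 0 t "\<lambda>q. h' (x + z *\<^sub>R b + q *\<^sub>R c) b"] d2) auto
  then obtain q where q: "0 < q" "q < t"
    "h' (x + z *\<^sub>R b + t *\<^sub>R c) b - h' (x + z *\<^sub>R b + 0 *\<^sub>R c) b = t * k (x + z *\<^sub>R b + q *\<^sub>R c) c" by auto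
  show ?thesis
  proof (rule that)
    show "x + z *\<^sub>R b + q *\<^sub>R c \<in> ball x r" using inb z q by simp
    show "h (x + t *\<^sub>R b + t *\<^sub>R c) - h (x + t *\<^sub>R b) - h (x + t *\<^sub>R c) + h x
        = t * t * k (x + z *\<^sub>R b + q *\<^sub>R c) c"
      using z(3) q(3) by (simp add: u_def algebra_simps)
  qed
qed

text \<open>The second difference over a parallelogram does not see the order of \<open>b\<close>
  and \<open>c\<close>. Shrinking the parallelogram turns it into either mixed derivative, by
  continuity of the second derivatives.\<close>

lemma second_derivative_symmetric:
  fixes h :: "'a::real_normed_vector \<Rightarrow> real"
  assumes U: "open U" "x \<in> U" and h: "smooth_on U h"
  shows "frechet_derivative (\<lambda>y. frechet_derivative h (at y) b) (at x) c =
         frechet_derivative (\<lambda>y. frechet_derivative h (at y) c) (at x) b"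
proof -
  define k where "k b y = frechet_derivative (\<lambda>y. frechet_derivative h (at y) b) (at y)" for b y
  have hd: "(h has_derivative frechet_derivative h (at y)) (at y)" if "y \<in> U" for y
    using smooth_on_differentiable[OF h that] .
  have kd: "((\<lambda>y. frechet_derivative h (at y) b) has_derivative k b y) (at y)" if "y \<in> U" for y b
    unfolding k_def using smooth_on_differentiable[OF smooth_on_derivative[OF h] that] .
  have "continuous_on U (\<lambda>y. k b y c)" for b c
    unfolding k_def using smooth_on_derivative[OF smooth_on_derivative[OF h]]
    by (metis Ck_on.simps(1) smooth_on_def)
  then have cont: "isCont (\<lambda>y. k b y c) x" for b c
    using U by (simp add: continuous_on_eq_continuous_at)
  have "\<bar>k b x c - k c x b\<bar> \<le> e" if e: "0 < e" for e
  proof -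
    have near: "\<forall>\<^sub>F y in nhds x. \<bar>k b y c - k b x c\<bar> < e / 2" for b c
    proof -
      have "((\<lambda>y. k b y c) \<longlongrightarrow> k b x c) (nhds x)"
        using cont[of b c] isCont_def tendsto_at_iff_tendsto_nhds by metis
      from tendstoD[OF this, of "e / 2"] e show ?thesis by (simp add: dist_real_def)
    qed
    note near[of b c] near[of c b]
    moreover have "\<forall>\<^sub>F y in nhds x. y \<in> U"
      using U by (simp add: eventually_nhds) blast
    ultimately have "\<forall>\<^sub>F y in nhds x. y \<in> U \<and> \<bar>k b y c - k b x c\<bar> < e / 2 \<and> \<bar>k c y b - k c x b\<bar> < e / 2"
      by eventually_elim simp
    then obtain r where r: "0 < r" "\<And>y. y \<in> ball x r \<Longrightarrow>
        y \<in> U \<and> \<bar>k b y c - k b x c\<bar> < e / 2 \<and> \<bar>k c y b - k c x b\<bar> < e / 2"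
      unfolding eventually_nhds_metric by (auto simp: dist_commute)
    \<comment> \<open>Small enough to keep the parallelogram inside the ball; the summand 1 covers
      the case that both vectors are zero.\<close>
    define t where "t = r / (2 * (norm b + norm c + 1))"
    have np: "0 < norm b + norm c + 1" using norm_ge_zero[of b] norm_ge_zero[of c] by linarith
    have t0: "0 < t" using np r by (simp add: t_def)
    have "t * (norm b + norm c) < t * (norm b + norm c + 1)" using t0 by simp
    also have "\<dots> = r / 2" using np by (simp add: t_def field_simps)
    also have "\<dots> < r" using r by simp
    finally have t1: "t * (norm b + norm c) < r" .
    then have t2: "t * (norm c + norm b) < r" by (simp add: add.commute)
    obtain y where y: "y \<in> ball x r"
      "h (x + t *\<^sub>R b + t *\<^sub>R c) - h (x + t *\<^sub>R b) - h (x + t *\<^sub>R c) + h x = t * t * k b y c"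
      using mixed_second_difference[OF hd kd t0 t1] r by blast
    obtain z where z: "z \<in> ball x r"
      "h (x + t *\<^sub>R c + t *\<^sub>R b) - h (x + t *\<^sub>R c) - h (x + t *\<^sub>R b) + h x = t * t * k c z b"
      using mixed_second_difference[OF hd kd t0 t2] r by blast
    have "t * t * k b y c = t * t * k c z b"
    proof -
      have eq: "x + t *\<^sub>R c + t *\<^sub>R b = x + t *\<^sub>R b + t *\<^sub>R c" by (simp add: algebra_simps)
      show ?thesis using y(2) z(2)[unfolded eq] by linarith
    qed
    then have "k b y c = k c z b" using t0 by simp
    then show ?thesis using r(2)[OF y(1)] r(2)[OF z(1)] by linarith
  qed
  then have "k b x c = k c x b"
    using field_le_epsilon[of "\<bar>k b x c - k c x b\<bar>" 0] by simp
  then show ?thesis by (simp add: k_def)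
qed

section \<open>Derivatives along a submanifold\<close>

text \<open>A derivative within \<open>M\<close> is not unique, but its composition with a curve in
  \<open>M\<close> of velocity \<open>v\<close> is an ordinary derivative at 0, which is unique.
  This is how \<open>mderiv\<close> is evaluated from here on.\<close>

lemma mderiv_eqI:
  assumes f: "(f has_derivative D) (at x within M)" and v: "v \<in> tangent_space M x"
  shows "mderiv M f x v = D v"
proof -
  obtain e c where e: "0 < e" and c: "c ` {-e<..<e} \<subseteq> M" "c 0 = x"
    and cv: "(c has_vector_derivative v) (at (0::real))"
    using v unfolding tangent_space_def by blast
  have "f differentiable (at x within M)" using f by (auto simp: differentiable_def)
  then have f': "(f has_derivative mderiv M f x) (at x within M)"
    by (simp add: mderiv_def[abs_def] frechet_derivative_works)
  have cd: "(c has_derivative (\<lambda>s. s *\<^sub>R v)) (at 0 within {-e<..<e})"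
    using cv by (auto simp: has_vector_derivative_def intro: has_derivative_at_withinI)
  have "(f \<circ> c has_derivative D' \<circ> (\<lambda>s. s *\<^sub>R v)) (at 0)"
    if "(f has_derivative D') (at x within M)" for D'
    using diff_chain_within[OF cd has_derivative_subset[OF _ c(1)]] that c(2) e
    by (simp add: at_within_open[of 0 "{-e<..<e}"])
  from has_derivative_unique[OF this[OF f] this[OF f']]
  show ?thesis by (metis comp_apply scaleR_one)
qed

lemma has_derivative_mderiv:
  assumes "smooth_map M f" "x \<in> M"
  shows "(f has_derivative mderiv M f x) (at x within M)"
proof -
  obtain U h where h: "open U" "M \<subseteq> U" "smooth_on U h" "\<And>x. x \<in> M \<Longrightarrow> f x = h x"
    using assms(1) unfolding smooth_map_def by blast
  have D: "(h has_derivative frechet_derivative h (at x)) (at x within M)"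
    by (rule has_derivative_at_withinI[OF smooth_on_differentiable[OF h(3) subsetD[OF h(2) assms(2)]]])
  have "(f has_derivative frechet_derivative h (at x)) (at x within M)"
    by (rule has_derivative_transform[OF assms(2) _ D]) (rule h(4))
  then have "f differentiable (at x within M)" by (auto simp: differentiable_def)
  then show ?thesis by (simp add: mderiv_def[abs_def] frechet_derivative_works)
qed

lemma mderiv_extension:
  assumes "U \<supseteq> M" "smooth_on U h" "\<And>x. x \<in> M \<Longrightarrow> f x = h x" "x \<in> M" "v \<in> tangent_space M x"
  shows "mderiv M f x v = frechet_derivative h (at x) v"
proof (rule mderiv_eqI[OF _ assms(5)])
  have D: "(h has_derivative frechet_derivative h (at x)) (at x within M)"
    by (rule has_derivative_at_withinI[OF smooth_on_differentiable[OF assms(2) subsetD[OF assms(1,4)]]])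
  show "(f has_derivative frechet_derivative h (at x)) (at x within M)"
    by (rule has_derivative_transform[OF assms(4) _ D]) (rule assms(3))
qed

lemma linear_mderiv:
  "smooth_map M f \<Longrightarrow> x \<in> M \<Longrightarrow> linear (mderiv M f x)"
  using has_derivative_linear[OF has_derivative_mderiv] .

lemma mderiv_cong:
  assumes "smooth_map M f" "x \<in> M" "\<And>y. y \<in> M \<Longrightarrow> g y = f y" "v \<in> tangent_space M x"
  shows "mderiv M g x v = mderiv M f x v"
  by (rule mderiv_eqI[OF has_derivative_transform[OF assms(2) _ has_derivative_mderiv[OF assms(1,2)]] assms(4)])
    (rule assms(3))

lemma mderiv_bounded_linear:
  assumes "bounded_linear h" "smooth_map M f" "x \<in> M" "v \<in> tangent_space M x"
  shows "mderiv M (\<lambda>y. h (f y)) x v = h (mderiv M f x v)"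
  by (rule mderiv_eqI[OF bounded_linear.has_derivative[OF assms(1) has_derivative_mderiv[OF assms(2,3)]] assms(4)])

lemma mderiv_bounded_bilinear:
  assumes "bounded_bilinear h" "smooth_map M f" "smooth_map M g" "x \<in> M" "v \<in> tangent_space M x"
  shows "mderiv M (\<lambda>y. h (f y) (g y)) x v = h (f x) (mderiv M g x v) + h (mderiv M f x v) (g x)"
  by (rule mderiv_eqI[OF bounded_bilinear.FDERIV[OF assms(1) has_derivative_mderiv[OF assms(2,4)]
          has_derivative_mderiv[OF assms(3,4)]] assms(5)])

lemma mderiv_add:
  assumes "smooth_map M f" "smooth_map M g" "x \<in> M" "v \<in> tangent_space M x"
  shows "mderiv M (\<lambda>y. f y + g y) x v = mderiv M f x v + mderiv M g x v"
  by (rule mderiv_eqI[OF has_derivative_add[OF has_derivative_mderiv[OF assms(1,3)]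
          has_derivative_mderiv[OF assms(2,3)]] assms(4)])

lemma mderiv_ident:
  assumes "v \<in> tangent_space M x" shows "mderiv M (\<lambda>y. y) x v = v"
  by (rule mderiv_eqI[OF has_derivative_ident assms])

lemma mderiv_const:
  assumes "v \<in> tangent_space M x" shows "mderiv M (\<lambda>y. c) x v = 0"
  by (rule mderiv_eqI[OF has_derivative_const assms])

lemma linear_basis_expansion:
  fixes D :: "'a::euclidean_space \<Rightarrow> 'b::real_vector"
  assumes "linear D"
  shows "D v = (\<Sum>b\<in>Basis. (v \<bullet> b) *\<^sub>R D b)"
proof -
  have "D v = D (\<Sum>b\<in>Basis. (v \<bullet> b) *\<^sub>R b)" by (simp add: euclidean_representation)
  then show ?thesis using assms by (simp add: linear_sum linear_cmul)
qed

text \<open>The derivative chosen by \<open>mderiv\<close> need not depend smoothly on the point,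
  but on tangent vectors it agrees with that of one smooth extension, whose partial derivatives are
  smooth.\<close>

lemma smooth_map_mderiv:
  fixes Y :: "'a::euclidean_space \<Rightarrow> 'b::real_normed_vector"
  assumes Y: "smooth_map M Y" and X: "vector_field M X"
  shows "smooth_map M (\<lambda>x. mderiv M Y x (X x))"
proof -
  obtain U h where h: "open U" "M \<subseteq> U" "smooth_on U h" "\<And>x. x \<in> M \<Longrightarrow> Y x = h x"
    using Y unfolding smooth_map_def by blast
  have "smooth_map M (\<lambda>x. \<Sum>b\<in>Basis. (X x \<bullet> b) *\<^sub>R frechet_derivative h (at x) b)"
  proof (intro smooth_map_sum smooth_map_bounded_bilinear[OF bounded_bilinear_scaleR]
      smooth_map_bounded_linear[OF bounded_linear_inner_left])
    show "smooth_map M X" using X by (simp add: vector_field_def)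
    show "smooth_map M (\<lambda>x. frechet_derivative h (at x) b)" for b
      unfolding smooth_map_def using h smooth_on_derivative by blast
  qed
  then show ?thesis
  proof (rule smooth_map_cong)
    fix x assume x: "x \<in> M"
    then have "linear (frechet_derivative h (at x))"
      using smooth_on_differentiable[OF h(3)] h(2) has_derivative_linear by blast
    then show "(\<Sum>b\<in>Basis. (X x \<bullet> b) *\<^sub>R frechet_derivative h (at x) b) = mderiv M Y x (X x)"
      using mderiv_extension[OF h(2-4) x, of "X x"] X x
      by (simp add: vector_field_def linear_basis_expansion[symmetric])
  qed
qed

text \<open>Both iterated derivatives are expanded in the coordinates of a smooth extension; the
  second-order terms cancel by symmetry and leave the Lie bracket. Tangency of the bracket is
  assumed here and supplied later through \<open>lc_conn_torsion\<close>.\<close>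

lemma mderiv_commutator:
  fixes f :: "'a::euclidean_space \<Rightarrow> real"
  assumes f: "smooth_map M f" and X: "vector_field M X" and Y: "vector_field M Y" and x: "x \<in> M"
    and br: "mderiv M Y x (X x) - mderiv M X x (Y x) \<in> tangent_space M x"
  shows "mderiv M (\<lambda>y. mderiv M f y (Y y)) x (X x) - mderiv M (\<lambda>y. mderiv M f y (X y)) x (Y x)
    = mderiv M f x (mderiv M Y x (X x) - mderiv M X x (Y x))"
proof -
  obtain U h where h: "open U" "M \<subseteq> U" "smooth_on U h" "\<And>x. x \<in> M \<Longrightarrow> f x = h x"
    using f unfolding smooth_map_def by blast
  let ?h = "\<lambda>b y. frechet_derivative h (at y) b"
  let ?D = "frechet_derivative h (at x)"
  have xU: "x \<in> U" using h(2) x by blast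
  have linh: "linear (frechet_derivative h (at y))" if "y \<in> M" for y
    using smooth_on_differentiable[OF h(3)] h(2) has_derivative_linear that by blast
  have sh: "smooth_map M (?h b)" for b
    unfolding smooth_map_def using h smooth_on_derivative by blast
  have dh: "mderiv M (?h b) x v = frechet_derivative (?h b) (at x) v" if "v \<in> tangent_space M x" for b v
    using mderiv_extension[OF h(2) smooth_on_derivative[OF h(3)] _ x that] by simp
  have linhh: "linear (frechet_derivative (?h b) (at x))" for b
    using smooth_on_differentiable[OF smooth_on_derivative[OF h(3)] xU] has_derivative_linear by blast
  have comp: "mderiv M (\<lambda>y. mderiv M f y (W y)) x (V x) =
      ?D (mderiv M W x (V x))
      + (\<Sum>b\<in>Basis. \<Sum>c\<in>Basis. (W x \<bullet> b) * (V x \<bullet> c) * frechet_derivative (?h b) (at x) c)"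
    if V: "vector_field M V" and W: "vector_field M W"
    for V W
  proof -
    have sW: "smooth_map M W" and tW: "\<And>y. y \<in> M \<Longrightarrow> W y \<in> tangent_space M y"
      and tV: "V x \<in> tangent_space M x"
      using V W x by (auto simp: vector_field_def)
    have sWb: "smooth_map M (\<lambda>y. W y \<bullet> b)" for b
      by (rule smooth_map_bounded_linear[OF bounded_linear_inner_left sW])
    have sterm: "smooth_map M (\<lambda>y. (W y \<bullet> b) * ?h b y)" for b
      by (rule smooth_map_bounded_bilinear[OF bounded_bilinear_mult sWb sh])
    have eq: "mderiv M f y (W y) = (\<Sum>b\<in>Basis. (W y \<bullet> b) * ?h b y)" if "y \<in> M" for y
      using mderiv_extension[OF h(2-4) that tW[OF that]] linear_basis_expansion[OF linh[OF that], of "W y"]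
      by simp
    have "mderiv M (\<lambda>y. mderiv M f y (W y)) x (V x) = mderiv M (\<lambda>y. \<Sum>b\<in>Basis. (W y \<bullet> b) * ?h b y) x (V x)"
      by (rule mderiv_cong[OF smooth_map_sum[OF sterm] x eq tV])
    also have "\<dots> = (\<Sum>b\<in>Basis. mderiv M (\<lambda>y. (W y \<bullet> b) * ?h b y) x (V x))"
      by (rule mderiv_eqI[OF has_derivative_sum[OF has_derivative_mderiv[OF sterm x]] tV])
    also have "\<dots> = (\<Sum>b\<in>Basis. (W x \<bullet> b) * frechet_derivative (?h b) (at x) (V x) + (mderiv M W x (V x) \<bullet> b) * ?h b x)"
      by (intro sum.cong refl)
        (simp add: mderiv_bounded_bilinear[OF bounded_bilinear_mult sWb sh x tV]
          mderiv_bounded_linear[OF bounded_linear_inner_left sW x tV] dh[OF tV])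
    also have "\<dots> = (\<Sum>b\<in>Basis. (W x \<bullet> b) * frechet_derivative (?h b) (at x) (V x))
        + (\<Sum>b\<in>Basis. (mderiv M W x (V x) \<bullet> b) * ?h b x)"
      by (rule sum.distrib)
    also have "(\<Sum>b\<in>Basis. (mderiv M W x (V x) \<bullet> b) * ?h b x) = ?D (mderiv M W x (V x))"
      using linear_basis_expansion[OF linh[OF x], of "mderiv M W x (V x)"] by simp
    also have "(\<Sum>b\<in>Basis. (W x \<bullet> b) * frechet_derivative (?h b) (at x) (V x))
       = (\<Sum>b\<in>Basis. \<Sum>c\<in>Basis. (W x \<bullet> b) * (V x \<bullet> c) * frechet_derivative (?h b) (at x) c)"
      by (intro sum.cong refl, subst linear_basis_expansion[OF linhh, of _ "V x"])
        (simp add: sum_distrib_left mult.assoc)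
    finally show ?thesis by simp
  qed
  have swap: "(\<Sum>b\<in>Basis. \<Sum>c\<in>Basis. (Y x \<bullet> b) * (X x \<bullet> c) * frechet_derivative (?h b) (at x) c)
      = (\<Sum>b\<in>Basis. \<Sum>c\<in>Basis. (X x \<bullet> b) * (Y x \<bullet> c) * frechet_derivative (?h b) (at x) c)"
  proof (subst sum.swap, intro sum.cong refl)
    fix b c :: 'a
    show "(Y x \<bullet> c) * (X x \<bullet> b) * frechet_derivative (?h c) (at x) b
        = (X x \<bullet> b) * (Y x \<bullet> c) * frechet_derivative (?h b) (at x) c"
      using second_derivative_symmetric[OF h(1) xU h(3), of b c] by simp
  qed
  have "mderiv M f x (mderiv M Y x (X x) - mderiv M X x (Y x)) = ?D (mderiv M Y x (X x) - mderiv M X x (Y x))"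
    by (rule mderiv_extension[OF h(2-4) x br])
  then show ?thesis
    using comp[OF X Y] comp[OF Y X] swap by (simp add: linear_diff[OF linh[OF x]])
qed

section \<open>Tuples of square matrices\<close>

definition tmul :: "('m, 'd::finite) tuple \<Rightarrow> ('m::finite, 'd) tuple \<Rightarrow> ('m, 'd) tuple" (infixl "\<odot>" 70) where
  "A \<odot> B = (\<chi> i. A $ i ** B $ i)"

definition adj :: "('m::finite, 'd::finite) tuple \<Rightarrow> ('m, 'd) tuple" where
  "adj A = (\<chi> i. transpose (A $ i))"

definition tone :: "('m::finite, 'd::finite) tuple" where
  "tone = (\<chi> i. mat 1)"

text \<open>Repeating the sum in every slot keeps it among the tuples: divided by the number of
  slots, it is the orthogonal projection onto the constant tuples.\<close>

definition tsum :: "('m::finite, 'd::finite) tuple \<Rightarrow> ('m, 'd) tuple" where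
  "tsum A = (\<chi> i. \<Sum>j\<in>UNIV. A $ j)"

definition bracket :: "('m::finite, 'd::finite) tuple \<Rightarrow> ('m, 'd) tuple \<Rightarrow> ('m, 'd) tuple" where
  "bracket A B = A \<odot> B - B \<odot> A"

lemma bounded_bilinear_tmul: "bounded_bilinear ((\<odot>) :: ('m::finite, 'd::finite) tuple \<Rightarrow> _)"
  unfolding bilinear_conv_bounded_bilinear[symmetric] bilinear_def linear_iff
  by (simp add: tmul_def matrix_matrix_mult_def vec_eq_iff sum.distrib algebra_simps sum_distrib_left)

interpretation tmul: bounded_bilinear "(\<odot>) :: ('m::finite, 'd::finite) tuple \<Rightarrow> _"
  by (rule bounded_bilinear_tmul)

lemmas tmul_simps = tmul.add_left tmul.add_right tmul.diff_left tmul.diff_right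
  tmul.minus_left tmul.minus_right tmul.scaleR_left tmul.scaleR_right tmul.zero_left tmul.zero_right

lemma tmul_assoc: "A \<odot> B \<odot> D = A \<odot> (B \<odot> D)"
  by (simp add: tmul_def matrix_mul_assoc)

lemma tone_tmul [simp]: "tone \<odot> A = A" and tmul_tone [simp]: "A \<odot> tone = A"
  by (simp_all add: tmul_def tone_def vec_eq_iff)

lemma linear_adj: "linear adj"
  by (simp add: linear_iff adj_def transpose_def vec_eq_iff)

lemma bounded_linear_adj: "bounded_linear adj"
  using linear_adj by (simp add: linear_conv_bounded_linear)

lemmas adj_linear_simps = linear_add[OF linear_adj] linear_diff[OF linear_adj]
  linear_neg[OF linear_adj] linear_cmul[OF linear_adj] linear_0[OF linear_adj]

lemma adj_adj [simp]: "adj (adj A) = A"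
  by (simp add: adj_def vec_eq_iff transpose_def)

lemma adj_tmul: "adj (A \<odot> B) = adj B \<odot> adj A"
  by (simp add: adj_def tmul_def matrix_transpose_mul)

lemma adj_tone [simp]: "adj tone = tone"
  by (simp add: adj_def tone_def transpose_mat)

lemma linear_tsum: "linear tsum"
  by (simp add: linear_iff tsum_def vec_eq_iff sum.distrib scaleR_sum_right)

lemma bounded_linear_tsum: "bounded_linear tsum"
  using linear_tsum by (simp add: linear_conv_bounded_linear)

lemmas tsum_linear_simps = linear_add[OF linear_tsum] linear_diff[OF linear_tsum]
  linear_neg[OF linear_tsum] linear_cmul[OF linear_tsum] linear_0[OF linear_tsum]

lemma adj_tsum: "adj (tsum A) = tsum (adj A)"
  by (simp add: adj_def tsum_def vec_eq_iff transpose_def)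

lemma tsum_tsum: "tsum (tsum A) = real CARD('m) *\<^sub>R tsum A" for A :: "('m::finite, 'd::finite) tuple"
  by (simp add: tsum_def sum_constant_scaleR vec_eq_iff[of "vec_lambda _"] del: sum_constant)

lemma
  fixes A B :: "('m::finite, 'd::finite) tuple"
  shows tsum_tmul_tsum_left: "tsum (tsum A \<odot> B) = tsum A \<odot> tsum B"
    and tsum_tmul_tsum_right: "tsum (B \<odot> tsum A) = tsum B \<odot> tsum A"
proof -
  have l: "linear (\<lambda>Q. P ** Q)" and l': "linear (\<lambda>Q. Q ** P)" for P :: "real^'d^'d"
    by (simp_all add: linear_iff matrix_matrix_mult_def vec_eq_iff sum.distrib algebra_simps sum_distrib_left)
  show "tsum (tsum A \<odot> B) = tsum A \<odot> tsum B"
    by (simp add: tsum_def tmul_def linear_sum[OF l] linear_sum[OF l'])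
  show "tsum (B \<odot> tsum A) = tsum B \<odot> tsum A"
    by (simp add: tsum_def tmul_def linear_sum[OF l] linear_sum[OF l']) (subst sum.swap, rule refl)
qed

lemma inner_matrix_mult:
  fixes A :: "real^'b^'a" and B :: "real^'c^'b"
  shows "(A ** B) \<bullet> D = B \<bullet> (transpose A ** D)" and "(A ** B) \<bullet> D = A \<bullet> (D ** transpose B)"
proof -
  have "(A ** B) \<bullet> D = (\<Sum>i\<in>UNIV. \<Sum>j\<in>UNIV. \<Sum>k\<in>UNIV. A $ i $ k * B $ k $ j * D $ i $ j)"
    by (simp add: inner_vec_def matrix_matrix_mult_def sum_distrib_right)
  also have "\<dots> = (\<Sum>k\<in>UNIV. \<Sum>j\<in>UNIV. \<Sum>i\<in>UNIV. A $ i $ k * B $ k $ j * D $ i $ j)"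
    by (subst sum.swap, subst (2) sum.swap, subst sum.swap, rule refl)
  also have "\<dots> = B \<bullet> (transpose A ** D)"
    by (simp add: inner_vec_def matrix_matrix_mult_def sum_distrib_left transpose_def mult_ac)
  finally show "(A ** B) \<bullet> D = B \<bullet> (transpose A ** D)" .
  have "(A ** B) \<bullet> D = (\<Sum>i\<in>UNIV. \<Sum>j\<in>UNIV. \<Sum>k\<in>UNIV. A $ i $ k * B $ k $ j * D $ i $ j)"
    by (simp add: inner_vec_def matrix_matrix_mult_def sum_distrib_right)
  also have "\<dots> = (\<Sum>i\<in>UNIV. \<Sum>k\<in>UNIV. \<Sum>j\<in>UNIV. A $ i $ k * B $ k $ j * D $ i $ j)"
    by (rule sum.cong[OF refl], rule sum.swap)
  also have "\<dots> = A \<bullet> (D ** transpose B)"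
    by (simp add: inner_vec_def matrix_matrix_mult_def sum_distrib_left transpose_def mult_ac)
  finally show "(A ** B) \<bullet> D = A \<bullet> (D ** transpose B)" .
qed

lemma inner_transpose: "transpose A \<bullet> transpose B = A \<bullet> B" for A B :: "real^'b^'a"
  by (simp add: inner_vec_def transpose_def) (rule sum.swap)

lemma inner_tuple: "A \<bullet> B = (\<Sum>i\<in>UNIV. A $ i \<bullet> B $ i)" for A B :: "('m::finite, 'd::finite) tuple"
  by (rule inner_vec_def)

lemma
  fixes A B D :: "('m::finite, 'd::finite) tuple"
  shows inner_tmul_left: "(A \<odot> B) \<bullet> D = B \<bullet> (adj A \<odot> D)"
    and inner_tmul_right: "(A \<odot> B) \<bullet> D = A \<bullet> (D \<odot> adj B)"
  unfolding inner_tuple tmul_def adj_def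
  by (intro sum.cong; simp add: inner_matrix_mult(1))
     (intro sum.cong; simp add: inner_matrix_mult(2))

lemma inner_adj: "adj A \<bullet> adj B = A \<bullet> B"
  unfolding inner_tuple adj_def by (simp add: inner_transpose)

lemma inner_tsum: "tsum A \<bullet> B = A \<bullet> tsum B"
proof -
  have "tsum A \<bullet> B = (\<Sum>i\<in>UNIV. A $ i) \<bullet> (\<Sum>i\<in>UNIV. B $ i)"
    unfolding inner_tuple by (simp add: tsum_def inner_sum_right)
  also have "\<dots> = A \<bullet> tsum B"
    unfolding inner_tuple by (simp add: tsum_def inner_sum_left)
  finally show ?thesis .
qed

section \<open>Commutators and skew tuples\<close>

lemma bounded_bilinear_bracket: "bounded_bilinear (bracket :: ('m::finite, 'd::finite) tuple \<Rightarrow> _)"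
  unfolding bilinear_conv_bounded_bilinear[symmetric] bilinear_def linear_iff
  by (simp add: bracket_def tmul_simps algebra_simps)

interpretation bracket: bounded_bilinear "bracket :: ('m::finite, 'd::finite) tuple \<Rightarrow> _"
  by (rule bounded_bilinear_bracket)

lemmas bracket_simps = bracket.add_left bracket.add_right bracket.diff_left bracket.diff_right
  bracket.minus_left bracket.minus_right bracket.scaleR_left bracket.scaleR_right

lemma bracket_commute: "bracket B A = - bracket A B"
  by (simp add: bracket_def)

lemma bracket_self [simp]: "bracket A A = 0"
  by (simp add: bracket_def)

definition skew_tuples :: "(('m::finite, 'd::finite) tuple) set" where
  "skew_tuples = {a. adj a = - a}"

lemma skew_tuples_iff: "a \<in> skew_tuples \<longleftrightarrow> (\<forall>i. a $ i \<in> skew)"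
  by (simp add: skew_tuples_def skew_def adj_def vec_eq_iff)

lemma subspace_skew_tuples: "subspace skew_tuples"
  by (simp add: subspace_def skew_tuples_def adj_linear_simps)

lemma bracket_skew: "a \<in> skew_tuples \<Longrightarrow> b \<in> skew_tuples \<Longrightarrow> bracket a b \<in> skew_tuples"
  by (simp add: skew_tuples_def bracket_def adj_linear_simps adj_tmul tmul_simps)

lemma tsum_skew: "a \<in> skew_tuples \<Longrightarrow> tsum a \<in> skew_tuples"
  by (simp add: skew_tuples_def adj_tsum tsum_linear_simps)

text \<open>Multiplication by a skew tuple has its negative as adjoint. The resulting invariance of
  the Frobenius product is what makes the connection compatible with the metric.\<close>

lemma inner_bracket_cyclic:
  assumes "a \<in> skew_tuples" "b \<in> skew_tuples" "d \<in> skew_tuples"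
  shows "a \<bullet> bracket b d = b \<bullet> bracket d a"
proof -
  have "a \<bullet> (b \<odot> d) = b \<bullet> (a \<odot> adj d)" "a \<bullet> (d \<odot> b) = b \<bullet> (adj d \<odot> a)"
    by (metis inner_commute inner_tmul_right, metis inner_commute inner_tmul_left)
  then show ?thesis
    using assms by (simp add: bracket_def skew_tuples_def inner_diff_right tmul_simps)
qed

lemma orthogonal_tuples_iff: "S \<in> orthogonal_tuples \<longleftrightarrow> adj S \<odot> S = tone"
  by (simp add: orthogonal_tuples_def orthogonal_matrix tmul_def adj_def tone_def vec_eq_iff)

lemma orthogonal_tuples_cancel:
  assumes "S \<in> orthogonal_tuples"
  shows "adj S \<odot> S = tone" "S \<odot> adj S = tone"
    and "adj S \<odot> (S \<odot> A) = A" "S \<odot> (adj S \<odot> A) = A"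
proof -
  show 1: "adj S \<odot> S = tone" using assms orthogonal_tuples_iff by blast
  show 2: "S \<odot> adj S = tone"
    using assms by (simp add: orthogonal_tuples_def orthogonal_matrix_def tmul_def adj_def tone_def)
  show "adj S \<odot> (S \<odot> A) = A" "S \<odot> (adj S \<odot> A) = A"
    by (simp_all add: tmul_assoc[symmetric] 1 2)
qed

lemma orthogonal_tuples_tmul_eq_iff:
  assumes "S \<in> orthogonal_tuples"
  shows "S \<odot> A = S \<odot> B \<longleftrightarrow> A = B"
  by (metis assms orthogonal_tuples_cancel(3))

section \<open>The tangent spaces of the orthogonal tuples\<close>

text \<open>Curves with a prescribed skew velocity come from the Cayley transform
  \<open>2 (1 - t a)\<^sup>-\<^sup>1 - 1 = (1 + t a) (1 - t a)\<^sup>-\<^sup>1\<close>, for which no matrix exponential is needed.\<close>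

lemma skew_resolvent:
  assumes a: "a \<in> skew_tuples"
  obtains X where "\<And>t::real. X t \<odot> (tone - t *\<^sub>R a) = tone" "\<And>t. (tone - t *\<^sub>R a) \<odot> X t = tone"
proof -
  have "\<exists>X. X \<odot> (tone - t *\<^sub>R a) = tone \<and> (tone - t *\<^sub>R a) \<odot> X = tone" for t :: real
  proof -
    have "\<exists>Y. Y ** (mat 1 - t *\<^sub>R a $ i) = mat 1 \<and> (mat 1 - t *\<^sub>R a $ i) ** Y = mat 1" for i
    proof -
      let ?B = "mat 1 - t *\<^sub>R a $ i"
      \<comment> \<open>A kernel vector satisfies v = t a v, and skewness makes a v orthogonal to
        v.\<close>
      have "v = 0" if v: "?B *v v = 0" for v
      proof -
        have sk: "transpose (a $ i) = - a $ i"
          using a by (simp add: skew_tuples_iff skew_def)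
        have "v = t *\<^sub>R (a $ i *v v)"
          using v by (simp add: matrix_vector_mult_diff_rdistrib scaleR_matrix_vector_assoc)
        then have 1: "v \<bullet> v = t * ((a $ i *v v) \<bullet> v)"
          by (metis inner_scaleR_left)
        have "(a $ i *v v) \<bullet> v = v \<bullet> ((- a $ i) *v v)"
          using inner_matrix_transpose[of "a $ i" v v] sk by simp
        also have "\<dots> = - ((a $ i *v v) \<bullet> v)"
          by (simp add: inner_vec_def matrix_vector_mult_def sum_negf mult.commute)
        finally have "(a $ i *v v) \<bullet> v = 0" by simp
        then show ?thesis using 1 by simp
      qed
      then obtain Y where "Y ** ?B = mat 1"
        using matrix_left_invertible_ker[of ?B] by blast
      then show ?thesis using matrix_left_right_inverse by blast
    qed
    then obtain Y where "\<And>i. Y i ** (mat 1 - t *\<^sub>R a $ i) = mat 1 \<and> (mat 1 - t *\<^sub>R a $ i) ** Y i = mat 1"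
      by metis
    then show ?thesis
      by (intro exI[of _ "\<chi> i. Y i"]) (simp add: tmul_def tone_def vec_eq_iff)
  qed
  then show ?thesis using that by metis
qed

text \<open>The resolvent identity
  \<open>X s - X t = (s - t) *\<^sub>R (X s \<odot> a \<odot> X t)\<close> and a uniform bound on
  \<open>X\<close> give continuity, then the derivative. As the derivative is a polynomial in
  \<open>X\<close>, smoothness follows by induction on the order.\<close>

lemma
  fixes a :: "('m::finite, 'd::finite) tuple"
  assumes a: "a \<in> skew_tuples"
    and L: "\<And>t::real. X t \<odot> (tone - t *\<^sub>R a) = tone" and R: "\<And>t. (tone - t *\<^sub>R a) \<odot> X t = tone"
  shows resolvent_has_derivative: "(X has_derivative (\<lambda>h. h *\<^sub>R (X t \<odot> a \<odot> X t))) (at t)"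
    and resolvent_continuous: "isCont X t"
    and resolvent_smooth: "Ck_on k UNIV X"
    and resolvent_0: "X 0 = tone"
    and cayley_orthogonal: "2 *\<^sub>R X t - tone \<in> orthogonal_tuples"
proof -
  have diff: "X s - X t = (s - t) *\<^sub>R (X s \<odot> a \<odot> X t)" for s t
  proof -
    have "X s - X t = X s \<odot> ((tone - t *\<^sub>R a) \<odot> X t) - X s \<odot> (tone - s *\<^sub>R a) \<odot> X t"
      by (simp add: L R)
    also have "\<dots> = (s - t) *\<^sub>R (X s \<odot> a \<odot> X t)"
      by (simp add: tmul_simps tmul_assoc algebra_simps)
    finally show ?thesis .
  qed
  have bound: "norm (X t) \<le> norm (tone :: ('m, 'd) tuple)" for t
  proof -
    \<comment> \<open>Pythagoras: \<open>tone\<close> is the difference of the orthogonal tuples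
      \<open>X t\<close> and \<open>t *\<^sub>R (a \<odot> X t)\<close>, so its norm bounds that of
      \<open>X t\<close>.\<close>
    have "X t \<bullet> (a \<odot> X t) = (adj a \<odot> X t) \<bullet> X t" by (metis inner_commute inner_tmul_left adj_adj)
    then have "X t \<bullet> (a \<odot> X t) = 0"
      using a by (simp add: skew_tuples_def tmul_simps inner_commute)
    then have "(norm (X t - t *\<^sub>R (a \<odot> X t)))\<^sup>2 = (norm (X t))\<^sup>2 + t\<^sup>2 * (norm (a \<odot> X t))\<^sup>2"
      unfolding power2_norm_eq_inner by (simp add: inner_diff_left inner_diff_right inner_commute power2_eq_square)
    moreover have "tone = X t - t *\<^sub>R (a \<odot> X t)" using R[of t] by (simp add: tmul_simps)
    ultimately have "(norm (tone :: ('m, 'd) tuple))\<^sup>2 = (norm (X t))\<^sup>2 + t\<^sup>2 * (norm (a \<odot> X t))\<^sup>2"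
      by simp
    then have "(norm (X t))\<^sup>2 \<le> (norm (tone :: ('m, 'd) tuple))\<^sup>2" by simp
    then show ?thesis by (rule power2_le_imp_le) simp
  qed
  show cont: "isCont X t" for t
  proof -
    obtain K where K: "0 < K" "\<And>A B :: ('m, 'd) tuple. norm (A \<odot> B) \<le> norm A * norm B * K"
      using tmul.pos_bounded by blast
    let ?n = "norm (tone :: ('m, 'd) tuple)"
    have le: "norm (X s - X t) \<le> \<bar>s - t\<bar> * (?n * norm a * K * ?n * K)" for s
    proof -
      have "norm (X s \<odot> a) \<le> ?n * norm a * K"
        using K(2)[of "X s" a] bound[of s] K(1) by (meson mult_right_mono norm_ge_zero order_trans less_imp_le)
      then have "norm (X s \<odot> a \<odot> X t) \<le> (?n * norm a * K) * ?n * K"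
        using K(2)[of "X s \<odot> a" "X t"] bound[of t] K(1)
        by (meson mult_right_mono mult_mono norm_ge_zero order_trans less_imp_le mult_nonneg_nonneg)
      then show ?thesis by (simp add: diff[of s] mult_left_mono)
    qed
    have "((\<lambda>s. \<bar>s - t\<bar> * (?n * norm a * K * ?n * K)) \<longlongrightarrow> \<bar>t - t\<bar> * (?n * norm a * K * ?n * K)) (at t)"
      by (intro tendsto_intros)
    then have "((\<lambda>s. \<bar>s - t\<bar> * (?n * norm a * K * ?n * K)) \<longlongrightarrow> 0) (at t)" by simp
    then have "((\<lambda>s. X s - X t) \<longlongrightarrow> 0) (at t)"
      by (rule Lim_null_comparison[rotated]) (simp add: le)
    then show ?thesis by (simp add: isCont_def LIM_zero_iff)
  qed
  show der: "(X has_derivative (\<lambda>h. h *\<^sub>R (X t \<odot> a \<odot> X t))) (at t)" for t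
    unfolding has_derivative_within
  proof
    show "bounded_linear (\<lambda>h. h *\<^sub>R (X t \<odot> a \<odot> X t))" by (rule bounded_linear_scaleR_left)
    have "((\<lambda>s. (X s - X t) \<odot> a \<odot> X t) \<longlongrightarrow> (X t - X t) \<odot> a \<odot> X t) (at t)"
      using cont[of t] by (intro tmul.tendsto tendsto_intros) (simp_all add: isCont_def)
    then have "((\<lambda>s. (X s - X t) \<odot> a \<odot> X t) \<longlongrightarrow> 0) (at t)"
      by (simp add: tmul.zero_left)
    then have lim: "((\<lambda>s. norm ((X s - X t) \<odot> a \<odot> X t)) \<longlongrightarrow> 0) (at t)"
      by (rule tendsto_norm_zero)
    have le: "norm ((1 / norm (s - t)) *\<^sub>R (X s - (X t + (s - t) *\<^sub>R (X t \<odot> a \<odot> X t))))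
        \<le> norm ((X s - X t) \<odot> a \<odot> X t)" for s
    proof -
      have "X s - (X t + (s - t) *\<^sub>R (X t \<odot> a \<odot> X t)) = (X s - X t) - (s - t) *\<^sub>R (X t \<odot> a \<odot> X t)" by simp
      also have "\<dots> = (s - t) *\<^sub>R ((X s - X t) \<odot> a \<odot> X t)"
        unfolding diff[of s t] by (subst diff[of s t, symmetric]) (simp add: tmul_simps scaleR_diff_right[symmetric])
      finally show ?thesis by simp
    qed
    show "((\<lambda>s. (1 / norm (s - t)) *\<^sub>R (X s - (X t + (s - t) *\<^sub>R (X t \<odot> a \<odot> X t)))) \<longlongrightarrow> 0) (at t)"
      by (rule Lim_null_comparison[OF always_eventually[OF allI[OF le]] lim])
  qed
  show "Ck_on k UNIV X"
  proof (induction k)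
    case 0
    then show ?case using cont by (simp add: continuous_at_imp_continuous_on)
  next
    case (Suc k)
    show ?case
      by (rule Ck_on_SucI[OF open_UNIV der])
        (intro Ck_on_bounded_linear[OF bounded_linear_scaleR_right] open_UNIV
          Ck_on_bounded_bilinear[OF bounded_bilinear_tmul] Ck_on_const Suc)
  qed
  show "X 0 = tone" using L[of 0] by simp
  show "2 *\<^sub>R X t - tone \<in> orthogonal_tuples"
  proof -
    have sk: "adj a = - a" using a by (simp add: skew_tuples_def)
    have 1: "adj (X t) \<odot> (tone + t *\<^sub>R a) = tone"
      using arg_cong[OF R[of t], of adj] by (simp add: adj_tmul adj_linear_simps sk)
    \<comment> \<open>Since 2 = (1 + t a) + (1 - t a), each summand cancels one factor; the
      resulting 2 X^T X = X + X^T says that 2 X - 1 is orthogonal.\<close>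
    have "2 *\<^sub>R (adj (X t) \<odot> X t) = adj (X t) \<odot> (tone + t *\<^sub>R a) \<odot> X t + adj (X t) \<odot> ((tone - t *\<^sub>R a) \<odot> X t)"
      by (simp add: tmul_simps tmul_assoc scaleR_2)
    also have "\<dots> = X t + adj (X t)" by (simp add: 1 R)
    finally have 2: "2 *\<^sub>R (adj (X t) \<odot> X t) = X t + adj (X t)" .
    have "adj (2 *\<^sub>R X t - tone) \<odot> (2 *\<^sub>R X t - tone)
        = 2 *\<^sub>R (2 *\<^sub>R (adj (X t) \<odot> X t)) - 2 *\<^sub>R adj (X t) - 2 *\<^sub>R X t + tone"
      by (simp add: adj_linear_simps tmul_simps algebra_simps)
    then show ?thesis unfolding orthogonal_tuples_iff 2 by (simp add: algebra_simps)
  qed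
qed

lemma orthogonal_tuples_tmul:
  "A \<in> orthogonal_tuples \<Longrightarrow> B \<in> orthogonal_tuples \<Longrightarrow> A \<odot> B \<in> orthogonal_tuples"
  by (simp add: orthogonal_tuples_iff adj_tmul tmul_assoc) (simp add: tmul_assoc[symmetric])

text \<open>One inclusion differentiates the relation \<open>adj S \<odot> S = tone\<close>; the
  other exhibits a Cayley curve through \<open>T\<close>.\<close>

lemma tangent_space_orthogonal_tuples:
  fixes T :: "('m::finite, 'd::finite) tuple"
  assumes T: "T \<in> orthogonal_tuples"
  shows "tangent_space orthogonal_tuples T = (\<odot>) T ` skew_tuples"
proof safe
  fix v assume v: "v \<in> tangent_space orthogonal_tuples T"
  have 1: "((\<lambda>S. adj S \<odot> S) has_derivative (\<lambda>h. adj T \<odot> h + adj h \<odot> T)) (at T within orthogonal_tuples)"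
    by (rule bounded_bilinear.FDERIV[OF bounded_bilinear_tmul
          bounded_linear.has_derivative[OF bounded_linear_adj has_derivative_ident] has_derivative_ident])
  have "mderiv orthogonal_tuples (\<lambda>S. adj S \<odot> S) T v = mderiv orthogonal_tuples (\<lambda>S. tone) T v"
    by (rule mderiv_cong[OF smooth_map_const T _ v]) (simp add: orthogonal_tuples_iff)
  then have "adj T \<odot> v + adj v \<odot> T = 0"
    using mderiv_eqI[OF 1 v] mderiv_const[OF v] by metis
  then have "adj T \<odot> v \<in> skew_tuples"
    by (simp add: skew_tuples_def adj_tmul eq_neg_iff_add_eq_0 add.commute)
  then show "v \<in> (\<odot>) T ` skew_tuples"
    using orthogonal_tuples_cancel(4)[OF T] by (metis image_eqI)
next
  fix a :: "('m, 'd) tuple" assume "a \<in> skew_tuples"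
  \<comment> \<open>The Cayley transform built from \<open>a\<close> itself would have velocity
    \<open>2 *\<^sub>R a\<close> at 0, hence the half.\<close>
  then have a2: "(1/2) *\<^sub>R a \<in> skew_tuples" using subspace_scale[OF subspace_skew_tuples] by blast
  obtain X where X: "\<And>t::real. X t \<odot> (tone - t *\<^sub>R (1/2) *\<^sub>R a) = tone" "\<And>t. (tone - t *\<^sub>R (1/2) *\<^sub>R a) \<odot> X t = tone"
    using skew_resolvent[OF a2] by blast
  define c where "c t = T \<odot> (2 *\<^sub>R X t + - tone)" for t
  have X0: "X 0 = tone" by (rule resolvent_0[OF a2 X])
  have "c t \<in> orthogonal_tuples" for t
    unfolding c_def using orthogonal_tuples_tmul[OF T cayley_orthogonal[OF a2 X, of t]] by simp
  moreover have "smooth_on UNIV c"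
    unfolding smooth_on_def c_def
    by (intro allI Ck_on_bounded_linear[OF tmul.bounded_linear_right] Ck_on_add Ck_on_const
        Ck_on_bounded_linear[OF bounded_linear_scaleR_right] resolvent_smooth[OF a2 X] open_UNIV)
  then have "smooth_on {- 1<..<1} c" by (rule smooth_on_subset) simp
  moreover have "c 0 = T" by (simp add: c_def X0 scaleR_2)
  moreover have "(c has_vector_derivative T \<odot> a) (at 0)"
  proof -
    have "(c has_derivative (\<lambda>h. T \<odot> (2 *\<^sub>R (h *\<^sub>R (X 0 \<odot> ((1/2) *\<^sub>R a) \<odot> X 0)) + 0))) (at 0)"
      unfolding c_def
      by (intro bounded_linear.has_derivative[OF tmul.bounded_linear_right] has_derivative_add has_derivative_const
          bounded_linear.has_derivative[OF bounded_linear_scaleR_right] resolvent_has_derivative[OF a2 X])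
    then show ?thesis
      by (simp add: has_vector_derivative_def X0 tmul_simps)
  qed
  ultimately show "T \<odot> a \<in> tangent_space orthogonal_tuples T"
    unfolding tangent_space_def by (intro CollectI exI[of _ 1] conjI exI[of _ c]) auto
qed

lemma tangent_spaceI:
  "T \<in> orthogonal_tuples \<Longrightarrow> a \<in> skew_tuples \<Longrightarrow> T \<odot> a \<in> tangent_space orthogonal_tuples T"
  using tangent_space_orthogonal_tuples by blast

lemma tangent_spaceD:
  "T \<in> orthogonal_tuples \<Longrightarrow> v \<in> tangent_space orthogonal_tuples T \<Longrightarrow> adj T \<odot> v \<in> skew_tuples"
  using tangent_space_orthogonal_tuples orthogonal_tuples_cancel(3) by force

lemma subspace_tangent_space:
  "T \<in> orthogonal_tuples \<Longrightarrow> subspace (tangent_space orthogonal_tuples T)"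
  by (simp add: tangent_space_orthogonal_tuples)
    (intro linear_subspace_image subspace_skew_tuples bounded_linear.linear tmul.bounded_linear_right)

section \<open>The quotient metric in left trivialization\<close>

lemma sum_option: "(\<Sum>v\<in>UNIV. f v) = f None + (\<Sum>i\<in>UNIV. f (Some i))"
  for f :: "'k::finite option \<Rightarrow> 'b::comm_monoid_add"
  by (simp add: UNIV_option_conv sum.reindex)

lemma quot_map_orthogonal: "S \<in> orthogonal_tuples \<Longrightarrow> quot_map S \<in> orthogonal_tuples"
  by (simp add: orthogonal_tuples_def quot_map_def orthogonal_matrix_mul)

lemma with_identity_orthogonal: "T \<in> orthogonal_tuples \<Longrightarrow> with_identity T \<in> orthogonal_tuples"
  by (simp add: orthogonal_tuples_def with_identity_def orthogonal_matrix_id split: option.split)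

lemma quot_map_with_identity [simp]: "quot_map (with_identity T) = T"
  by (simp add: quot_map_def with_identity_def vec_eq_iff transpose_mat)

lemma mderiv_quot_map:
  fixes S :: "('k::finite option, 'd::finite) tuple"
  assumes Z: "Z \<in> tangent_space orthogonal_tuples S"
  shows "mderiv orthogonal_tuples quot_map S Z =
    (\<chi> i. S $ Some i ** transpose (Z $ None) + Z $ Some i ** transpose (S $ None))"
proof -
  define Q :: "('k option, 'd) tuple \<Rightarrow> ('k option, 'd) tuple \<Rightarrow> ('k, 'd) tuple"
    where "Q A B = (\<chi> i. A $ Some i ** transpose (B $ None))" for A B
  have Q: "bounded_bilinear Q"
    unfolding bilinear_conv_bounded_bilinear[symmetric] bilinear_def linear_iff
    by (simp add: Q_def matrix_matrix_mult_def transpose_def vec_eq_iff sum.distrib algebra_simps sum_distrib_left)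
  have "mderiv orthogonal_tuples quot_map S Z = Q S Z + Q Z S"
    by (rule mderiv_eqI[OF _ Z])
      (use bounded_bilinear.FDERIV[OF Q has_derivative_ident has_derivative_ident] in
        \<open>simp add: Q_def[abs_def] quot_map_def[abs_def]\<close>)
  then show ?thesis by (simp add: Q_def vec_eq_iff)
qed

text \<open>The Gram operator of the quotient metric in left trivialization, see
  \<open>g_quot_tangent\<close>; the number of views is \<open>CARD('k) + 1\<close>. Its inverse is
  \<open>metric_op_inv\<close>.\<close>

definition metric_op :: "('k::finite, 'd::finite) tuple \<Rightarrow> ('k, 'd) tuple" where
  "metric_op a = a - (1 / (real CARD('k) + 1)) *\<^sub>R tsum a"

definition metric_op_inv :: "('k::finite, 'd::finite) tuple \<Rightarrow> ('k, 'd) tuple" where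
  "metric_op_inv a = a + tsum a"

lemma linear_metric_op: "linear metric_op"
  unfolding metric_op_def[abs_def]
  by (simp add: linear_iff tsum_linear_simps algebra_simps)

lemma metric_op_metric_op_inv: "metric_op (metric_op_inv a) = a"
  for a :: "('k::finite, 'd::finite) tuple"
proof -
  have "metric_op (metric_op_inv a) =
      a + (1 - (1 / (real CARD('k) + 1)) * (1 + real CARD('k))) *\<^sub>R tsum a"
    by (simp only: metric_op_def metric_op_inv_def tsum_linear_simps tsum_tsum)
      (simp only: scaleR_left_diff_distrib scaleR_right_distrib scaleR_scaleR ring_distribs scaleR_left_distrib
        scaleR_one mult_1_right add_diff_eq diff_diff_eq)
  then show ?thesis by (simp add: field_simps)
qed

lemma inner_metric_op: "metric_op a \<bullet> b = a \<bullet> metric_op b"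
  by (simp add: metric_op_def inner_diff_left inner_diff_right inner_tsum)

lemma metric_op_skew: "a \<in> skew_tuples \<Longrightarrow> metric_op a \<in> skew_tuples"
  and metric_op_inv_skew: "a \<in> skew_tuples \<Longrightarrow> metric_op_inv a \<in> skew_tuples"
  unfolding metric_op_def metric_op_inv_def
  by (simp_all add: subspace_diff subspace_add subspace_scale subspace_skew_tuples tsum_skew)

lemma metric_op_nondegenerate:
  assumes p: "p \<in> skew_tuples" and z: "\<And>c. c \<in> skew_tuples \<Longrightarrow> p \<bullet> metric_op c = 0"
  shows "p = 0"
  using z[OF metric_op_inv_skew[OF p]] by (simp add: metric_op_metric_op_inv)

text \<open>The horizontal lift of \<open>T a\<close> to \<open>(I, T)\<close> is \<open>(I, T) \<Omega>\<close> with \<open>\<Omega> = lift_skew a\<close>.\<close>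

definition lift_skew :: "('k::finite, 'd::finite) tuple \<Rightarrow> ('k option, 'd) tuple" where
  "lift_skew a = (let b = (1 / (real CARD('k) + 1)) *\<^sub>R (\<Sum>i\<in>UNIV. a $ i)
     in (\<chi> v. case v of None \<Rightarrow> - b | Some i \<Rightarrow> a $ i - b))"

text \<open>The effect on skew velocities of passing from the representative \<open>S\<close> of a
  quotient point to \<open>right_mult S Q\<close>.\<close>

definition conj_tuple :: "real^'d^'d \<Rightarrow> ('m::finite, 'd::finite) tuple \<Rightarrow> ('m, 'd) tuple" where
  "conj_tuple Q A = (\<chi> i. transpose Q ** A $ i ** Q)"

lemma linear_conj: "linear (\<lambda>A. P ** A ** Q)" for P Q :: "real^'d^'d"
  by (simp add: linear_iff matrix_matrix_mult_def vec_eq_iff sum.distrib algebra_simps sum_distrib_left sum_distrib_right)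

lemma conj_linear_simps:
  fixes P Q A B :: "real^'d^'d"
  shows "P ** (- A) ** Q = - (P ** A ** Q)" "P ** (A - B) ** Q = P ** A ** Q - P ** B ** Q"
    "P ** (\<Sum>v\<in>I. f v) ** Q = (\<Sum>v\<in>I. P ** f v ** Q)"
  by (rule linear_neg[OF linear_conj], rule linear_diff[OF linear_conj], rule linear_sum[OF linear_conj])

text \<open>Together with \<open>sum_lift_skew\<close> this determines the lift: the differences to
  the first slot are prescribed and the total is zero.\<close>

lemma lift_skew_diff: "lift_skew a $ Some i - lift_skew a $ None = a $ i"
  by (simp add: lift_skew_def Let_def)

lemma sum_lift_skew: "(\<Sum>v\<in>UNIV. lift_skew a $ v) = 0"
  for a :: "('k::finite, 'd::finite) tuple"
proof -
  define s where "s = (\<Sum>i\<in>UNIV. a $ i)"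
  define r where "r = 1 / (real CARD('k) + 1)"
  have "(\<Sum>v\<in>UNIV. lift_skew a $ v) = - (r *\<^sub>R s) + (s - real CARD('k) *\<^sub>R (r *\<^sub>R s))"
    by (simp add: sum_option lift_skew_def Let_def sum_subtractf sum_constant_scaleR
        s_def[symmetric] r_def[symmetric] del: sum_constant)
  also have "\<dots> = (1 - r * (real CARD('k) + 1)) *\<^sub>R s"
    by (simp add: algebra_simps)
  also have "\<dots> = 0" by (simp add: r_def field_simps)
  finally show ?thesis .
qed

lemma lift_skew_skew:
  fixes a :: "('k::finite, 'd::finite) tuple"
  assumes a: "a \<in> skew_tuples"
  shows "lift_skew a \<in> skew_tuples"
proof -
  have sub: "subspace (skew :: (real^'d^'d) set)"
  proof -
    have "transpose (x + y) = transpose x + transpose y" "transpose (c *\<^sub>R x) = c *\<^sub>R transpose x"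
      "transpose 0 = (0 :: real^'d^'d)" for x y :: "real^'d^'d" and c
      by (simp_all add: transpose_def vec_eq_iff)
    then show ?thesis by (simp add: subspace_def skew_def)
  qed
  have ai: "a $ i \<in> skew" for i using a by (simp add: skew_tuples_iff)
  have "(\<Sum>i\<in>UNIV. a $ i) \<in> skew" by (rule subspace_sum[OF sub]) (rule ai)
  then have "lift_skew a $ v \<in> skew" for v
    by (cases v)
      (simp_all add: lift_skew_def Let_def subspace_diff[OF sub] subspace_neg[OF sub]
        subspace_scale[OF sub] ai)
  then show ?thesis by (simp add: skew_tuples_iff)
qed

text \<open>\<open>lift_skew a\<close> is the tuple (0, a) minus its mean over all m slots, so this
  is the formula for a covariance.\<close>

lemma inner_lift_skew: "lift_skew a \<bullet> lift_skew b = a \<bullet> metric_op b"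
  for a b :: "('k::finite, 'd::finite) tuple"
proof -
  define s where "s = (\<Sum>i\<in>UNIV. a $ i)"
  define t where "t = (\<Sum>i\<in>UNIV. b $ i)"
  define r where "r = 1 / (real CARD('k) + 1)"
  have "lift_skew a \<bullet> lift_skew b = r * r * (s \<bullet> t)
      + (\<Sum>i\<in>UNIV. (a $ i - r *\<^sub>R s) \<bullet> (b $ i - r *\<^sub>R t))"
    unfolding inner_tuple
    by (simp add: sum_option lift_skew_def Let_def s_def[symmetric] t_def[symmetric] r_def[symmetric])
  also have "(\<Sum>i\<in>UNIV. (a $ i - r *\<^sub>R s) \<bullet> (b $ i - r *\<^sub>R t))
      = a \<bullet> b - r * (s \<bullet> t) - r * (s \<bullet> t) + real CARD('k) * (r * r * (s \<bullet> t))"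
    unfolding inner_tuple
    by (simp add: inner_diff_left inner_diff_right sum.distrib sum_subtractf algebra_simps
        sum_distrib_left[symmetric] inner_sum_left[symmetric] inner_sum_right[symmetric] s_def[symmetric] t_def[symmetric])
  also have "r * r * (s \<bullet> t) + (a \<bullet> b - r * (s \<bullet> t) - r * (s \<bullet> t) + real CARD('k) * (r * r * (s \<bullet> t)))
      = a \<bullet> b + (r * (real CARD('k) + 1) - 2) * (r * (s \<bullet> t))"
    by (simp add: algebra_simps)
  also have "r * (real CARD('k) + 1) = 1" by (simp add: r_def field_simps)
  also have "s \<bullet> t = a \<bullet> tsum b"
    unfolding inner_tuple by (simp add: tsum_def s_def t_def inner_sum_left)
  finally show ?thesis by (simp add: metric_op_def r_def inner_diff_right)
qed

lemma conj_tuple_inner: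
  fixes A B :: "('m::finite, 'd::finite) tuple"
  assumes Q: "orthogonal_matrix Q"
  shows "conj_tuple Q A \<bullet> conj_tuple Q B = A \<bullet> B"
proof -
  have "(transpose Q ** X ** Q) \<bullet> (transpose Q ** Y ** Q) = X \<bullet> Y" for X Y :: "real^'d^'d"
  proof -
    have "(transpose Q ** X ** Q) \<bullet> (transpose Q ** Y ** Q)
        = X \<bullet> ((Q ** transpose Q) ** Y ** (Q ** transpose Q))"
      by (simp only: inner_matrix_mult(2)[of "transpose Q ** X"] inner_matrix_mult(1)[of "transpose Q"]
          transpose_transpose matrix_mul_assoc)
    then show ?thesis using Q by (simp add: orthogonal_matrix_def)
  qed
  then show ?thesis by (simp add: inner_tuple conj_tuple_def)
qed

lemma conj_tuple_skew: "a \<in> skew_tuples \<Longrightarrow> conj_tuple Q a \<in> skew_tuples"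
proof -
  assume "a \<in> skew_tuples"
  moreover have "transpose (transpose Q ** B ** Q) = - (transpose Q ** B ** Q)" if "transpose B = - B" for B
    using that conj_linear_simps(1)[of "transpose Q" B Q] by (simp add: matrix_transpose_mul matrix_mul_assoc)
  ultimately show ?thesis by (simp add: skew_tuples_iff skew_def conj_tuple_def)
qed

lemma sum_conj_tuple: "(\<Sum>v\<in>UNIV. conj_tuple Q A $ v) = transpose Q ** (\<Sum>v\<in>UNIV. A $ v) ** Q"
  by (simp add: conj_tuple_def conj_linear_simps)

section \<open>Horizontal vectors and horizontal lifts\<close>

lemma horizontal_space_iff:
  "Z \<in> horizontal_space S \<longleftrightarrow> (\<exists>\<Omega>. Z = S \<odot> \<Omega> \<and> \<Omega> \<in> skew_tuples \<and> (\<Sum>v\<in>UNIV. \<Omega> $ v) = 0)"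
proof
  assume "Z \<in> horizontal_space S"
  then obtain \<Omega> where "Z = (\<chi> i. S $ i ** \<Omega> i)" "\<forall>i. \<Omega> i \<in> skew" "(\<Sum>i\<in>UNIV. \<Omega> i) = 0"
    unfolding horizontal_space_def by blast
  then show "\<exists>\<Omega>. Z = S \<odot> \<Omega> \<and> \<Omega> \<in> skew_tuples \<and> (\<Sum>v\<in>UNIV. \<Omega> $ v) = 0"
    by (intro exI[of _ "\<chi> i. \<Omega> i"]) (simp add: tmul_def skew_tuples_iff)
next
  assume "\<exists>\<Omega>. Z = S \<odot> \<Omega> \<and> \<Omega> \<in> skew_tuples \<and> (\<Sum>v\<in>UNIV. \<Omega> $ v) = 0"
  then show "Z \<in> horizontal_space S"
    unfolding horizontal_space_def by (auto simp: tmul_def skew_tuples_iff)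
qed

text \<open>The product rule for S_i S_1^T along S Omega gives S_i (Omega_i - Omega_1) S_1^T, the
  minus sign coming from skewness; writing S_i as (S_i S_1^T) S_1 splits off
  \<open>quot_map S\<close>.\<close>

lemma mderiv_quot_map_horizontal:
  fixes S :: "('k::finite option, 'd::finite) tuple"
  assumes S: "S \<in> orthogonal_tuples" and \<Omega>: "\<Omega> \<in> skew_tuples"
  shows "mderiv orthogonal_tuples quot_map S (S \<odot> \<Omega>) =
    quot_map S \<odot> (\<chi> i. S $ None ** (\<Omega> $ Some i - \<Omega> $ None) ** transpose (S $ None))"
proof -
  have sk: "transpose (\<Omega> $ None) = - \<Omega> $ None" using \<Omega> by (simp add: skew_tuples_iff skew_def)
  have cancel: "transpose (S $ None) ** S $ None = mat 1"
    using S by (simp add: orthogonal_tuples_def orthogonal_matrix_def)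
  have neg: "- A ** B = - (A ** B)" "A ** (B - B') = A ** B - A ** B'" "A ** - B = - (A ** B)"
    "(B - B') ** A = B ** A - B' ** A"
    for A B B' :: "real^'d^'d"
    by (simp_all add: matrix_matrix_mult_def vec_eq_iff sum_negf algebra_simps sum_subtractf)
  have 1: "transpose (S $ None) ** (S $ None ** A) = A" for A :: "real^'d^'d"
    by (simp add: matrix_mul_assoc cancel)
  show ?thesis
    unfolding mderiv_quot_map[OF tangent_spaceI[OF S \<Omega>]]
    by (simp add: tmul_def quot_map_def vec_eq_iff[of "vec_lambda _"] matrix_transpose_mul sk neg
        matrix_mul_assoc[symmetric] 1)
qed

text \<open>For existence, \<open>lift_skew a\<close> is the lift when the first view is the
  identity, and conjugation moves it to general \<open>S\<close>. For uniqueness, the derivative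
  condition fixes all differences to the first slot, and the zero sum then fixes the first
  slot.\<close>

lemma horizontal_lift_tangent:
  fixes S :: "('k::finite option, 'd::finite) tuple"
  assumes S: "S \<in> orthogonal_tuples" and a: "a \<in> skew_tuples"
  shows "horizontal_lift S (quot_map S \<odot> a) = S \<odot> conj_tuple (S $ None) (lift_skew a)"
  unfolding horizontal_lift_def
proof (rule the_equality, intro conjI)
  let ?Q = "S $ None"
  have cancel: "transpose ?Q ** ?Q = mat 1" "?Q ** transpose ?Q = mat 1"
    using S by (simp_all add: orthogonal_tuples_def orthogonal_matrix_def)
  have c': "?Q ** (transpose ?Q ** X) = X" "transpose ?Q ** (?Q ** X) = X" for X :: "real^'d^'d"
    by (simp_all add: matrix_mul_assoc cancel)
  have Tq: "quot_map S \<in> orthogonal_tuples" by (rule quot_map_orthogonal[OF S])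
  let ?\<Omega> = "conj_tuple ?Q (lift_skew a)"
  have sk: "?\<Omega> \<in> skew_tuples" by (rule conj_tuple_skew[OF lift_skew_skew[OF a]])
  show "S \<odot> ?\<Omega> \<in> horizontal_space S"
    unfolding horizontal_space_iff using sk sum_conj_tuple[of ?Q "lift_skew a"]
    by (intro exI[of _ ?\<Omega>]) (simp add: sum_lift_skew)
  have "?Q ** (?\<Omega> $ Some i - ?\<Omega> $ None) ** transpose ?Q = a $ i" for i
  proof -
    have "?\<Omega> $ Some i - ?\<Omega> $ None = transpose ?Q ** (lift_skew a $ Some i - lift_skew a $ None) ** ?Q"
      by (simp add: conj_tuple_def conj_linear_simps)
    then show ?thesis
      by (simp add: lift_skew_diff matrix_mul_assoc[symmetric] c' cancel)
  qed
  then show "mderiv orthogonal_tuples quot_map S (S \<odot> ?\<Omega>) = quot_map S \<odot> a"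
    by (simp add: mderiv_quot_map_horizontal[OF S sk])
  fix Z assume "Z \<in> horizontal_space S \<and> mderiv orthogonal_tuples quot_map S Z = quot_map S \<odot> a"
  then obtain \<Omega> where \<Omega>: "Z = S \<odot> \<Omega>" "\<Omega> \<in> skew_tuples" "(\<Sum>v\<in>UNIV. \<Omega> $ v) = 0"
    and m: "mderiv orthogonal_tuples quot_map S (S \<odot> \<Omega>) = quot_map S \<odot> a"
    by (auto simp: horizontal_space_iff)
  have "(\<chi> i. ?Q ** (\<Omega> $ Some i - \<Omega> $ None) ** transpose ?Q) = a"
    using m by (simp add: mderiv_quot_map_horizontal[OF S \<Omega>(2)] orthogonal_tuples_tmul_eq_iff[OF Tq])
  then have ai: "?Q ** (\<Omega> $ Some i - \<Omega> $ None) ** transpose ?Q = a $ i" for i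
    by (simp add: vec_eq_iff)
  have d1: "\<Omega> $ Some i = \<Omega> $ None + transpose ?Q ** a $ i ** ?Q" for i
    unfolding ai[symmetric] by (simp add: matrix_mul_assoc[symmetric] c' cancel)
  have d2: "?\<Omega> $ Some i = ?\<Omega> $ None + transpose ?Q ** a $ i ** ?Q" for i
    by (simp add: conj_tuple_def lift_skew_diff[of a i, symmetric] conj_linear_simps)
  have sums: "(real CARD('k) + 1) *\<^sub>R X $ None + (\<Sum>i\<in>UNIV. transpose ?Q ** a $ i ** ?Q) = 0"
    if "(\<Sum>v\<in>UNIV. X $ v) = 0" "\<And>i. X $ Some i = X $ None + transpose ?Q ** a $ i ** ?Q"
    for X :: "('k option, 'd) tuple"
  proof -
    have "(\<Sum>v\<in>UNIV. X $ v) = X $ None + (\<Sum>i\<in>UNIV. X $ None + transpose ?Q ** a $ i ** ?Q)"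
      by (simp only: sum_option that(2))
    also have "\<dots> = (real CARD('k) + 1) *\<^sub>R X $ None + (\<Sum>i\<in>UNIV. transpose ?Q ** a $ i ** ?Q)"
      by (simp only: sum.distrib sum_constant_scaleR scaleR_left_distrib scaleR_one add_ac)
    finally show ?thesis using that(1) by simp
  qed
  have "(\<Sum>v\<in>UNIV. ?\<Omega> $ v) = 0" by (simp add: sum_conj_tuple sum_lift_skew)
  from sums[OF \<Omega>(3) d1] sums[OF this d2]
  have "(real CARD('k) + 1) *\<^sub>R \<Omega> $ None = (real CARD('k) + 1) *\<^sub>R ?\<Omega> $ None"
    by (metis add_right_cancel)
  moreover have "real CARD('k) + 1 \<noteq> 0" using of_nat_0_le_iff[of "CARD('k)"] by linarith
  ultimately have "\<Omega> $ None = ?\<Omega> $ None" by (simp only: scaleR_cancel_left) simp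
  then have "\<Omega> $ v = ?\<Omega> $ v" for v using d1 d2 by (cases v) simp_all
  then have "\<Omega> = ?\<Omega>" by (intro vec_eq_iff[THEN iffD2] allI) simp
  then show "Z = S \<odot> ?\<Omega>" using \<Omega>(1) by simp
qed

lemma g_total_eq_inner: "g_total Z W = Z \<bullet> W"
  for Z W :: "('m::finite, 'd::finite) tuple"
proof -
  have "g_total Z W = (\<Sum>q\<in>UNIV. \<Sum>(i, p)\<in>UNIV \<times> UNIV. Z $ i $ p $ q * W $ i $ p $ q)"
    by (simp add: g_total_def trace_def matrix_matrix_mult_def transpose_def stack_def UNIV_Times_UNIV split_def)
  also have "\<dots> = (\<Sum>(i, p)\<in>UNIV \<times> UNIV. \<Sum>q\<in>UNIV. Z $ i $ p $ q * W $ i $ p $ q)"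
    by (subst sum.swap) (simp add: split_def)
  also have "\<dots> = Z \<bullet> W"
    by (simp only: sum.cartesian_product[symmetric]) (simp add: inner_vec_def)
  finally show ?thesis .
qed

text \<open>Conjugation by an orthogonal matrix is an isometry of tuples, so the preimage picked by
  the choice in \<open>g_quot\<close> does not influence the value.\<close>

lemma g_quot_tangent:
  fixes T :: "('k::finite, 'd::finite) tuple"
  assumes T: "T \<in> orthogonal_tuples" and a: "a \<in> skew_tuples" and b: "b \<in> skew_tuples"
  shows "g_quot T (T \<odot> a) (T \<odot> b) = a \<bullet> metric_op b"
proof -
  define S :: "('k option, 'd) tuple" where "S = (SOME S. S \<in> orthogonal_tuples \<and> quot_map S = T)"
  have "S \<in> orthogonal_tuples \<and> quot_map S = T"
    unfolding S_def by (rule someI[of _ "with_identity T"]) (simp add: T with_identity_orthogonal)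
  then have S: "S \<in> orthogonal_tuples" "T = quot_map S" by auto
  have Q: "orthogonal_matrix (S $ None)" using S(1) by (simp add: orthogonal_tuples_def)
  have "g_quot T (T \<odot> a) (T \<odot> b) = horizontal_lift S (T \<odot> a) \<bullet> horizontal_lift S (T \<odot> b)"
    by (simp add: g_quot_def S_def[symmetric] g_total_eq_inner)
  also have "\<dots> = conj_tuple (S $ None) (lift_skew a) \<bullet> conj_tuple (S $ None) (lift_skew b)"
    unfolding S(2) horizontal_lift_tangent[OF S(1) a] horizontal_lift_tangent[OF S(1) b]
    by (simp add: inner_tmul_left orthogonal_tuples_cancel[OF S(1)])
  also have "\<dots> = a \<bullet> metric_op b"
    by (simp add: conj_tuple_inner[OF Q] inner_lift_skew)
  finally show ?thesis .
qed

section \<open>The Levi-Civita connection of the quotient metric\<close>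

text \<open>Half the bracket plus the correction that Koszul's formula gives for the left-invariant metric
  \<open>a \<bullet> metric_op b\<close>.\<close>

definition conn :: "('k::finite, 'd::finite) tuple \<Rightarrow> ('k, 'd) tuple \<Rightarrow> ('k, 'd) tuple" where
  "conn a b = (1/2) *\<^sub>R (bracket a b
     + (1 / (real CARD('k) + 1)) *\<^sub>R (bracket (tsum a) b + bracket (tsum b) a))"

lemma bounded_bilinear_conn: "bounded_bilinear (conn :: ('k::finite, 'd::finite) tuple \<Rightarrow> _)"
  unfolding bilinear_conv_bounded_bilinear[symmetric] bilinear_def linear_iff
  by (simp add: conn_def bracket_simps tsum_linear_simps algebra_simps)

lemma conn_skew: "a \<in> skew_tuples \<Longrightarrow> b \<in> skew_tuples \<Longrightarrow> conn a b \<in> skew_tuples"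
  unfolding conn_def
  by (intro subspace_add subspace_scale subspace_skew_tuples bracket_skew tsum_skew)

lemma conn_torsion: "conn a b - conn b a = bracket a b"
proof -
  have "conn a b - conn b a = (1/2) *\<^sub>R (bracket a b - bracket b a)"
    by (simp add: conn_def algebra_simps)
  then show ?thesis by (simp add: bracket_commute[of b a] scaleR_2[symmetric] del: scaleR_2)
qed

text \<open>Koszul's formula with \<open>metric_op\<close> kept on both sides. The correction in
  \<open>conn\<close> has vanishing \<open>tsum\<close>, since the brackets of \<open>tsum a\<close>
  and \<open>tsum b\<close> cancel, so \<open>metric_op\<close> fixes it; this is why
  \<open>conn\<close> can be written without the inverse of \<open>metric_op\<close>.\<close>

lemma metric_op_conn:
  fixes a b :: "('k::finite, 'd::finite) tuple"
  shows "2 *\<^sub>R metric_op (conn a b) = metric_op (bracket a b) - bracket (metric_op a) b - bracket (metric_op b) a"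
proof -
  define r where "r = 1 / (real CARD('k) + 1)"
  define P where "P = bracket (tsum a) b + bracket (tsum b) a"
  have tb: "tsum (bracket (tsum u) v) = bracket (tsum u) (tsum v)" for u v :: "('k, 'd) tuple"
    by (simp add: bracket_def tsum_linear_simps tsum_tmul_tsum_left tsum_tmul_tsum_right)
  have "tsum P = bracket (tsum a) (tsum b) + bracket (tsum b) (tsum a)"
    by (simp only: P_def tsum_linear_simps tb)
  then have "tsum P = 0" by (simp add: bracket_def)
  then have mP: "metric_op P = P" by (simp add: metric_op_def)
  have e: "2 *\<^sub>R conn a b = bracket a b + r *\<^sub>R P"
    by (simp add: conn_def P_def r_def)
  have "2 *\<^sub>R metric_op (conn a b) = metric_op (2 *\<^sub>R conn a b)"
    by (simp only: linear_cmul[OF linear_metric_op])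
  also have "\<dots> = metric_op (bracket a b) + r *\<^sub>R P"
    by (simp only: e linear_add[OF linear_metric_op] linear_cmul[OF linear_metric_op] mP)
  also have "r *\<^sub>R P = - bracket (metric_op a) b - bracket (metric_op b) a"
  proof -
    have m: "bracket (metric_op u) v = bracket u v - r *\<^sub>R bracket (tsum u) v" for u v :: "('k, 'd) tuple"
      by (simp only: metric_op_def r_def bracket_simps)
    show ?thesis unfolding P_def m bracket_commute[of b a] by (simp add: scaleR_add_right)
  qed
  finally show ?thesis by simp
qed

text \<open>After \<open>metric_op_conn\<close> the six bracket terms cancel in pairs by
  \<open>inner_bracket_cyclic\<close>.\<close>

lemma conn_compatible:
  assumes a: "a \<in> skew_tuples" and b: "b \<in> skew_tuples" and c: "c \<in> skew_tuples"
  shows "conn a b \<bullet> metric_op c + b \<bullet> metric_op (conn a c) = 0"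
proof -
  note [simp] = metric_op_skew
  have e: "2 * (u \<bullet> metric_op (conn a v)) = metric_op u \<bullet> bracket a v - u \<bullet> bracket (metric_op a) v - u \<bullet> bracket (metric_op v) a"
    for u v
    using arg_cong[OF metric_op_conn[of a v], of "\<lambda>z. u \<bullet> z"] by (simp add: inner_diff_right inner_metric_op)
  have "2 * (conn a b \<bullet> metric_op c + b \<bullet> metric_op (conn a c))
    = 2 * (c \<bullet> metric_op (conn a b)) + 2 * (b \<bullet> metric_op (conn a c))"
    by (metis inner_commute inner_metric_op distrib_left)
  also have "\<dots> = metric_op c \<bullet> bracket a b - c \<bullet> bracket (metric_op a) b - c \<bullet> bracket (metric_op b) a
     + (metric_op b \<bullet> bracket a c - b \<bullet> bracket (metric_op a) c - b \<bullet> bracket (metric_op c) a)"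
    by (simp add: e)
  also have "metric_op c \<bullet> bracket a b = b \<bullet> bracket (metric_op c) a"
    using inner_bracket_cyclic[of "metric_op c" a b] inner_bracket_cyclic[of a b "metric_op c"] a b c by simp
  also have "metric_op b \<bullet> bracket a c = c \<bullet> bracket (metric_op b) a"
    using inner_bracket_cyclic[of "metric_op b" a c] inner_bracket_cyclic[of a c "metric_op b"] a b c by simp
  also have "c \<bullet> bracket (metric_op a) b = - (b \<bullet> bracket (metric_op a) c)"
    using inner_bracket_cyclic[of b "metric_op a" c] inner_bracket_cyclic[of "metric_op a" c b] a b c
    by (simp add: bracket_commute[of b])
  finally show ?thesis by simp
qed

abbreviation (input) Od :: "(('k::finite, 'd::finite) tuple) set" where
  "Od \<equiv> orthogonal_tuples"

definition left_triv :: "(('k::finite, 'd::finite) tuple \<Rightarrow> ('k, 'd) tuple) \<Rightarrow> ('k, 'd) tuple \<Rightarrow> ('k, 'd) tuple" where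
  "left_triv Y T = adj T \<odot> Y T"

text \<open>A field is differentiated through its coefficients in the left-invariant frame;
  \<open>conn\<close> supplies the Christoffel term.\<close>

definition lc_conn :: "('k::finite, 'd::finite) tuple \<Rightarrow> ('k, 'd) tuple \<Rightarrow>
    (('k, 'd) tuple \<Rightarrow> ('k, 'd) tuple) \<Rightarrow> ('k, 'd) tuple" where
  "lc_conn T u Y = T \<odot> (mderiv Od (left_triv Y) T u + conn (adj T \<odot> u) (left_triv Y T))"

lemma smooth_map_adj: "smooth_map M f \<Longrightarrow> smooth_map M (\<lambda>T. adj (f T))"
  by (rule smooth_map_bounded_linear[OF bounded_linear_adj])

lemma smooth_map_tmul: "smooth_map M f \<Longrightarrow> smooth_map M g \<Longrightarrow> smooth_map M (\<lambda>T. f T \<odot> g T)"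
  by (rule smooth_map_bounded_bilinear[OF bounded_bilinear_tmul])

lemma smooth_left_triv: "smooth_map M Y \<Longrightarrow> smooth_map M (left_triv Y)"
  unfolding left_triv_def[abs_def] by (intro smooth_map_tmul smooth_map_adj smooth_map_ident)

lemma left_triv_mult: "T \<in> Od \<Longrightarrow> T \<odot> left_triv Y T = Y T"
  by (simp add: left_triv_def orthogonal_tuples_cancel)

lemma vector_fieldD:
  assumes "vector_field Od Y"
  shows "smooth_map Od Y" "smooth_map Od (left_triv Y)" "T \<in> Od \<Longrightarrow> Y T \<in> tangent_space Od T"
    "T \<in> Od \<Longrightarrow> left_triv Y T \<in> skew_tuples"
  using assms unfolding vector_field_def
  by (auto simp: smooth_left_triv) (auto simp: left_triv_def tangent_spaceD)

lemma mderiv_left_triv_skew: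
  assumes Y: "vector_field Od Y" and T: "T \<in> Od" and u: "u \<in> tangent_space Od T"
  shows "mderiv Od (left_triv Y) T u \<in> skew_tuples"
proof -
  note sY = vector_fieldD(2)[OF Y]
  have "mderiv Od (\<lambda>T. adj (left_triv Y T) + left_triv Y T) T u = mderiv Od (\<lambda>T. 0) T u"
    by (rule mderiv_cong[OF smooth_map_const T _ u])
      (use vector_fieldD(4)[OF Y] in \<open>simp add: skew_tuples_def\<close>)
  then have "adj (mderiv Od (left_triv Y) T u) + mderiv Od (left_triv Y) T u = 0"
    by (simp add: mderiv_add[OF smooth_map_adj[OF sY] sY T u] mderiv_const[OF u]
        mderiv_bounded_linear[OF bounded_linear_adj sY T u])
  then show ?thesis by (simp add: skew_tuples_def eq_neg_iff_add_eq_0)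
qed

lemma lc_conn_skew:
  assumes "vector_field Od Y" "T \<in> Od" "u \<in> tangent_space Od T"
  shows "mderiv Od (left_triv Y) T u + conn (adj T \<odot> u) (left_triv Y T) \<in> skew_tuples"
  using assms
  by (intro subspace_add[OF subspace_skew_tuples] mderiv_left_triv_skew conn_skew tangent_spaceD vector_fieldD(4))

lemma vector_field_tmul:
  assumes w: "smooth_map Od w" and sk: "\<And>T. T \<in> Od \<Longrightarrow> w T \<in> skew_tuples"
  shows "vector_field Od (\<lambda>T. T \<odot> w T)"
  unfolding vector_field_def
  by (intro conjI ballI smooth_map_tmul smooth_map_ident w tangent_spaceI sk)

lemma left_invariant_vector_field: "b \<in> skew_tuples \<Longrightarrow> vector_field Od (\<lambda>T. T \<odot> b)"
  by (rule vector_field_tmul[OF smooth_map_const])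

lemma mderiv_vector_field:
  assumes Y: "vector_field Od Y" and T: "T \<in> Od" and u: "u \<in> tangent_space Od T"
  shows "mderiv Od Y T u = T \<odot> mderiv Od (left_triv Y) T u + u \<odot> left_triv Y T"
proof -
  have "mderiv Od Y T u = mderiv Od (\<lambda>T. T \<odot> left_triv Y T) T u"
    by (rule mderiv_cong[OF smooth_map_tmul[OF smooth_map_ident vector_fieldD(2)[OF Y]] T _ u])
      (simp add: left_triv_mult)
  then show ?thesis
    by (simp add: mderiv_bounded_bilinear[OF bounded_bilinear_tmul smooth_map_ident vector_fieldD(2)[OF Y] T u]
        mderiv_ident[OF u])
qed

text \<open>The product rule for \<open>T \<odot> left_triv Y T\<close> produces exactly the
  commutator that \<open>conn_torsion\<close> leaves.\<close>

lemma lc_conn_torsion: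
  assumes X: "vector_field Od X" and Y: "vector_field Od Y" and T: "T \<in> Od"
  shows "lc_conn T (X T) Y - lc_conn T (Y T) X = mderiv Od Y T (X T) - mderiv Od X T (Y T)"
proof -
  note tX = vector_fieldD(3)[OF X T] and tY = vector_fieldD(3)[OF Y T]
  have "lc_conn T (X T) Y - lc_conn T (Y T) X
      = T \<odot> (mderiv Od (left_triv Y) T (X T) - mderiv Od (left_triv X) T (Y T))
        + T \<odot> (conn (left_triv X T) (left_triv Y T) - conn (left_triv Y T) (left_triv X T))"
    by (simp add: lc_conn_def left_triv_def[symmetric] tmul_simps)
  also have "\<dots> = T \<odot> (mderiv Od (left_triv Y) T (X T) - mderiv Od (left_triv X) T (Y T))
        + (T \<odot> left_triv X T \<odot> left_triv Y T - T \<odot> left_triv Y T \<odot> left_triv X T)"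
    unfolding conn_torsion bracket_def by (simp add: tmul_simps tmul_assoc)
  also have "\<dots> = mderiv Od Y T (X T) - mderiv Od X T (Y T)"
    unfolding mderiv_vector_field[OF Y T tX] mderiv_vector_field[OF X T tY]
    by (simp add: left_triv_mult[OF T] tmul_simps)
  finally show ?thesis .
qed

lemma g_quot_eq:
  assumes T: "T \<in> Od" and v: "v \<in> tangent_space Od T" and w: "w \<in> tangent_space Od T"
  shows "g_quot T v w = (adj T \<odot> v) \<bullet> metric_op (adj T \<odot> w)"
  using g_quot_tangent[OF T tangent_spaceD[OF T v] tangent_spaceD[OF T w]]
  by (simp add: orthogonal_tuples_cancel[OF T])

lemma bounded_linear_metric_op: "bounded_linear metric_op"
  using linear_metric_op by (simp add: linear_conv_bounded_linear)

text \<open>Existence, on which the choice in \<open>levi_civita\<close> depends: it is what gives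
  the chosen connection the axioms.\<close>

lemma lc_conn_is_levi_civita:
  "is_levi_civita (Od :: (('k::finite, 'd::finite) tuple) set) g_quot lc_conn"
  unfolding is_levi_civita_def affine_connection_def
proof (intro conjI allI impI ballI)
  fix Y :: "('k, 'd) tuple \<Rightarrow> ('k, 'd) tuple" and T u :: "('k, 'd) tuple"
  assume Y: "vector_field Od Y" and T: "T \<in> Od" and u: "u \<in> tangent_space Od T"
  show "lc_conn T u Y \<in> tangent_space Od T"
    unfolding lc_conn_def by (rule tangent_spaceI[OF T lc_conn_skew[OF Y T u]])
next
  fix X Y :: "('k, 'd) tuple \<Rightarrow> ('k, 'd) tuple"
  assume X: "vector_field Od X" and Y: "vector_field Od Y"
  show "vector_field Od (\<lambda>T. lc_conn T (X T) Y)"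
    unfolding lc_conn_def left_triv_def[of X, symmetric]
  proof (rule vector_field_tmul)
    show "smooth_map Od (\<lambda>T. mderiv Od (left_triv Y) T (X T) + conn (left_triv X T) (left_triv Y T))"
      by (intro smooth_map_add smooth_map_mderiv X vector_fieldD(2) Y
          smooth_map_bounded_bilinear[OF bounded_bilinear_conn])
    show "mderiv Od (left_triv Y) T (X T) + conn (left_triv X T) (left_triv Y T) \<in> skew_tuples" if T: "T \<in> Od" for T
      using lc_conn_skew[OF Y T vector_fieldD(3)[OF X T]] by (simp add: left_triv_def[symmetric])
  qed
next
  fix Y :: "('k, 'd) tuple \<Rightarrow> ('k, 'd) tuple" and T u v :: "('k, 'd) tuple" and a b :: real
  assume Y: "vector_field Od Y" and T: "T \<in> Od"
    and u: "u \<in> tangent_space Od T" and v: "v \<in> tangent_space Od T"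
  note lin = linear_mderiv[OF vector_fieldD(2)[OF Y] T]
  show "lc_conn T (a *\<^sub>R u + b *\<^sub>R v) Y = a *\<^sub>R lc_conn T u Y + b *\<^sub>R lc_conn T v Y"
    by (simp add: lc_conn_def linear_add[OF lin] linear_cmul[OF lin] tmul_simps
        bounded_bilinear.add_left[OF bounded_bilinear_conn] bounded_bilinear.scaleR_left[OF bounded_bilinear_conn]
        algebra_simps)
next
  fix Y Z :: "('k, 'd) tuple \<Rightarrow> ('k, 'd) tuple" and T u :: "('k, 'd) tuple" and a b :: real
  assume Y: "vector_field Od Y" and Z: "vector_field Od Z" and T: "T \<in> Od" and u: "u \<in> tangent_space Od T"
  note sY = vector_fieldD(2)[OF Y] and sZ = vector_fieldD(2)[OF Z]
  have e: "left_triv (\<lambda>y. a *\<^sub>R Y y + b *\<^sub>R Z y) = (\<lambda>y. a *\<^sub>R left_triv Y y + b *\<^sub>R left_triv Z y)"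
    by (simp add: left_triv_def fun_eq_iff tmul_simps)
  have d: "mderiv Od (\<lambda>y. a *\<^sub>R left_triv Y y + b *\<^sub>R left_triv Z y) T u
      = a *\<^sub>R mderiv Od (left_triv Y) T u + b *\<^sub>R mderiv Od (left_triv Z) T u"
    by (simp add: mderiv_add[OF smooth_map_scaleR_const[OF sY] smooth_map_scaleR_const[OF sZ] T u]
        mderiv_bounded_linear[OF bounded_linear_scaleR_right sY T u] mderiv_bounded_linear[OF bounded_linear_scaleR_right sZ T u])
  show "lc_conn T u (\<lambda>y. a *\<^sub>R Y y + b *\<^sub>R Z y) = a *\<^sub>R lc_conn T u Y + b *\<^sub>R lc_conn T u Z"
    by (simp add: lc_conn_def e d tmul_simps
        bounded_bilinear.add_right[OF bounded_bilinear_conn] bounded_bilinear.scaleR_right[OF bounded_bilinear_conn]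
        algebra_simps)
next
  fix f :: "('k, 'd) tuple \<Rightarrow> real" and Y :: "('k, 'd) tuple \<Rightarrow> ('k, 'd) tuple" and T u :: "('k, 'd) tuple"
  assume f: "smooth_map Od f" and Y: "vector_field Od Y" and T: "T \<in> Od" and u: "u \<in> tangent_space Od T"
  note sY = vector_fieldD(2)[OF Y]
  have e: "left_triv (\<lambda>y. f y *\<^sub>R Y y) = (\<lambda>y. f y *\<^sub>R left_triv Y y)"
    by (simp add: left_triv_def fun_eq_iff tmul_simps)
  show "lc_conn T u (\<lambda>y. f y *\<^sub>R Y y) = mderiv Od f T u *\<^sub>R Y T + f T *\<^sub>R lc_conn T u Y"
    by (simp add: lc_conn_def e mderiv_bounded_bilinear[OF bounded_bilinear_scaleR f sY T u] tmul_simps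
        bounded_bilinear.scaleR_right[OF bounded_bilinear_conn] left_triv_mult[OF T] algebra_simps)
next
  fix X Y :: "('k, 'd) tuple \<Rightarrow> ('k, 'd) tuple" and f :: "('k, 'd) tuple \<Rightarrow> real" and T :: "('k, 'd) tuple"
  assume X: "vector_field Od X" and Y: "vector_field Od Y" and f: "smooth_map Od f" and T: "T \<in> Od"
  \<comment> \<open>By \<open>lc_conn_torsion\<close> this difference is the Lie bracket, so its
    tangency is the side condition of \<open>mderiv_commutator\<close>.\<close>
  have "lc_conn T (X T) Y - lc_conn T (Y T) X \<in> tangent_space Od T"
    unfolding lc_conn_def
    by (intro subspace_diff[OF subspace_tangent_space[OF T]] tangent_spaceI[OF T] lc_conn_skew X Y T
        vector_fieldD(3))
  then show "mderiv Od f T (lc_conn T (X T) Y - lc_conn T (Y T) X) =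
      mderiv Od (\<lambda>y. mderiv Od f y (Y y)) T (X T) - mderiv Od (\<lambda>y. mderiv Od f y (X y)) T (Y T)"
    unfolding lc_conn_torsion[OF X Y T] using mderiv_commutator[OF f X Y T] by simp
next
  fix Y Z :: "('k, 'd) tuple \<Rightarrow> ('k, 'd) tuple" and T u :: "('k, 'd) tuple"
  assume Y: "vector_field Od Y" and Z: "vector_field Od Z" and T: "T \<in> Od" and u: "u \<in> tangent_space Od T"
  note sY = vector_fieldD(2)[OF Y] and sZ = vector_fieldD(2)[OF Z]
  let ?dY = "mderiv Od (left_triv Y) T u" and ?dZ = "mderiv Od (left_triv Z) T u"
  let ?y = "left_triv Y T" and ?z = "left_triv Z T" and ?a = "adj T \<odot> u"
  have 1: "mderiv Od (\<lambda>y. g_quot y (Y y) (Z y)) T u = mderiv Od (\<lambda>y. left_triv Y y \<bullet> metric_op (left_triv Z y)) T u"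
    by (rule mderiv_cong[OF smooth_map_bounded_bilinear[OF bounded_bilinear_inner sY
          smooth_map_bounded_linear[OF bounded_linear_metric_op sZ]] T _ u])
      (simp add: g_quot_eq vector_fieldD(3)[OF Y] vector_fieldD(3)[OF Z] left_triv_def)
  also have 2: "\<dots> = ?y \<bullet> metric_op ?dZ + ?dY \<bullet> metric_op ?z"
    by (simp add: mderiv_bounded_bilinear[OF bounded_bilinear_inner sY
          smooth_map_bounded_linear[OF bounded_linear_metric_op sZ] T u]
        mderiv_bounded_linear[OF bounded_linear_metric_op sZ T u])
  have g: "g_quot T (lc_conn T u Y) (Z T) = (?dY + conn ?a ?y) \<bullet> metric_op ?z"
    "g_quot T (Y T) (lc_conn T u Z) = ?y \<bullet> metric_op (?dZ + conn ?a ?z)"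
    using g_quot_tangent[OF T lc_conn_skew[OF Y T u] vector_fieldD(4)[OF Z T]]
      g_quot_tangent[OF T vector_fieldD(4)[OF Y T] lc_conn_skew[OF Z T u]]
    by (simp_all add: lc_conn_def left_triv_mult[OF T])
  have "conn ?a ?y \<bullet> metric_op ?z + ?y \<bullet> metric_op (conn ?a ?z) = 0"
    by (rule conn_compatible[OF tangent_spaceD[OF T u] vector_fieldD(4)[OF Y T] vector_fieldD(4)[OF Z T]])
  then show "mderiv Od (\<lambda>y. g_quot y (Y y) (Z y)) T u
      = g_quot T (lc_conn T u Y) (Z T) + g_quot T (Y T) (lc_conn T u Z)"
    unfolding 1 2 g by (simp add: inner_add_left inner_add_right linear_add[OF linear_metric_op])
qed

section \<open>The chosen connection on left-invariant fields\<close>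

lemma levi_civita_is_levi_civita:
  "is_levi_civita Od g_quot (levi_civita (Od :: (('k::finite, 'd::finite) tuple) set) g_quot)"
  unfolding levi_civita_def by (rule someI[of "is_levi_civita Od g_quot", OF lc_conn_is_levi_civita])

lemma
  fixes f :: "'a::euclidean_space \<Rightarrow> real"
  assumes "is_levi_civita M g nab" "vector_field M Y" "x \<in> M"
  shows levi_civita_tangent: "u \<in> tangent_space M x \<Longrightarrow> nab x u Y \<in> tangent_space M x"
    and levi_civita_torsion: "vector_field M X \<Longrightarrow> smooth_map M f \<Longrightarrow>
      mderiv M f x (nab x (X x) Y - nab x (Y x) X) =
        mderiv M (\<lambda>y. mderiv M f y (Y y)) x (X x) - mderiv M (\<lambda>y. mderiv M f y (X y)) x (Y x)"
    and levi_civita_metric: "vector_field M Z \<Longrightarrow> u \<in> tangent_space M x \<Longrightarrow>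
      mderiv M (\<lambda>y. g y (Y y) (Z y)) x u = g x (nab x u Y) (Z x) + g x (Y x) (nab x u Z)"
proof -
  note L = assms(1)[unfolded is_levi_civita_def]
  show "nab x u Y \<in> tangent_space M x" if "u \<in> tangent_space M x"
    using L[THEN conjunct1, unfolded affine_connection_def, THEN conjunct1] assms(2,3) that by simp
  show "mderiv M f x (nab x (X x) Y - nab x (Y x) X) =
      mderiv M (\<lambda>y. mderiv M f y (Y y)) x (X x) - mderiv M (\<lambda>y. mderiv M f y (X y)) x (Y x)"
    if "vector_field M X" "smooth_map M f"
    using L[THEN conjunct2, THEN conjunct1] assms(2,3) that by blast
  show "mderiv M (\<lambda>y. g y (Y y) (Z y)) x u = g x (nab x u Y) (Z x) + g x (Y x) (nab x u Z)"
    if "vector_field M Z" "u \<in> tangent_space M x"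
    using L[THEN conjunct2, THEN conjunct2] assms(2,3) that by blast
qed

lemma left_triv_left_invariant: "T \<in> Od \<Longrightarrow> left_triv (\<lambda>T. T \<odot> b) T = b"
  by (simp add: left_triv_def orthogonal_tuples_cancel)

lemma lc_conn_left_invariant:
  assumes T: "T \<in> Od" and a: "a \<in> skew_tuples"
  shows "lc_conn T (T \<odot> a) (\<lambda>T. T \<odot> b) = T \<odot> conn a b"
proof -
  have "mderiv Od (left_triv (\<lambda>T. T \<odot> b)) T (T \<odot> a) = mderiv Od (\<lambda>T. b) T (T \<odot> a)"
    by (rule mderiv_cong[OF smooth_map_const T left_triv_left_invariant tangent_spaceI[OF T a]])
  then show ?thesis
    by (simp add: lc_conn_def left_triv_left_invariant[OF T] orthogonal_tuples_cancel[OF T]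
        mderiv_const[OF tangent_spaceI[OF T a]])
qed

text \<open>The difference of two Levi-Civita connections on left-invariant fields is a trilinear form
  symmetric in its first two and antisymmetric in its last two arguments, hence zero.\<close>

lemma levi_civita_left_invariant:
  fixes T :: "('k::finite, 'd::finite) tuple"
  assumes T: "T \<in> Od" and a: "a \<in> skew_tuples" and b: "b \<in> skew_tuples"
  shows "levi_civita Od g_quot T (T \<odot> a) (\<lambda>T. T \<odot> b) = T \<odot> conn a b"
proof -
  define X :: "('k, 'd) tuple \<Rightarrow> ('k, 'd) tuple \<Rightarrow> ('k, 'd) tuple" where "X b T = T \<odot> b" for b T
  let ?n = "levi_civita (Od :: (('k, 'd) tuple) set) g_quot"
  have vX: "vector_field Od (X b)" if "b \<in> skew_tuples" for b
    unfolding X_def using left_invariant_vector_field[OF that] .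
  have tX: "X b T \<in> tangent_space Od T" if "b \<in> skew_tuples" for b
    unfolding X_def using tangent_spaceI[OF T that] .
  have tang: "nab T (X a T) (X b) \<in> tangent_space Od T"
    if "is_levi_civita Od g_quot nab" "a \<in> skew_tuples" "b \<in> skew_tuples" for nab a b
    by (rule levi_civita_tangent[OF that(1) vX[OF that(3)] T tX[OF that(2)]])
  have tor: "mderiv Od f T (nab T (X a T) (X b) - nab T (X b T) (X a)) =
      mderiv Od (\<lambda>y. mderiv Od f y (X b y)) T (X a T) - mderiv Od (\<lambda>y. mderiv Od f y (X a y)) T (X b T)"
    if "is_levi_civita Od g_quot nab" "a \<in> skew_tuples" "b \<in> skew_tuples" "smooth_map Od f"
    for nab a b and f :: "('k, 'd) tuple \<Rightarrow> real"
    by (rule levi_civita_torsion[OF that(1) vX[OF that(3)] T vX[OF that(2)] that(4)])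
  have met: "mderiv Od (\<lambda>y. g_quot y (X b y) (X c y)) T (X a T) =
      g_quot T (nab T (X a T) (X b)) (X c T) + g_quot T (X b T) (nab T (X a T) (X c))"
    if "is_levi_civita Od g_quot nab" "a \<in> skew_tuples" "b \<in> skew_tuples" "c \<in> skew_tuples" for nab a b c
    by (rule levi_civita_metric[OF that(1) vX[OF that(3)] T vX[OF that(4)] tX[OF that(2)]])
  define p where "p a b = adj T \<odot> (?n T (X a T) (X b) - lc_conn T (X a T) (X b))" for a b
  note n = levi_civita_is_levi_civita and l = lc_conn_is_levi_civita
  have psk: "p a b \<in> skew_tuples" if "a \<in> skew_tuples" "b \<in> skew_tuples" for a b
    unfolding p_def
    by (intro tangent_spaceD[OF T] subspace_diff[OF subspace_tangent_space[OF T]] tang n l that)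
  have psym: "p a b = p b a" if "a \<in> skew_tuples" "b \<in> skew_tuples" for a b
  proof -
    let ?v = "?n T (X a T) (X b) - ?n T (X b T) (X a)" and ?w = "lc_conn T (X a T) (X b) - lc_conn T (X b T) (X a)"
    have tv: "?v \<in> tangent_space Od T" "?w \<in> tangent_space Od T"
      by (intro subspace_diff[OF subspace_tangent_space[OF T]] tang n l that)+
    \<comment> \<open>The torsion axiom speaks of derivatives of functions; the coordinate functions
      \<open>\<lambda>y. y \<bullet> e\<close> recover the vector itself.\<close>
    have "?v \<bullet> e = ?w \<bullet> e" for e
    proof -
      have se: "smooth_map Od (\<lambda>y. y \<bullet> e)" by (rule smooth_map_bounded_linear[OF bounded_linear_inner_left smooth_map_ident])
      have "mderiv Od (\<lambda>y. y \<bullet> e) T ?v = mderiv Od (\<lambda>y. y \<bullet> e) T ?w"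
        unfolding tor[OF n that se] tor[OF l that se] ..
      then show ?thesis
        using mderiv_bounded_linear[OF bounded_linear_inner_left smooth_map_ident T] tv
        by (simp add: mderiv_ident)
    qed
    then have "?v = ?w" using vector_eq_rdot by blast
    then have "adj T \<odot> (?v - ?w) = 0" by (simp add: tmul_simps)
    moreover have "adj T \<odot> (?v - ?w) = p a b - p b a"
      unfolding p_def by (simp only: tmul_simps) simp
    ultimately show ?thesis by simp
  qed
  have pant: "p a b \<bullet> metric_op c + b \<bullet> metric_op (p a c) = 0"
    if abc: "a \<in> skew_tuples" "b \<in> skew_tuples" "c \<in> skew_tuples" for a b c
  proof -
    have "g_quot T (?n T (X a T) (X b)) (X c T) + g_quot T (X b T) (?n T (X a T) (X c))
      = g_quot T (lc_conn T (X a T) (X b)) (X c T) + g_quot T (X b T) (lc_conn T (X a T) (X c))"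
      using met[OF n abc] met[OF l abc] by simp
    moreover have "adj T \<odot> X b T = b" for b by (simp add: X_def orthogonal_tuples_cancel[OF T])
    ultimately show ?thesis
      unfolding p_def
      by (simp add: g_quot_eq[OF T] tang n l tX abc tmul_simps inner_diff_left inner_diff_right
          linear_diff[OF linear_metric_op])
  qed
  define f where "f a b c = p a b \<bullet> metric_op c" for a b c
  have fs: "f a b c = f b a c" if "a \<in> skew_tuples" "b \<in> skew_tuples" for a b c
    using psym[OF that] by (simp add: f_def)
  have fa: "f a b c = - f a c b" if "a \<in> skew_tuples" "b \<in> skew_tuples" "c \<in> skew_tuples" for a b c
    using pant[OF that] by (simp add: f_def inner_metric_op inner_commute)
  have "p a b = 0"
  proof (rule metric_op_nondegenerate[OF psk[OF a b]])
    fix c :: "('k, 'd) tuple" assume c: "c \<in> skew_tuples"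
    \<comment> \<open>Alternately swapping the first two and the last two arguments returns to the
      start after six swaps, three of which change the sign.\<close>
    have "f a b c = - f a b c"
      using fs[OF a b, of c] fa[OF b a c] fs[OF b c, of a] fa[OF c b a] fs[OF c a, of b] fa[OF a c b] by simp
    then show "p a b \<bullet> metric_op c = 0" by (simp add: f_def)
  qed
  then have "T \<odot> p a b = 0" by (simp add: tmul_simps)
  then have "?n T (X a T) (X b) = lc_conn T (X a T) (X b)"
    by (simp add: p_def orthogonal_tuples_cancel[OF T])
  then show ?thesis
    unfolding X_def[abs_def] using lc_conn_left_invariant[OF T a, of b] by simp
qed

section \<open>Gradient and Hessian\<close>

lemma skew_part_skew: "(1/2) *\<^sub>R (B - adj B) \<in> skew_tuples"
  by (simp add: skew_tuples_def adj_linear_simps algebra_simps)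

lemma inner_skew_part: "w \<in> skew_tuples \<Longrightarrow> ((1/2) *\<^sub>R (B - adj B)) \<bullet> w = B \<bullet> w"
proof -
  assume w: "w \<in> skew_tuples"
  have "adj B \<bullet> w = B \<bullet> adj w" using inner_adj[of B "adj w"] by simp
  then show ?thesis using w by (simp add: skew_tuples_def inner_diff_left)
qed

text \<open>\<open>E\<close> is a Euclidean gradient of \<open>f\<close>. On skew tuples the
  differential is represented in the Frobenius product by the skew part of
  \<open>adj T \<odot> E T\<close>, and \<open>metric_op_inv\<close> turns this into a
  representation in the quotient metric.\<close>

lemma riem_grad_orthogonal:
  fixes E :: "('k::finite, 'd::finite) tuple \<Rightarrow> ('k, 'd) tuple"
  assumes T: "T \<in> Od" and E: "\<And>v. v \<in> tangent_space Od T \<Longrightarrow> mderiv Od f T v = E T \<bullet> v"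
  shows "riem_grad Od g_quot f T = T \<odot> metric_op_inv ((1/2) *\<^sub>R (adj T \<odot> E T - adj (adj T \<odot> E T)))"
proof -
  let ?q = "(1/2) *\<^sub>R (adj T \<odot> E T - adj (adj T \<odot> E T))"
  have qs: "metric_op_inv ?q \<in> skew_tuples" by (rule metric_op_inv_skew[OF skew_part_skew])
  have g: "g_quot T (T \<odot> a) w = mderiv Od f T w \<longleftrightarrow> (a - metric_op_inv ?q) \<bullet> metric_op (adj T \<odot> w) = 0"
    if a: "a \<in> skew_tuples" and w: "w \<in> tangent_space Od T" for a w
  proof -
    have "mderiv Od f T w = (adj T \<odot> E T) \<bullet> (adj T \<odot> w)"
      using E[OF w] by (simp add: inner_tmul_left orthogonal_tuples_cancel[OF T])
    also have "\<dots> = ?q \<bullet> (adj T \<odot> w)" by (rule inner_skew_part[OF tangent_spaceD[OF T w], symmetric])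
    also have "\<dots> = metric_op_inv ?q \<bullet> metric_op (adj T \<odot> w)"
      by (simp only: inner_metric_op[symmetric] metric_op_metric_op_inv)
    finally show ?thesis
      using g_quot_eq[OF T tangent_spaceI[OF T a] w]
      by (simp add: orthogonal_tuples_cancel[OF T] inner_diff_left)
  qed
  show ?thesis
    unfolding riem_grad_def
  proof (rule the_equality, intro conjI ballI)
    show "T \<odot> metric_op_inv ?q \<in> tangent_space Od T" by (rule tangent_spaceI[OF T qs])
    show "g_quot T (T \<odot> metric_op_inv ?q) w = mderiv Od f T w" if "w \<in> tangent_space Od T" for w
      by (simp add: g[OF qs that])
    fix v assume v: "v \<in> tangent_space Od T \<and> (\<forall>w\<in>tangent_space Od T. g_quot T v w = mderiv Od f T w)"
    let ?a = "adj T \<odot> v"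
    have a: "?a \<in> skew_tuples" "v = T \<odot> ?a"
      using v by (simp_all add: tangent_spaceD[OF T] orthogonal_tuples_cancel[OF T])
    have "?a - metric_op_inv ?q = 0"
    proof (rule metric_op_nondegenerate)
      show "?a - metric_op_inv ?q \<in> skew_tuples" using a(1) qs subspace_diff[OF subspace_skew_tuples] by blast
      show "(?a - metric_op_inv ?q) \<bullet> metric_op c = 0" if c: "c \<in> skew_tuples" for c
        using g[OF a(1) tangent_spaceI[OF T c]] v tangent_spaceI[OF T c] a(2)
        by (simp add: orthogonal_tuples_cancel[OF T])
    qed
    then show "v = T \<odot> metric_op_inv ?q" using a(2) by simp
  qed
qed

text \<open>Compatibility with the metric, for the gradient and the left-invariant field of
  \<open>b\<close>, gives the Hessian form as the derivative of
  \<open>E T \<bullet> (T \<odot> b)\<close> minus the differential in the direction of the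
  connection term. The product \<open>a \<odot> b\<close> comes from differentiating
  \<open>T \<odot> b\<close> along \<open>T \<odot> a\<close>.\<close>

lemma
  fixes E :: "('k::finite, 'd::finite) tuple \<Rightarrow> ('k, 'd) tuple"
  assumes sE: "smooth_map Od E"
    and E: "\<And>T v. T \<in> Od \<Longrightarrow> v \<in> tangent_space Od T \<Longrightarrow> mderiv Od f T v = E T \<bullet> v"
    and T: "T \<in> Od" and a: "a \<in> skew_tuples"
  shows riem_hess_tangent: "riem_hess Od g_quot f T (T \<odot> a) \<in> tangent_space Od T"
    and riem_hess_form: "b \<in> skew_tuples \<Longrightarrow> g_quot T (riem_hess Od g_quot f T (T \<odot> a)) (T \<odot> b)
      = mderiv Od E T (T \<odot> a) \<bullet> (T \<odot> b) + E T \<bullet> (T \<odot> (a \<odot> b - conn a b))"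
proof -
  let ?G = "riem_grad Od g_quot f" and ?n = "levi_civita (Od :: (('k, 'd) tuple) set) g_quot"
  have gr: "?G T = T \<odot> metric_op_inv ((1/2) *\<^sub>R (adj T \<odot> E T - adj (adj T \<odot> E T)))" if "T \<in> Od" for T
    by (rule riem_grad_orthogonal[OF that]) (rule E[OF that])
  \<comment> \<open>The axioms apply to smooth fields only; the explicit formula shows that the
    gradient is one.\<close>
  have vG: "vector_field Od ?G"
  proof -
    have sm: "smooth_map Od (\<lambda>T. T \<odot> metric_op_inv ((1/2) *\<^sub>R (adj T \<odot> E T - adj (adj T \<odot> E T))))"
      unfolding metric_op_inv_def
      by (intro smooth_map_tmul smooth_map_ident smooth_map_add smooth_map_bounded_linear[OF bounded_linear_tsum]
          smooth_map_scaleR_const smooth_map_diff smooth_map_adj sE)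
    have sG: "smooth_map Od ?G" by (rule smooth_map_cong[OF sm]) (rule gr[symmetric])
    show ?thesis
      unfolding vector_field_def
    proof (intro conjI ballI sG)
      fix T :: "('k, 'd) tuple" assume T: "T \<in> Od"
      show "?G T \<in> tangent_space Od T"
        unfolding gr[OF T] by (rule tangent_spaceI[OF T metric_op_inv_skew[OF skew_part_skew]])
    qed
  qed
  note ta = tangent_spaceI[OF T a]
  show tan: "riem_hess Od g_quot f T (T \<odot> a) \<in> tangent_space Od T"
    unfolding riem_hess_def by (rule levi_civita_tangent[OF levi_civita_is_levi_civita vG T ta])
  assume b: "b \<in> skew_tuples"
  note vb = left_invariant_vector_field[OF b]
  have gG: "g_quot S (?G S) w = E S \<bullet> w" if S: "S \<in> Od" and w: "w \<in> tangent_space Od S" for S w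
  proof -
    have "g_quot S (?G S) w = metric_op_inv ((1/2) *\<^sub>R (adj S \<odot> E S - adj (adj S \<odot> E S))) \<bullet> metric_op (adj S \<odot> w)"
      unfolding gr[OF S]
      using g_quot_eq[OF S tangent_spaceI[OF S metric_op_inv_skew[OF skew_part_skew]] w]
      by (simp add: orthogonal_tuples_cancel[OF S])
    also have "\<dots> = (adj S \<odot> E S) \<bullet> (adj S \<odot> w)"
      by (simp only: inner_metric_op[symmetric] metric_op_metric_op_inv inner_skew_part[OF tangent_spaceD[OF S w]])
    also have "\<dots> = E S \<bullet> w" by (simp add: inner_tmul_left orthogonal_tuples_cancel[OF S])
    finally show ?thesis .
  qed
  have "mderiv Od (\<lambda>y. g_quot y (?G y) (y \<odot> b)) T (T \<odot> a) =
      g_quot T (?n T (T \<odot> a) ?G) (T \<odot> b) + g_quot T (?G T) (?n T (T \<odot> a) (\<lambda>y. y \<odot> b))"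
    by (rule levi_civita_metric[OF levi_civita_is_levi_civita vG T vb ta])
  also have "?n T (T \<odot> a) (\<lambda>y. y \<odot> b) = T \<odot> conn a b" by (rule levi_civita_left_invariant[OF T a b])
  also have "g_quot T (?G T) (T \<odot> conn a b) = E T \<bullet> (T \<odot> conn a b)"
    by (rule gG[OF T tangent_spaceI[OF T conn_skew[OF a b]]])
  also have "mderiv Od (\<lambda>y. g_quot y (?G y) (y \<odot> b)) T (T \<odot> a) = mderiv Od (\<lambda>y. E y \<bullet> (y \<odot> b)) T (T \<odot> a)"
    by (rule mderiv_cong[OF smooth_map_bounded_bilinear[OF bounded_bilinear_inner sE
          smooth_map_tmul[OF smooth_map_ident smooth_map_const]] T _ ta])
      (rule gG, assumption, rule tangent_spaceI[OF _ b])
  also have "\<dots> = E T \<bullet> (T \<odot> a \<odot> b) + mderiv Od E T (T \<odot> a) \<bullet> (T \<odot> b)"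
    by (simp add: mderiv_bounded_bilinear[OF bounded_bilinear_inner sE smooth_map_tmul[OF smooth_map_ident smooth_map_const] T ta]
        mderiv_bounded_linear[OF tmul.bounded_linear_left smooth_map_ident T ta] mderiv_ident[OF ta])
  finally show "g_quot T (riem_hess Od g_quot f T (T \<odot> a)) (T \<odot> b)
      = mderiv Od E T (T \<odot> a) \<bullet> (T \<odot> b) + E T \<bullet> (T \<odot> (a \<odot> b - conn a b))"
    by (simp add: riem_hess_def tmul_simps tmul_assoc inner_diff_right)
qed

section \<open>The objective function and its Hessian\<close>

definition bcast :: "real^'d^'d \<Rightarrow> ('m::finite, 'd::finite) tuple" where
  "bcast Q = (\<chi> i. Q)"

definition block_op :: "('m::finite, 'd::finite) block_mat \<Rightarrow> ('m, 'd) tuple \<Rightarrow> ('m, 'd) tuple" where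
  "block_op A V = (\<chi> i. row_block (A ** stack V) i)"

text \<open>The differential of the affine map \<open>with_identity\<close>; its adjoint is
  \<open>res\<close>.\<close>

definition emb :: "('k::finite, 'd::finite) tuple \<Rightarrow> ('k option, 'd) tuple" where
  "emb H = (\<chi> v. case v of None \<Rightarrow> 0 | Some i \<Rightarrow> H $ i)"

definition res :: "('k::finite option, 'd::finite) tuple \<Rightarrow> ('k, 'd) tuple" where
  "res H = (\<chi> i. H $ Some i)"

lemma sum_prod_UNIV: "(\<Sum>c\<in>UNIV. f c) = (\<Sum>i\<in>UNIV. \<Sum>p\<in>UNIV. f (i, p))"
  for f :: "'a::finite \<times> 'b::finite \<Rightarrow> 'c::comm_monoid_add"
  by (simp add: UNIV_Times_UNIV[symmetric] sum.cartesian_product del: UNIV_Times_UNIV)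

lemma stack_block_op: "stack (block_op A V) = A ** stack V"
  by (simp add: block_op_def stack_def row_block_def vec_eq_iff)

lemma block_op_nth: "block_op A V $ i $ p $ q = (\<Sum>j\<in>UNIV. \<Sum>s\<in>UNIV. A $ (i, p) $ (j, s) * V $ j $ s $ q)"
  by (simp add: block_op_def row_block_def matrix_matrix_mult_def stack_def sum_prod_UNIV)

lemma linear_block_op: "linear (block_op A)"
  by (simp add: linear_iff vec_eq_iff block_op_nth sum.distrib algebra_simps sum_distrib_left)

lemma bounded_linear_block_op: "bounded_linear (block_op A)"
  using linear_block_op by (simp add: linear_conv_bounded_linear)

lemmas block_op_simps = linear_add[OF linear_block_op] linear_diff[OF linear_block_op]
  linear_cmul[OF linear_block_op] linear_neg[OF linear_block_op] linear_0[OF linear_block_op]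

lemma inner_stack: "stack V \<bullet> stack W = V \<bullet> W"
  by (simp add: inner_vec_def sum_prod_UNIV stack_def)

lemma norm_stack: "norm (stack V) = norm V"
  by (simp add: norm_eq_sqrt_inner inner_stack)

lemma block_op_selfadjoint:
  assumes "transpose A = A"
  shows "block_op A V \<bullet> W = V \<bullet> block_op A W"
  using inner_matrix_mult(1)[of A "stack V" "stack W"] assms
  by (simp add: inner_stack[symmetric] stack_block_op)

lemma block_op_commute:
  assumes "transpose A = A"
  shows "block_op A V \<bullet> W = block_op A W \<bullet> V"
  by (metis block_op_selfadjoint[OF assms] inner_commute)

lemma bcast_simps: "bcast (transpose Q) = adj (bcast Q)" "bcast Q $ i = Q"
  by (simp_all add: bcast_def adj_def)

lemma bcast_orthogonal: "orthogonal_matrix Q \<Longrightarrow> bcast Q \<in> orthogonal_tuples"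
  by (simp add: orthogonal_tuples_def bcast_def)

lemma row_block_mult: "row_block (M ** Q) i = row_block M i ** Q"
  by (simp add: row_block_def matrix_matrix_mult_def vec_eq_iff)

lemma block_op_bcast: "block_op A (V \<odot> bcast Q) = block_op A V \<odot> bcast Q"
proof -
  have "stack (V \<odot> bcast Q) = stack V ** Q"
    by (simp add: stack_def tmul_def bcast_def matrix_matrix_mult_def vec_eq_iff)
  then show ?thesis
    by (simp add: block_op_def tmul_def bcast_def matrix_mul_assoc row_block_mult)
qed

section \<open>The objective as a quadratic function of the quotient point\<close>

lemma linear_emb: "linear emb"
  by (simp add: linear_iff emb_def vec_eq_iff split: option.split)

lemmas emb_simps = linear_add[OF linear_emb] linear_diff[OF linear_emb]
  linear_cmul[OF linear_emb] linear_neg[OF linear_emb] linear_0[OF linear_emb]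

lemma bounded_linear_emb: "bounded_linear emb"
  using linear_emb by (simp add: linear_conv_bounded_linear)

lemma linear_res: "linear res"
  by (simp add: linear_iff res_def vec_eq_iff)

lemma bounded_linear_res: "bounded_linear res"
  using linear_res by (simp add: linear_conv_bounded_linear)

lemma inner_res: "res V \<bullet> H = V \<bullet> emb H"
  by (simp add: inner_tuple sum_option res_def emb_def)

lemma with_identity_add: "with_identity (T + H) = with_identity T + emb H"
  by (simp add: with_identity_def emb_def vec_eq_iff split: option.split)

lemma with_identity_alt: "with_identity T = with_identity 0 + emb T"
  using with_identity_add[of 0 T] by simp

lemma emb_tmul: "emb (T \<odot> a) = with_identity T \<odot> emb a"
  by (simp add: emb_def tmul_def with_identity_def vec_eq_iff split: option.split)

lemma F_quot_eq: "F_quot C T = block_op C (with_identity T) \<bullet> with_identity T"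
proof -
  have tr: "trace (A ** transpose B) = A \<bullet> B" for A B :: "real^'e^'f"
    by (simp add: trace_def matrix_matrix_mult_def transpose_def inner_vec_def)
  show ?thesis
    by (simp add: F_quot_def matrix_mul_assoc tr stack_block_op[symmetric] inner_stack)
qed

lemma F_quot_add:
  assumes C: "transpose C = C"
  shows "F_quot C (T + H) = F_quot C T + 2 * (block_op C (with_identity T) \<bullet> emb H) + block_op C (emb H) \<bullet> emb H"
proof -
  have "block_op C (emb H) \<bullet> with_identity T = block_op C (with_identity T) \<bullet> emb H"
    by (rule block_op_commute[OF C])
  then show ?thesis
    by (simp add: F_quot_eq with_identity_add block_op_simps inner_add_left inner_add_right)
qed

definition F_grad :: "('k::finite option, 'd::finite) block_mat \<Rightarrow> ('k, 'd) tuple \<Rightarrow> ('k, 'd) tuple" where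
  "F_grad C T = 2 *\<^sub>R res (block_op C (with_identity T))"

lemma F_grad_has_derivative:
  "(F_grad C has_derivative (\<lambda>H. 2 *\<^sub>R res (block_op C (emb H)))) (at T within M)"
proof -
  have "F_grad C = (\<lambda>T. 2 *\<^sub>R res (block_op C (with_identity 0 + emb T)))"
    by (simp add: F_grad_def fun_eq_iff with_identity_alt[symmetric])
  moreover have "((\<lambda>T. 2 *\<^sub>R res (block_op C (with_identity 0 + emb T))) has_derivative
      (\<lambda>H. 2 *\<^sub>R res (block_op C (0 + emb H)))) (at T within M)"
    by (intro bounded_linear.has_derivative[OF bounded_linear_scaleR_right]
        bounded_linear.has_derivative[OF bounded_linear_res] bounded_linear.has_derivative[OF bounded_linear_block_op]
        has_derivative_add has_derivative_const bounded_linear.has_derivative[OF bounded_linear_emb] has_derivative_ident)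
  ultimately show ?thesis by simp
qed

lemma smooth_F_grad: "smooth_map M (F_grad C)"
proof -
  have "smooth_map M (\<lambda>T. 2 *\<^sub>R res (block_op C (with_identity 0 + emb T)))"
    by (intro smooth_map_scaleR_const smooth_map_bounded_linear[OF bounded_linear_res]
        smooth_map_bounded_linear[OF bounded_linear_block_op] smooth_map_add smooth_map_const
        smooth_map_bounded_linear[OF bounded_linear_emb] smooth_map_ident)
  then show ?thesis by (rule smooth_map_cong) (simp add: F_grad_def with_identity_alt[symmetric])
qed

lemma mderiv_F_quot:
  assumes C: "transpose C = C" and v: "v \<in> tangent_space M T"
  shows "mderiv M (F_quot C) T v = F_grad C T \<bullet> v"
proof -
  let ?w = "\<lambda>T. with_identity 0 + emb T"
  have "((\<lambda>T. block_op C (?w T) \<bullet> ?w T) has_derivative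
      (\<lambda>H. block_op C (?w T) \<bullet> (0 + emb H) + block_op C (0 + emb H) \<bullet> ?w T)) (at T within M)"
    by (intro bounded_bilinear.FDERIV[OF bounded_bilinear_inner] bounded_linear.has_derivative[OF bounded_linear_block_op]
        has_derivative_add has_derivative_const bounded_linear.has_derivative[OF bounded_linear_emb] has_derivative_ident)
  moreover have "F_quot C = (\<lambda>T. block_op C (?w T) \<bullet> ?w T)"
    by (simp add: fun_eq_iff F_quot_eq with_identity_alt[symmetric])
  ultimately have "mderiv M (F_quot C) T v = block_op C (?w T) \<bullet> (0 + emb v) + block_op C (0 + emb v) \<bullet> ?w T"
    using mderiv_eqI[OF _ v] by simp
  then show ?thesis
    by (simp add: with_identity_alt[symmetric] F_grad_def inner_res block_op_commute[OF C, of "emb v"])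
qed

definition hess_form :: "('k::finite option, 'd::finite) block_mat \<Rightarrow> ('k, 'd) tuple \<Rightarrow> ('k, 'd) tuple \<Rightarrow> ('k, 'd) tuple \<Rightarrow> real" where
  "hess_form C T a b = 2 * (block_op C (emb (T \<odot> a)) \<bullet> emb (T \<odot> b))
     + 2 * (block_op C (with_identity T) \<bullet> emb (T \<odot> (a \<odot> b - conn a b)))"

lemma
  assumes C: "transpose C = C" and T: "T \<in> orthogonal_tuples" and a: "a \<in> skew_tuples"
  shows hess_F_quot_tangent: "hess_F_quot C T (T \<odot> a) \<in> tangent_space orthogonal_tuples T"
    and hess_F_quot_form: "b \<in> skew_tuples \<Longrightarrow>
      g_quot T (hess_F_quot C T (T \<odot> a)) (T \<odot> b) = hess_form C T a b"
proof -
  note E = mderiv_F_quot[OF C]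
  show "hess_F_quot C T (T \<odot> a) \<in> tangent_space orthogonal_tuples T"
    unfolding hess_F_quot_def by (rule riem_hess_tangent[where E = "F_grad C", OF smooth_F_grad E T a])
  assume b: "b \<in> skew_tuples"
  have "mderiv orthogonal_tuples (F_grad C) T (T \<odot> a) = 2 *\<^sub>R res (block_op C (emb (T \<odot> a)))"
    by (rule mderiv_eqI[OF F_grad_has_derivative tangent_spaceI[OF T a]])
  then show "g_quot T (hess_F_quot C T (T \<odot> a)) (T \<odot> b) = hess_form C T a b"
    unfolding hess_F_quot_def hess_form_def
    using riem_hess_form[where E = "F_grad C", OF smooth_F_grad E T a b]
    by (simp add: F_grad_def inner_res)
qed

lemma bounded_bilinear_hess_form: "bounded_bilinear (hess_form C T)"
  unfolding bilinear_conv_bounded_bilinear[symmetric] bilinear_def linear_iff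
  by (simp add: hess_form_def tmul_simps emb_simps block_op_simps inner_add_left inner_add_right
      bounded_bilinear.add_left[OF bounded_bilinear_conn] bounded_bilinear.scaleR_left[OF bounded_bilinear_conn]
      bounded_bilinear.add_right[OF bounded_bilinear_conn] bounded_bilinear.scaleR_right[OF bounded_bilinear_conn]
      inner_diff_right algebra_simps)

text \<open>Symmetry of the Hessian is vanishing torsion: the two connection terms differ by the
  commutator.\<close>

lemma hess_form_commute:
  assumes C: "transpose C = C"
  shows "hess_form C T a b = hess_form C T b a"
proof -
  have "a \<odot> b - conn a b = b \<odot> a - conn b a"
    using conn_torsion[of a b] by (simp add: bracket_def algebra_simps)
  moreover have "block_op C (emb (T \<odot> a)) \<bullet> emb (T \<odot> b) = block_op C (emb (T \<odot> b)) \<bullet> emb (T \<odot> a)"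
    by (rule block_op_commute[OF C])
  ultimately show ?thesis by (simp add: hess_form_def)
qed

section \<open>Second-order conditions at a local minimizer\<close>

text \<open>Along the Cayley curve the change of the objective is \<open>t\<close> times a
  continuous expression, nonnegative for small positive \<open>t\<close>; its limit gives the
  first-order inequality, and passing to \<open>- a\<close> an equality. Another factor
  \<open>t\<close> then splits off, and the limit of the rest gives the second-order
  inequality.\<close>

lemma
  fixes T :: "('k::finite, 'd::finite) tuple"
  assumes C: "transpose C = C" and T: "T \<in> orthogonal_tuples" and e: "0 < e"
    and min: "\<And>T'. T' \<in> orthogonal_tuples \<Longrightarrow> dist T' T < e \<Longrightarrow> F_quot C T \<le> F_quot C T'"
    and a: "a \<in> skew_tuples"
  shows local_min_critical: "block_op C (with_identity T) \<bullet> emb (T \<odot> a) = 0"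
    and local_min_hess: "0 \<le> hess_form C T a a"
proof -
  define G where "G = block_op C (with_identity T)"
  have first: "0 \<le> G \<bullet> emb (T \<odot> a)" and second: "G \<bullet> emb (T \<odot> a) = 0 \<Longrightarrow>
      0 \<le> G \<bullet> emb (T \<odot> (a \<odot> a)) + block_op C (emb (T \<odot> a)) \<bullet> emb (T \<odot> a)"
    if a: "a \<in> skew_tuples" for a
  proof -
    obtain X where X: "\<And>t::real. X t \<odot> (tone - t *\<^sub>R a) = tone" "\<And>t. (tone - t *\<^sub>R a) \<odot> X t = tone"
      using skew_resolvent[OF a] by blast
    \<comment> \<open>The difference quotient of the curve: \<open>T + t *\<^sub>R V t\<close> is
      \<open>T\<close> times the Cayley transform.\<close>
    define V where "V t = 2 *\<^sub>R (T \<odot> (a \<odot> X t))" for t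
    note contX = resolvent_continuous[OF a X]
    have X0: "X 0 = tone" by (rule resolvent_0[OF a X])
    have X1: "X t = tone + t *\<^sub>R (a \<odot> X t)" for t using X(2)[of t] by (simp add: tmul_simps algebra_simps)
    have contV: "isCont V t" for t
      unfolding V_def
      by (intro bounded_linear.isCont[OF bounded_linear_scaleR_right] bounded_linear.isCont[OF tmul.bounded_linear_right] contX)
    have cV: "T + t *\<^sub>R V t = T \<odot> (2 *\<^sub>R X t - tone)" for t
    proof -
      have "2 *\<^sub>R X t - tone = tone + (2 * t) *\<^sub>R (a \<odot> X t)"
        using X1[of t] by (metis (no_types, lifting) add.commute add_diff_eq diff_add_cancel scaleR_2 scaleR_add_right scaleR_scaleR add_diff_cancel_left')
      then show ?thesis by (simp add: tmul_simps V_def mult.commute)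
    qed
    have diff: "F_quot C (T + t *\<^sub>R V t) - F_quot C T = t * (2 * (G \<bullet> emb (V t)) + t * (block_op C (emb (V t)) \<bullet> emb (V t)))" for t
      by (simp add: F_quot_add[OF C] G_def emb_simps block_op_simps algebra_simps)
    have "((\<lambda>t. T + t *\<^sub>R V t) \<longlongrightarrow> T + 0 *\<^sub>R V 0) (at 0)"
      using contV[of 0] by (intro tendsto_intros) (simp add: isCont_def)
    then have "\<forall>\<^sub>F t in at 0. dist (T + t *\<^sub>R V t) T < e"
      using e by (auto simp: tendsto_iff)
    then have "\<forall>\<^sub>F t in at_right 0. dist (T + t *\<^sub>R V t) T < e"
      by (rule filter_leD[OF at_le, rotated]) simp
    then have ge: "\<forall>\<^sub>F t in at_right 0. 0 < t \<and> 0 \<le> 2 * (G \<bullet> emb (V t)) + t * (block_op C (emb (V t)) \<bullet> emb (V t))"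
      using eventually_at_right_less[of 0]
    proof eventually_elim
      case (elim t)
      have "T + t *\<^sub>R V t \<in> orthogonal_tuples"
        unfolding cV by (rule orthogonal_tuples_tmul[OF T cayley_orthogonal[OF a X]])
      then have "0 \<le> F_quot C (T + t *\<^sub>R V t) - F_quot C T" using min elim by simp
      then show ?case unfolding diff using elim by (simp add: zero_le_mult_iff)
    qed
    have contE: "isCont (\<lambda>t. emb (V t)) 0" by (rule bounded_linear.isCont[OF bounded_linear_emb contV])
    have contQ: "isCont (\<lambda>t. block_op C (emb (V t)) \<bullet> emb (V t)) 0"
      by (intro bounded_bilinear.isCont[OF bounded_bilinear_inner] bounded_linear.isCont[OF bounded_linear_block_op] contE)
    have V0: "V 0 = 2 *\<^sub>R (T \<odot> a)" by (simp add: V_def X0)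
    show "0 \<le> G \<bullet> emb (T \<odot> a)"
    proof -
      have "isCont (\<lambda>t. 2 * (G \<bullet> emb (V t)) + t * (block_op C (emb (V t)) \<bullet> emb (V t))) 0"
        by (intro continuous_intros contQ bounded_linear.isCont[OF bounded_linear_inner_right] contE)
      then have "((\<lambda>t. 2 * (G \<bullet> emb (V t)) + t * (block_op C (emb (V t)) \<bullet> emb (V t))) \<longlongrightarrow> 2 * (G \<bullet> emb (V 0))) (at_right 0)"
        by (auto simp: isCont_def intro: filterlim_mono[OF _ order_refl at_le])
      then have "0 \<le> 2 * (G \<bullet> emb (V 0))"
        by (rule tendsto_lowerbound) (use ge in \<open>auto elim: eventually_mono\<close>)
      then show ?thesis by (simp add: V0 emb_simps)
    qed
    show "0 \<le> G \<bullet> emb (T \<odot> (a \<odot> a)) + block_op C (emb (T \<odot> a)) \<bullet> emb (T \<odot> a)" if crit: "G \<bullet> emb (T \<odot> a) = 0"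
    proof -
      have GV: "G \<bullet> emb (V t) = 2 * t * (G \<bullet> emb (T \<odot> (a \<odot> (a \<odot> X t))))" for t
      proof -
        have "V t = 2 *\<^sub>R (T \<odot> a) + (2 * t) *\<^sub>R (T \<odot> (a \<odot> (a \<odot> X t)))"
          unfolding V_def by (subst X1) (simp add: tmul_simps scaleR_add_right)
        then show ?thesis using crit by (simp add: emb_simps inner_add_right)
      qed
      let ?\<phi> = "\<lambda>t. 4 * (G \<bullet> emb (T \<odot> (a \<odot> (a \<odot> X t)))) + block_op C (emb (V t)) \<bullet> emb (V t)"
      have ev: "\<forall>\<^sub>F t in at_right 0. 0 \<le> ?\<phi> t"
        using ge
      proof eventually_elim
        case (elim t)
        then have "0 \<le> t * ?\<phi> t" unfolding GV by (simp add: algebra_simps)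
        then show ?case using elim by (simp add: zero_le_mult_iff)
      qed
      have "isCont ?\<phi> 0"
        by (intro continuous_intros contQ bounded_linear.isCont[OF bounded_linear_inner_right]
            bounded_linear.isCont[OF bounded_linear_emb] bounded_linear.isCont[OF tmul.bounded_linear_right] contX)
      then have "(?\<phi> \<longlongrightarrow> ?\<phi> 0) (at_right 0)"
        by (auto simp: isCont_def intro: filterlim_mono[OF _ order_refl at_le])
      then have "0 \<le> ?\<phi> 0"
        by (rule tendsto_lowerbound) (use ev in auto)
      then show ?thesis by (simp add: X0 V0 emb_simps block_op_simps)
    qed
  qed
  have crit: "G \<bullet> emb (T \<odot> a) = 0" if a: "a \<in> skew_tuples" for a
    using first[OF a] first[OF subspace_neg[OF subspace_skew_tuples a]] by (simp add: tmul_simps emb_simps)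
  show "block_op C (with_identity T) \<bullet> emb (T \<odot> a) = 0"
    using crit[OF a] by (simp add: G_def)
  \<comment> \<open>The connection term is the differential in the skew direction
    \<open>conn a a\<close>, which vanishes at a critical point.\<close>
  show "0 \<le> hess_form C T a a"
    using second[OF a crit[OF a]] crit[OF conn_skew[OF a a]]
    by (simp add: hess_form_def G_def[symmetric] tmul_simps emb_simps inner_diff_right)
qed

text \<open>Semidefiniteness comes from minimality. A null vector would pair to zero with every
  direction, so the Hessian operator would annihilate it, against non-singularity.\<close>

lemma nondegenerate_hess_form_pos:
  fixes S :: "('k::finite option, 'd::finite) tuple"
  assumes C: "transpose C = C" and S: "S \<in> orthogonal_tuples" and nd: "nondegenerate C S"
    and a: "a \<in> skew_tuples" and a0: "a \<noteq> 0"
  shows "0 < hess_form C (quot_map S) a a"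
proof -
  let ?T = "quot_map S"
  have T: "?T \<in> orthogonal_tuples" by (rule quot_map_orthogonal[OF S])
  obtain e where e: "0 < e" "\<And>T'. T' \<in> orthogonal_tuples \<Longrightarrow> dist T' ?T < e \<Longrightarrow> F_quot C ?T \<le> F_quot C T'"
    using nd unfolding nondegenerate_def by blast
  have psd: "0 \<le> hess_form C ?T b b" if "b \<in> skew_tuples" for b
    by (rule local_min_hess[OF C T e that])
  interpret H: bounded_bilinear "hess_form C ?T" by (rule bounded_bilinear_hess_form)
  have "hess_form C ?T a a \<noteq> 0"
  proof
    assume z: "hess_form C ?T a a = 0"
    have Hab: "hess_form C ?T a b = 0" if b: "b \<in> skew_tuples" for b
    proof (rule quadratic_nonneg_imp_linear_zero[OF psd[OF b]])
      fix t :: real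
      have "0 \<le> hess_form C ?T (a + t *\<^sub>R b) (a + t *\<^sub>R b)"
        by (intro psd subspace_add subspace_scale subspace_skew_tuples a b)
      then show "0 \<le> 2 * t * hess_form C ?T a b + t\<^sup>2 * hess_form C ?T b b"
        using hess_form_commute[OF C, of ?T a b] z
        by (simp add: H.add_left H.add_right H.scaleR_left H.scaleR_right power2_eq_square algebra_simps)
    qed
    let ?h = "hess_F_quot C ?T (?T \<odot> a)"
    have th: "?h \<in> tangent_space orthogonal_tuples ?T" by (rule hess_F_quot_tangent[OF C T a])
    have "adj ?T \<odot> ?h = 0"
    proof (rule metric_op_nondegenerate[OF tangent_spaceD[OF T th]])
      fix c :: "('k, 'd) tuple" assume c: "c \<in> skew_tuples"
      show "(adj ?T \<odot> ?h) \<bullet> metric_op c = 0"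
        using g_quot_eq[OF T th tangent_spaceI[OF T c]] hess_F_quot_form[OF C T a c] Hab[OF c]
        by (simp add: orthogonal_tuples_cancel[OF T])
    qed
    then have "?h = 0" by (metis orthogonal_tuples_cancel(4)[OF T] tmul.zero_right)
    then have "?T \<odot> a = 0" using nd tangent_spaceI[OF T a] unfolding nondegenerate_def by blast
    then have "a = 0" by (metis orthogonal_tuples_cancel(3)[OF T] tmul.zero_right)
    with a0 show False ..
  qed
  then show ?thesis using psd[OF a] by simp
qed

lemma nondegenerate_critical:
  fixes S :: "('k::finite option, 'd::finite) tuple"
  assumes C: "transpose C = C" and S: "S \<in> orthogonal_tuples" and nd: "nondegenerate C S"
    and a: "a \<in> skew_tuples"
  shows "block_op C (with_identity (quot_map S)) \<bullet> emb (quot_map S \<odot> a) = 0"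
proof -
  obtain e where e: "0 < e" "\<And>T'. T' \<in> orthogonal_tuples \<Longrightarrow> dist T' (quot_map S) < e \<Longrightarrow> F_quot C (quot_map S) \<le> F_quot C T'"
    using nd unfolding nondegenerate_def by blast
  show ?thesis by (rule local_min_critical[OF C quot_map_orthogonal[OF S] e a])
qed

section \<open>The matrix \<open>L(S)\<close> as an operator on tuples\<close>

text \<open>The action of \<open>L_mat C S\<close> in closed form, see
  \<open>block_op_L_mat\<close>: the diagonal blocks of \<open>C_hat\<close> are the slots of
  \<open>adj S \<odot> block_op C S\<close>.\<close>

definition L_op :: "('m::finite, 'd::finite) block_mat \<Rightarrow> ('m, 'd) tuple \<Rightarrow> ('m, 'd) tuple \<Rightarrow> ('m, 'd) tuple" where
  "L_op C S \<Omega> = adj S \<odot> (block_op C (S \<odot> \<Omega>) - block_op C S \<odot> \<Omega>)"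

definition L_form :: "('m::finite, 'd::finite) block_mat \<Rightarrow> ('m, 'd) tuple \<Rightarrow> ('m, 'd) tuple \<Rightarrow> real" where
  "L_form C S \<Omega> = \<Omega> \<bullet> L_op C S \<Omega>"

lemma stack_inject: "stack V = stack W \<longleftrightarrow> V = W"
  by (simp add: stack_def vec_eq_iff)

lemma blockdiag_stack: "blockdiag S ** stack V = stack (S \<odot> V)"
proof -
  have "(\<Sum>p\<in>UNIV. if b then f p else 0) = (if b then \<Sum>p\<in>UNIV. f p else 0)"
    for b and f :: "'a \<Rightarrow> real"
    by simp
  then show ?thesis
    by (simp add: blockdiag_def stack_def tmul_def matrix_matrix_mult_def vec_eq_iff sum_prod_UNIV
        if_distrib[of "\<lambda>x. x * _"] cong: if_cong)
qed

lemma transpose_blockdiag: "transpose (blockdiag S) = blockdiag (adj S)"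
  by (simp add: blockdiag_def transpose_def adj_def vec_eq_iff)

lemma block_op_blockdiag: "block_op (blockdiag S) V = S \<odot> V"
  by (simp add: stack_inject[symmetric] stack_block_op blockdiag_stack)

lemma block_op_mult: "block_op (A ** B) V = block_op A (block_op B V)"
  by (simp add: stack_inject[symmetric] stack_block_op matrix_mul_assoc)

lemma block_op_mat_1: "block_op (mat 1) V = V"
  by (simp add: stack_inject[symmetric] stack_block_op)

lemma block_op_ext:
  fixes A B :: "('m::finite, 'd::finite) block_mat"
  assumes eq: "\<And>V. block_op A V = block_op B V"
  shows "A = B"
proof -
  have "A *v v = B *v v" for v
  proof -
    \<comment> \<open>All columns of \<open>stack V\<close> equal \<open>v\<close>.\<close>
    define V :: "('m, 'd) tuple" where "V = (\<chi> i p q. v $ (i, p))"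
    have V: "(M *v v) $ (i, p) = block_op M V $ i $ p $ p" for M i p
      by (simp add: block_op_nth V_def matrix_vector_mult_def sum_prod_UNIV)
    have "(A *v v) $ c = (B *v v) $ c" for c
      by (cases c) (simp add: V eq)
    then show ?thesis by (simp add: vec_eq_iff)
  qed
  then show ?thesis by (simp add: matrix_eq)
qed

lemma block_op_diff_left: "block_op (A - B) V = block_op A V - block_op B V"
  by (simp add: vec_eq_iff block_op_nth left_diff_distrib sum_subtractf)

lemma block_op_C_conj: "block_op (C_conj C S) V = adj S \<odot> block_op C (S \<odot> V)"
  by (simp add: C_conj_def transpose_blockdiag block_op_mult block_op_blockdiag)

lemma block_op_tone: "block_op A tone $ i = (\<Sum>j\<in>UNIV. block A i j)"
  by (simp add: vec_eq_iff block_op_nth tone_def mat_def block_def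
      if_distrib[of "\<lambda>x. _ * x"] cong: if_cong)

lemma block_op_L_mat: "block_op (L_mat C S) \<Omega> = L_op C S \<Omega>"
proof -
  have "(\<chi> i. \<Sum>j\<in>UNIV. block (C_conj C S) i j) = adj S \<odot> block_op C S"
    using block_op_C_conj[of C S tone] by (simp add: block_op_tone[symmetric] vec_eq_iff)
  then show ?thesis
    by (simp add: L_mat_def C_hat_def block_op_diff_left block_op_C_conj block_op_blockdiag L_op_def
        tmul_simps tmul_assoc)
qed

lemma linear_L_op: "linear (L_op C S)"
  unfolding block_op_L_mat[symmetric, abs_def] by (rule linear_block_op)

text \<open>The diagonal blocks of \<open>C_hat\<close> are the block row sums of
  \<open>C_conj\<close>, so constant tuples cancel. For skew \<open>B\<close> they are the vertical
  directions.\<close>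

lemma L_op_bcast: "L_op C S (bcast B) = 0"
  by (simp add: L_op_def block_op_bcast tmul_simps)

lemma right_mult_eq: "right_mult S Q = S \<odot> bcast Q"
  by (simp add: right_mult_def tmul_def bcast_def)

lemma conj_tuple_eq: "conj_tuple Q A = adj (bcast Q) \<odot> A \<odot> bcast Q"
  by (simp add: conj_tuple_def tmul_def bcast_def adj_def)

lemma L_form_eq: "L_form C S \<Omega> = block_op C (S \<odot> \<Omega>) \<bullet> (S \<odot> \<Omega>) - (block_op C S \<odot> \<Omega>) \<bullet> (S \<odot> \<Omega>)"
  using inner_tmul_left[of S \<Omega> "block_op C (S \<odot> \<Omega>) - block_op C S \<odot> \<Omega>"]
  by (simp add: L_form_def L_op_def inner_diff_right inner_commute)

text \<open>\<open>bcast Q\<close> moves past \<open>\<Omega>\<close> at the price of a conjugation,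
  and a common orthogonal factor on the right drops out of the inner products.\<close>

lemma L_form_right_mult:
  assumes Q: "orthogonal_matrix Q"
  shows "L_form C (right_mult S Q) \<Omega> = L_form C S (conj_tuple (transpose Q) \<Omega>)"
proof -
  let ?b = "bcast Q" and ?\<Omega> = "conj_tuple (transpose Q) \<Omega>"
  note c = orthogonal_tuples_cancel[OF bcast_orthogonal[OF Q]]
  have e: "?b \<odot> \<Omega> = ?\<Omega> \<odot> ?b"
    by (simp add: conj_tuple_eq bcast_simps tmul_assoc c)
  have inn: "(A \<odot> ?b) \<bullet> (B \<odot> ?b) = A \<bullet> B" for A B
    by (simp add: inner_tmul_right tmul_assoc c)
  have 1: "S \<odot> ?b \<odot> \<Omega> = S \<odot> ?\<Omega> \<odot> ?b" by (simp add: tmul_assoc e)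
  have 2: "block_op C S \<odot> ?b \<odot> \<Omega> = block_op C S \<odot> ?\<Omega> \<odot> ?b" by (simp add: tmul_assoc e)
  show ?thesis
    unfolding L_form_eq right_mult_eq block_op_bcast 1 2 inn ..
qed

lemma emb_tmul_emb: "emb (a \<odot> b) = emb a \<odot> emb b"
  by (simp add: emb_def tmul_def vec_eq_iff split: option.split)

lemma lift_skew_decomp: "lift_skew a = emb a + bcast (lift_skew a $ None)"
  using lift_skew_diff[of a]
  by (simp add: vec_eq_iff[of "lift_skew a"] emb_def bcast_def split: option.split) (metis diff_eq_eq)

text \<open>On the diagonal the bracket term of \<open>conn\<close> vanishes and only the metric
  correction survives; the mean in it is, up to sign, the first slot of the lift.\<close>

lemma emb_conn_self:
  fixes a :: "('k::finite, 'd::finite) tuple"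
  shows "emb (conn a a) = bracket (emb a) (bcast (lift_skew a $ None))"
proof -
  define s where "s = (\<Sum>i\<in>UNIV. a $ i)"
  define r where "r = 1 / (real CARD('k) + 1)"
  have "conn a a = r *\<^sub>R bracket (tsum a) a"
    by (simp add: conn_def r_def scaleR_2[symmetric] del: scaleR_2)
  also have "emb \<dots> = bracket (emb a) (bcast (- (r *\<^sub>R s)))"
  proof -
    have l: "- (r *\<^sub>R s) ** x = - (r *\<^sub>R (s ** x))" "x ** - (r *\<^sub>R s) = - (r *\<^sub>R (x ** s))" for x
      by (simp_all add: matrix_matrix_mult_def vec_eq_iff sum_negf sum_distrib_left mult_ac)
    have l0: "0 ** x = 0" "x ** 0 = 0" for x :: "real^'d^'d"
      by (simp_all add: matrix_matrix_mult_def vec_eq_iff)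
    have "emb (r *\<^sub>R bracket (tsum a) a) $ v = bracket (emb a) (bcast (- (r *\<^sub>R s))) $ v" for v
      by (cases v)
        (simp_all add: emb_def bracket_def tmul_def bcast_def tsum_def s_def[symmetric] l l0 scaleR_diff_right)
    then show ?thesis by (intro vec_eq_iff[THEN iffD2] allI) simp
  qed
  also have "- (r *\<^sub>R s) = lift_skew a $ None"
    by (simp add: lift_skew_def r_def s_def Let_def)
  finally show ?thesis .
qed

lemma inner_tmul_skew: "adj c = - c \<Longrightarrow> (G \<odot> c) \<bullet> W = - (G \<bullet> (W \<odot> c))"
  by (simp add: inner_tmul_right tmul_simps)

text \<open>The lift splits as \<open>w + c\<close> with \<open>w = emb a\<close> and
  \<open>c\<close> constant. In \<open>L_form\<close> the terms with \<open>c\<close> reduce to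
  pairings with \<open>G\<close>, because \<open>block_op C\<close> commutes with constant right
  factors; in \<open>hess_form\<close> the connection term becomes the commutator of
  \<open>w\<close> and \<open>c\<close>. The two expansions agree.\<close>

lemma hess_form_eq_L_form:
  fixes a :: "('k::finite, 'd::finite) tuple"
  assumes C: "transpose C = C" and a: "a \<in> skew_tuples"
  shows "hess_form C T a a = 2 * L_form C (with_identity T) (lift_skew a)"
proof -
  define S where "S = with_identity T"
  define G where "G = block_op C S"
  define c where "c = (bcast (lift_skew a $ None) :: ('k option, 'd) tuple)"
  define w where "w = emb a"
  define \<Omega> where "\<Omega> = lift_skew a"
  have dec: "\<Omega> = w + c" unfolding \<Omega>_def w_def c_def by (rule lift_skew_decomp)
  have \<Omega>sk: "adj \<Omega> = - \<Omega>"
    using lift_skew_skew[OF a] by (simp add: skew_tuples_def \<Omega>_def)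
  have csk: "adj c = - c"
  proof -
    have "transpose (\<Omega> $ None) = - (\<Omega> $ None)"
      using lift_skew_skew[OF a] by (simp add: skew_tuples_iff skew_def \<Omega>_def)
    then show ?thesis by (simp add: c_def adj_def bcast_def vec_eq_iff \<Omega>_def)
  qed
  have Cc: "block_op C (S \<odot> c) = G \<odot> c" by (simp add: c_def block_op_bcast G_def)
  have "L_form C S \<Omega> = block_op C (S \<odot> \<Omega>) \<bullet> (S \<odot> \<Omega>) + G \<bullet> (S \<odot> \<Omega> \<odot> \<Omega>)"
    by (simp add: L_form_eq G_def[symmetric] inner_tmul_skew[OF \<Omega>sk])
  also have "block_op C (S \<odot> \<Omega>) \<bullet> (S \<odot> \<Omega>)
      = block_op C (S \<odot> w) \<bullet> (S \<odot> w) + 2 * ((G \<odot> c) \<bullet> (S \<odot> w)) + (G \<odot> c) \<bullet> (S \<odot> c)"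
    using block_op_commute[OF C, of "S \<odot> w" "S \<odot> c"]
    by (simp add: dec tmul_simps block_op_simps Cc inner_add_left inner_add_right)
  also have "\<dots> = block_op C (S \<odot> w) \<bullet> (S \<odot> w) - 2 * (G \<bullet> (S \<odot> w \<odot> c)) - G \<bullet> (S \<odot> c \<odot> c)"
    by (simp add: inner_tmul_skew[OF csk])
  also have "G \<bullet> (S \<odot> \<Omega> \<odot> \<Omega>) = G \<bullet> (S \<odot> w \<odot> w) + G \<bullet> (S \<odot> w \<odot> c) + G \<bullet> (S \<odot> c \<odot> w) + G \<bullet> (S \<odot> c \<odot> c)"
    by (simp add: dec tmul_simps inner_add_right)
  finally have 1: "L_form C S \<Omega> = block_op C (S \<odot> w) \<bullet> (S \<odot> w)
      + (G \<bullet> (S \<odot> w \<odot> w) - G \<bullet> (S \<odot> w \<odot> c) + G \<bullet> (S \<odot> c \<odot> w))" by simp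
  have "emb (T \<odot> (a \<odot> a - conn a a)) = S \<odot> emb (a \<odot> a - conn a a)"
    by (simp only: emb_tmul S_def)
  also have "\<dots> = S \<odot> (w \<odot> w - bracket w c)"
    by (simp only: emb_simps emb_tmul_emb emb_conn_self w_def c_def)
  finally have 2: "hess_form C T a a = 2 * (block_op C (S \<odot> w) \<bullet> (S \<odot> w))
      + 2 * (G \<bullet> (S \<odot> w \<odot> w) - G \<bullet> (S \<odot> w \<odot> c) + G \<bullet> (S \<odot> c \<odot> w))"
    by (simp add: hess_form_def S_def[symmetric] emb_tmul[of T a] w_def[symmetric] G_def[symmetric] bracket_def
        tmul_simps tmul_assoc inner_diff_right inner_add_right)
  show ?thesis using 1 2 by (simp add: S_def \<Omega>_def)
qed

lemma with_identity_quot_map: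
  assumes S: "S \<in> orthogonal_tuples"
  shows "right_mult (with_identity (quot_map S)) (S $ None) = S"
proof -
  have "transpose (S $ None) ** S $ None = mat 1"
    using S by (simp add: orthogonal_tuples_def orthogonal_matrix_def)
  then show ?thesis
    by (simp add: right_mult_def with_identity_def quot_map_def vec_eq_iff[of _ S] matrix_mul_assoc[symmetric]
        split: option.split)
qed

text \<open>A tuple of sum zero is recovered from its differences to the first slot. This transfers
  positivity of the Hessian form to \<open>L_form\<close> on all skew tuples of sum zero.\<close>

lemma sum_zero_eq_lift_skew:
  fixes \<Omega> :: "('k::finite option, 'd::finite) tuple"
  assumes sk: "\<Omega> \<in> skew_tuples" and z: "(\<Sum>v\<in>UNIV. \<Omega> $ v) = 0"
  obtains a where "a \<in> skew_tuples" "\<Omega> = lift_skew a"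
proof
  define a :: "('k, 'd) tuple" where "a = (\<chi> i. \<Omega> $ Some i - \<Omega> $ None)"
  have tr: "transpose (A - B) = transpose A - transpose B" for A B :: "real^'d^'d"
    by (simp add: transpose_def vec_eq_iff)
  show "a \<in> skew_tuples"
    using sk by (simp add: skew_tuples_iff skew_def a_def tr)
  have "(\<Sum>i\<in>UNIV. a $ i) = (\<Sum>i\<in>UNIV. \<Omega> $ Some i) - real CARD('k) *\<^sub>R \<Omega> $ None"
    by (simp add: a_def sum_subtractf sum_constant_scaleR del: sum_constant)
  also have "(\<Sum>i\<in>UNIV. \<Omega> $ Some i) = - \<Omega> $ None"
    using z by (simp add: sum_option add_eq_0_iff)
  finally have sa: "(\<Sum>i\<in>UNIV. a $ i) = - (real CARD('k) + 1) *\<^sub>R \<Omega> $ None"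
    by (simp add: scaleR_left_distrib scaleR_left_diff_distrib algebra_simps)
  have "(1 / (real CARD('k) + 1)) *\<^sub>R (\<Sum>i\<in>UNIV. a $ i) = - \<Omega> $ None"
  proof -
    have "(1 / (real CARD('k) + 1)) * - (real CARD('k) + 1) = - 1" by (simp add: field_simps)
    then show ?thesis
      by (simp only: sa scaleR_scaleR) simp
  qed
  then show "\<Omega> = lift_skew a"
    by (simp add: lift_skew_def Let_def vec_eq_iff[of \<Omega>] a_def split: option.split)
qed

lemma nondegenerate_L_form_pos:
  fixes S :: "('k::finite option, 'd::finite) tuple"
  assumes C: "transpose C = C" and S: "S \<in> orthogonal_tuples" and nd: "nondegenerate C S"
    and sk: "\<Omega> \<in> skew_tuples" and z: "(\<Sum>v\<in>UNIV. \<Omega> $ v) = 0" and nz: "\<Omega> \<noteq> 0"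
  shows "0 < L_form C S \<Omega>"
proof -
  let ?Q = "S $ None" and ?T = "quot_map S"
  have Q: "orthogonal_matrix ?Q" using S by (simp add: orthogonal_tuples_def)
  have Qt: "orthogonal_matrix (transpose ?Q)" using Q by simp
  let ?\<Omega> = "conj_tuple (transpose ?Q) \<Omega>"
  obtain a where a: "a \<in> skew_tuples" "?\<Omega> = lift_skew a"
    using sum_zero_eq_lift_skew[OF conj_tuple_skew[OF sk, of "transpose ?Q"]] z
    by (auto simp: sum_conj_tuple)
  have "a \<noteq> 0"
  proof
    assume "a = 0"
    then have "lift_skew a \<bullet> lift_skew a = 0" by (simp add: inner_lift_skew)
    then have "\<Omega> \<bullet> \<Omega> = 0" using conj_tuple_inner[OF Qt, of \<Omega> \<Omega>] a(2) by simp
    then show False using nz by simp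
  qed
  then have "0 < hess_form C ?T a a" by (rule nondegenerate_hess_form_pos[OF C S nd a(1)])
  also have "hess_form C ?T a a = 2 * L_form C (right_mult (with_identity ?T) ?Q) \<Omega>"
    unfolding hess_form_eq_L_form[OF C a(1)] L_form_right_mult[OF Q] a(2) ..
  also have "right_mult (with_identity ?T) ?Q = S" by (rule with_identity_quot_map[OF S])
  finally show ?thesis by simp
qed

text \<open>Criticality tests only directions that vanish in the first slot, but the objective is
  stationary along constant skew directions anyway. Hence \<open>adj S \<odot> block_op C S\<close>
  is orthogonal to all skew tuples, in particular to its own skew part.\<close>

lemma nondegenerate_block_sum_symmetric:
  fixes S :: "('k::finite option, 'd::finite) tuple"
  assumes C: "transpose C = C" and S: "S \<in> orthogonal_tuples" and nd: "nondegenerate C S"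
  shows "adj (adj S \<odot> block_op C S) = adj S \<odot> block_op C S"
proof -
  let ?Q = "S $ None" and ?T = "quot_map S"
  let ?I = "with_identity ?T"
  have Q: "orthogonal_matrix ?Q" using S by (simp add: orthogonal_tuples_def)
  let ?b = "bcast ?Q :: ('k option, 'd) tuple"
  have SI: "S = ?I \<odot> ?b" using with_identity_quot_map[OF S] by (simp add: right_mult_eq)
  have crit: "block_op C ?I \<bullet> (?I \<odot> \<Omega>) = 0" if sk: "\<Omega> \<in> skew_tuples" for \<Omega>
  proof -
    define a :: "('k, 'd) tuple" where "a = (\<chi> i. \<Omega> $ Some i - \<Omega> $ None)"
    have tr: "transpose (A - B) = transpose A - transpose B" for A B :: "real^'d^'d"
      by (simp add: transpose_def vec_eq_iff)
    have a: "a \<in> skew_tuples"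
      using sk by (simp add: skew_tuples_iff skew_def a_def tr)
    let ?c = "bcast (\<Omega> $ None) :: ('k option, 'd) tuple"
    have csk: "adj ?c = - ?c"
      using sk by (simp add: skew_tuples_iff skew_def adj_def bcast_def vec_eq_iff)
    have dec: "\<Omega> = emb a + ?c"
      by (simp add: vec_eq_iff[of \<Omega>] emb_def bcast_def a_def split: option.split)
    have "block_op C ?I \<bullet> (?I \<odot> \<Omega>) = block_op C ?I \<bullet> emb (?T \<odot> a) + block_op C ?I \<bullet> (?I \<odot> ?c)"
      using arg_cong[OF dec, of "\<lambda>z. block_op C ?I \<bullet> (?I \<odot> z)"]
      by (simp only: tmul.add_right emb_tmul inner_add_right)
    \<comment> \<open>Symmetry of \<open>C\<close> and skewness of the constant factor show that
      this pairing equals its own negative.\<close>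
    moreover have "block_op C ?I \<bullet> (?I \<odot> ?c) = (block_op C ?I \<odot> ?c) \<bullet> ?I"
      by (simp only: block_op_commute[OF C, of ?I "?I \<odot> ?c"] block_op_bcast)
    then have "block_op C ?I \<bullet> (?I \<odot> ?c) = 0"
      by (simp add: inner_tmul_skew[OF csk])
    ultimately show ?thesis using nondegenerate_critical[OF C S nd a] by simp
  qed
  have critS: "(adj S \<odot> block_op C S) \<bullet> \<Omega> = 0" if sk: "\<Omega> \<in> skew_tuples" for \<Omega>
  proof -
    have "(adj S \<odot> block_op C S) \<bullet> \<Omega> = block_op C S \<bullet> (S \<odot> \<Omega>)"
      by (simp add: inner_tmul_left)
    also have "\<dots> = (block_op C ?I \<odot> ?b) \<bullet> (?I \<odot> ?b \<odot> \<Omega>)"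
      by (subst (1 2) SI) (simp add: block_op_bcast)
    also have "\<dots> = block_op C ?I \<bullet> (?I \<odot> conj_tuple (transpose ?Q) \<Omega>)"
      by (simp add: inner_tmul_right conj_tuple_eq bcast_simps tmul_assoc)
    also have "\<dots> = 0" by (rule crit[OF conj_tuple_skew[OF sk]])
    finally show ?thesis .
  qed
  let ?B = "adj S \<odot> block_op C S"
  have sk: "?B - adj ?B \<in> skew_tuples" by (simp add: skew_tuples_def adj_linear_simps)
  have "adj ?B \<bullet> (?B - adj ?B) = - (?B \<bullet> (?B - adj ?B))"
    using inner_adj[of ?B "adj ?B - ?B"] by (simp add: adj_linear_simps inner_diff_right)
  then have "(?B - adj ?B) \<bullet> (?B - adj ?B) = 0"
    using critS[OF sk] by (simp add: inner_diff_left)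
  then show ?thesis by simp
qed

lemma nondegenerate_L_op_selfadjoint:
  fixes S :: "('k::finite option, 'd::finite) tuple"
  assumes C: "transpose C = C" and S: "S \<in> orthogonal_tuples" and nd: "nondegenerate C S"
  shows "L_op C S V \<bullet> W = V \<bullet> L_op C S W"
proof -
  let ?B = "adj S \<odot> block_op C S"
  have B: "(?B \<odot> V) \<bullet> W = V \<bullet> (?B \<odot> W)"
    unfolding inner_tmul_left[of ?B V W] nondegenerate_block_sum_symmetric[OF C S nd] ..
  have "L_op C S V \<bullet> W = block_op C (S \<odot> V) \<bullet> (S \<odot> W) - (?B \<odot> V) \<bullet> W"
    by (simp add: L_op_def tmul_simps inner_diff_left inner_tmul_left[of "adj S"] tmul_assoc)
  also have "\<dots> = (S \<odot> V) \<bullet> block_op C (S \<odot> W) - V \<bullet> (?B \<odot> W)"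
    by (simp add: block_op_selfadjoint[OF C] B)
  also have "\<dots> = V \<bullet> L_op C S W"
    by (simp add: L_op_def tmul_simps inner_diff_right inner_tmul_left[of S] tmul_assoc)
  finally show ?thesis .
qed

section \<open>Perturbation of the quadratic form\<close>

text \<open>The squared Frobenius norm is the sum of the squared column norms, and each column of
  \<open>A ** B\<close> is \<open>A\<close> applied to one of \<open>B\<close>.\<close>

lemma norm_matrix_mult_column_bound:
  fixes A :: "real^'b^'a" and B :: "real^'c^'b"
  assumes A: "\<And>v. norm (A *v v) \<le> k * norm v" and k: "0 \<le> k"
  shows "norm (A ** B) \<le> k * norm B"
proof -
  have nc: "(norm M)\<^sup>2 = (\<Sum>c\<in>UNIV. (norm (column c M))\<^sup>2)" for M :: "real^'c^'e"
    unfolding power2_norm_eq_inner by (simp add: inner_vec_def column_def) (rule sum.swap)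
  have "(norm (A ** B))\<^sup>2 = (\<Sum>c\<in>UNIV. (norm (A *v column c B))\<^sup>2)"
    unfolding nc by (simp add: column_def matrix_matrix_mult_def matrix_vector_mult_def)
  also have "\<dots> \<le> (\<Sum>c\<in>UNIV. (k * norm (column c B))\<^sup>2)"
    by (intro sum_mono power_mono A) simp
  also have "\<dots> = (k * norm B)\<^sup>2"
    unfolding power_mult_distrib nc by (simp add: sum_distrib_left)
  finally show ?thesis by (rule power2_le_imp_le) (simp add: k)
qed

lemma norm_mult_sigma_max: "norm (A ** B) \<le> sigma_max A * norm B"
  by (rule norm_matrix_mult_column_bound[OF sigma_max_bound])

lemma norm_matrix_mult: "norm (A ** B) \<le> norm A * norm B" for A :: "real^'b^'a" and B :: "real^'c^'b"
proof (rule norm_matrix_mult_column_bound)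
  fix v :: "real^'b"
  have n: "(norm u)\<^sup>2 = (\<Sum>i\<in>UNIV. (u $ i)\<^sup>2)" for u :: "real^'a"
    unfolding power2_norm_eq_inner by (simp add: inner_vec_def power2_eq_square)
  have nA: "(norm A)\<^sup>2 = (\<Sum>i\<in>UNIV. (norm (A $ i))\<^sup>2)"
    unfolding power2_norm_eq_inner by (simp add: inner_vec_def[of A])
  have "(norm (A *v v))\<^sup>2 = (\<Sum>i\<in>UNIV. (A $ i \<bullet> v)\<^sup>2)"
    by (simp add: n matrix_mult_dot)
  also have "\<dots> \<le> (\<Sum>i\<in>UNIV. (norm (A $ i) * norm v)\<^sup>2)"
    by (intro sum_mono) (metis Cauchy_Schwarz_ineq2 abs_ge_zero power2_abs power_mono)
  also have "\<dots> = (norm A * norm v)\<^sup>2"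
    unfolding power_mult_distrib nA by (simp add: sum_distrib_right)
  finally show "norm (A *v v) \<le> norm A * norm v" by (rule power2_le_imp_le) simp
qed simp

lemma norm_tmul_le:
  fixes V W :: "('m::finite, 'd::finite) tuple"
  assumes "\<And>i. norm (V $ i) \<le> k" and k: "0 \<le> k"
  shows "norm (V \<odot> W) \<le> k * norm W"
proof -
  have n: "(norm U)\<^sup>2 = (\<Sum>i\<in>UNIV. (norm (U $ i))\<^sup>2)" for U :: "('m, 'd) tuple"
    unfolding power2_norm_eq_inner by (simp add: inner_tuple)
  have "norm ((V \<odot> W) $ i) \<le> k * norm (W $ i)" for i
    unfolding tmul_def using order_trans[OF norm_matrix_mult mult_right_mono[OF assms(1) norm_ge_zero]] by simp
  then have "(norm (V \<odot> W))\<^sup>2 \<le> (\<Sum>i\<in>UNIV. (k * norm (W $ i))\<^sup>2)"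
    unfolding n by (intro sum_mono power_mono) simp_all
  also have "\<dots> = (k * norm W)\<^sup>2"
    unfolding power_mult_distrib n by (simp add: sum_distrib_left)
  finally show ?thesis by (rule power2_le_imp_le) (simp add: k)
qed

lemma norm_orthogonal_tmul: "S \<in> orthogonal_tuples \<Longrightarrow> norm (S \<odot> V) = norm V"
  by (simp add: norm_eq_sqrt_inner inner_tmul_left orthogonal_tuples_cancel)

lemma adj_orthogonal: "S \<in> orthogonal_tuples \<Longrightarrow> adj S \<in> orthogonal_tuples"
  by (simp add: orthogonal_tuples_iff) (metis orthogonal_tuples_iff orthogonal_tuples_cancel(2))

lemma norm_L_op: "norm (L_op C S V) \<le> c3 C S * norm V"
  using norm_mult_sigma_max[of "L_mat C S" "stack V"]
  by (simp add: c3_def block_op_L_mat[symmetric] norm_stack[symmetric] stack_block_op)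

lemma norm_block_op_nth: "norm (block_op C V $ i) \<le> c1 C * norm V"
proof -
  have "block_op C V $ i = row_block C i ** stack V"
    by (simp add: block_op_def row_block_def matrix_matrix_mult_def)
  also have "norm \<dots> \<le> sigma_max (row_block C i) * norm V"
    using norm_mult_sigma_max[of "row_block C i" "stack V"] by (simp add: norm_stack)
  also have "\<dots> \<le> c1 C * norm V"
    unfolding c1_def by (intro mult_right_mono Max_ge) auto
  finally show ?thesis .
qed

lemma c1_nonneg: "0 \<le> c1 C" and c2_nonneg: "0 \<le> c2 C S" and c3_nonneg: "0 \<le> c3 C S"
proof -
  have "sigma_max (row_block C undefined) \<le> c1 C" unfolding c1_def by (rule Max_ge) auto
  then show "0 \<le> c1 C" using sigma_max_bound(2) order_trans by blast
  have "sigma_max (row_block (C ** stack S) undefined) \<le> c2 C S" unfolding c2_def by (rule Max_ge) auto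
  then show "0 \<le> c2 C S" using sigma_max_bound(2) order_trans by blast
  show "0 \<le> c3 C S" unfolding c3_def by (rule sigma_max_bound(2))
qed

lemma norm_nth_orthogonal:
  fixes S V :: "('m::finite, 'd::finite) tuple"
  assumes S: "S \<in> orthogonal_tuples"
  shows "norm ((adj S \<odot> V) $ i) = norm (V $ i)"
proof -
  have "S $ i ** transpose (S $ i) = mat 1"
    using S by (simp add: orthogonal_tuples_def orthogonal_matrix_def)
  then have "S $ i ** (transpose (S $ i) ** X) = X" for X :: "real^'d^'d"
    by (simp add: matrix_mul_assoc)
  then show ?thesis
    by (simp add: tmul_def adj_def norm_eq_sqrt_inner inner_matrix_mult(1))
qed

text \<open>With \<open>U = S\<^sup>T O\<close> the form of \<open>L(O)\<close> is the form of \<open>L(S)\<close> at \<open>U \<Omega>\<close> up to the block-diagonal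
  defect \<open>W\<close>; the first contributes \<open>2 c\<^sub>3\<close> and the second \<open>c\<^sub>1 + c\<^sub>2\<close>.\<close>

lemma L_form_perturbation:
  fixes S R \<Omega> :: "('m::finite, 'd::finite) tuple"
  assumes S: "S \<in> orthogonal_tuples" and R: "R \<in> orthogonal_tuples"
  shows "\<bar>L_form C R \<Omega> - L_form C S \<Omega>\<bar> \<le> (c1 C + c2 C S + 2 * c3 C S) * norm (R - S) * (norm \<Omega>)\<^sup>2"
proof -
  define U where "U = adj S \<odot> R"
  define W where "W = block_op C (R - S) - block_op C S \<odot> (adj S \<odot> (R - S))"
  let ?n = "norm (R - S)"
  have SU: "S \<odot> U = R" by (simp add: U_def orthogonal_tuples_cancel[OF S])
  have Uo: "U \<in> orthogonal_tuples"
    unfolding U_def by (rule orthogonal_tuples_tmul[OF adj_orthogonal[OF S] R])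
  have e: "adj S \<odot> (R - S) = U - tone"
    by (simp add: U_def tmul_simps orthogonal_tuples_cancel[OF S])
  \<comment> \<open>\<open>W\<close> acts slot by slot, so bounds for single block rows suffice;
    this is why \<open>c1\<close> and \<open>c2\<close> are maxima over block rows.\<close>
  have Wi: "norm (W $ i) \<le> (c1 C + c2 C S) * ?n" for i
  proof -
    have "norm ((block_op C S \<odot> (adj S \<odot> (R - S))) $ i) \<le> c2 C S * ?n"
    proof -
      have "(block_op C S \<odot> (adj S \<odot> (R - S))) $ i = row_block (C ** stack S) i ** (adj S \<odot> (R - S)) $ i"
        by (simp add: tmul_def[of "block_op C S"]) (simp add: block_op_def)
      also have "norm \<dots> \<le> sigma_max (row_block (C ** stack S) i) * norm ((R - S) $ i)"
        using norm_mult_sigma_max[of "row_block (C ** stack S) i" "(adj S \<odot> (R - S)) $ i"]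
        by (simp add: norm_nth_orthogonal[OF S])
      also have "\<dots> \<le> c2 C S * ?n"
      proof (intro mult_mono)
        show "sigma_max (row_block (C ** stack S) i) \<le> c2 C S"
          unfolding c2_def by (rule Max_ge) auto
        show "norm ((R - S) $ i) \<le> ?n" by (rule Finite_Cartesian_Product.norm_nth_le)
      qed (simp_all add: c2_nonneg)
      finally show ?thesis .
    qed
    moreover have "norm (W $ i) \<le> norm (block_op C (R - S) $ i) + norm ((block_op C S \<odot> (adj S \<odot> (R - S))) $ i)"
      unfolding W_def vector_minus_component by (rule norm_triangle_ineq4)
    ultimately show ?thesis using norm_block_op_nth[of C "R - S" i] by (simp add: algebra_simps)
  qed
  \<comment> \<open>The terms with \<open>C\<close> agree because \<open>S \<odot> U = R\<close>;
    only the block-diagonal terms differ.\<close>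
  have 1: "L_form C R \<Omega> - L_form C S (U \<odot> \<Omega>) = - ((W \<odot> \<Omega>) \<bullet> (R \<odot> \<Omega>))"
  proof -
    have W: "W = block_op C R - block_op C S \<odot> U"
      unfolding W_def e by (simp add: block_op_simps tmul_simps)
    have "block_op C R \<odot> \<Omega> = W \<odot> \<Omega> + block_op C S \<odot> (U \<odot> \<Omega>)"
      unfolding W by (simp add: tmul_simps tmul_assoc)
    then show ?thesis
      by (simp add: L_form_eq tmul_assoc[symmetric] SU inner_add_left)
  qed
  have b1: "\<bar>(W \<odot> \<Omega>) \<bullet> (R \<odot> \<Omega>)\<bar> \<le> (c1 C + c2 C S) * ?n * (norm \<Omega>)\<^sup>2"
  proof -
    have "\<bar>(W \<odot> \<Omega>) \<bullet> (R \<odot> \<Omega>)\<bar> \<le> norm (W \<odot> \<Omega>) * norm \<Omega>"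
      using Cauchy_Schwarz_ineq2[of "W \<odot> \<Omega>" "R \<odot> \<Omega>"] by (simp add: norm_orthogonal_tmul[OF R])
    also have "\<dots> \<le> ((c1 C + c2 C S) * ?n * norm \<Omega>) * norm \<Omega>"
      by (intro mult_right_mono norm_tmul_le Wi) (simp_all add: c1_nonneg c2_nonneg)
    finally show ?thesis by (simp add: power2_eq_square mult.assoc)
  qed
  have b2: "\<bar>L_form C S (U \<odot> \<Omega>) - L_form C S \<Omega>\<bar> \<le> 2 * c3 C S * ?n * (norm \<Omega>)\<^sup>2"
  proof -
    let ?D = "U \<odot> \<Omega> - \<Omega>"
    have "?D = (U - tone) \<odot> \<Omega>" by (simp add: tmul_simps)
    moreover have "norm ((U - tone) $ i) \<le> ?n" for i
      using norm_nth_orthogonal[OF S, of "R - S" i] Finite_Cartesian_Product.norm_nth_le[of "R - S" i] by (simp add: e)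
    ultimately have D: "norm ?D \<le> ?n * norm \<Omega>" using norm_tmul_le[of "U - tone" ?n \<Omega>] by simp
    \<comment> \<open>Each of the two increments contains \<open>?D\<close> once, which produces the
      factor 2 in front of \<open>c3\<close>.\<close>
    have "L_form C S (U \<odot> \<Omega>) - L_form C S \<Omega> = ?D \<bullet> L_op C S (U \<odot> \<Omega>) + \<Omega> \<bullet> L_op C S ?D"
      by (simp add: L_form_def linear_diff[OF linear_L_op] inner_diff_left inner_diff_right)
    moreover have "\<bar>?D \<bullet> L_op C S (U \<odot> \<Omega>)\<bar> \<le> (?n * norm \<Omega>) * (c3 C S * norm \<Omega>)"
      using norm_L_op[of C S "U \<odot> \<Omega>"]
      by (intro order_trans[OF Cauchy_Schwarz_ineq2] mult_mono D) (simp_all add: norm_orthogonal_tmul[OF Uo])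
    moreover have "\<bar>\<Omega> \<bullet> L_op C S ?D\<bar> \<le> norm \<Omega> * (c3 C S * (?n * norm \<Omega>))"
      by (intro order_trans[OF Cauchy_Schwarz_ineq2] mult_left_mono order_trans[OF norm_L_op] D c3_nonneg) simp
    ultimately have "\<bar>L_form C S (U \<odot> \<Omega>) - L_form C S \<Omega>\<bar>
        \<le> (?n * norm \<Omega>) * (c3 C S * norm \<Omega>) + norm \<Omega> * (c3 C S * (?n * norm \<Omega>))" by linarith
    then show ?thesis by (simp add: power2_eq_square algebra_simps)
  qed
  have "\<bar>L_form C R \<Omega> - L_form C S \<Omega>\<bar>
      \<le> (c1 C + c2 C S) * ?n * (norm \<Omega>)\<^sup>2 + 2 * c3 C S * ?n * (norm \<Omega>)\<^sup>2"
    using 1 b1 b2 by linarith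
  also have "\<dots> = (c1 C + c2 C S + 2 * c3 C S) * ?n * (norm \<Omega>)\<^sup>2" by (simp add: algebra_simps)
  finally show ?thesis .
qed

section \<open>Invariance of the constants c2 and c3 under right multiplication\<close>

lemma c2_right_mult: "orthogonal_matrix Q \<Longrightarrow> c2 C (right_mult S Q) = c2 C S"
proof -
  assume Q: "orthogonal_matrix Q"
  have "row_block (C ** stack (right_mult S Q)) i = row_block (C ** stack S) i ** Q" for i
  proof -
    have "stack (right_mult S Q) = stack S ** Q"
      by (simp add: right_mult_def stack_def matrix_matrix_mult_def vec_eq_iff)
    then show ?thesis by (simp add: matrix_mul_assoc row_block_mult)
  qed
  then show ?thesis by (simp add: c2_def sigma_max_mult_orthogonal_right[OF Q])
qed

text \<open>Passing to \<open>right_mult S Q\<close> conjugates \<open>L_mat\<close> by the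
  orthogonal matrix with all diagonal blocks \<open>Q\<close>, which leaves the singular values
  unchanged.\<close>

lemma c3_right_mult:
  fixes S :: "('m::finite, 'd::finite) tuple"
  assumes Q: "orthogonal_matrix Q"
  shows "c3 C (right_mult S Q) = c3 C S"
proof -
  let ?D = "blockdiag (bcast Q) :: ('m, 'd) block_mat"
  have D: "orthogonal_matrix ?D"
    unfolding orthogonal_matrix
    by (rule block_op_ext)
      (simp add: block_op_mult transpose_blockdiag block_op_blockdiag block_op_mat_1
        orthogonal_tuples_cancel[OF bcast_orthogonal[OF Q]])
  have "L_mat C (right_mult S Q) = transpose ?D ** L_mat C S ** ?D"
  proof (rule block_op_ext)
    fix V
    note c = orthogonal_tuples_cancel[OF bcast_orthogonal[OF Q]]
    have "L_op C S (bcast Q \<odot> V) = adj S \<odot> (block_op C (S \<odot> bcast Q \<odot> V) - block_op C (S \<odot> bcast Q) \<odot> V)"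
      by (simp add: L_op_def tmul_assoc block_op_bcast)
    then show "block_op (L_mat C (right_mult S Q)) V = block_op (transpose ?D ** L_mat C S ** ?D) V"
      by (simp add: block_op_mult transpose_blockdiag block_op_blockdiag block_op_L_mat)
        (simp add: L_op_def right_mult_eq adj_tmul tmul_assoc)
  qed
  then show ?thesis
    using D by (simp add: c3_def sigma_max_mult_orthogonal_right sigma_max_mult_orthogonal_left)
qed

section \<open>The matrix \<open>LL_mat C S\<close> as a quadratic form on skew tuples\<close>

text \<open>Up to the order of coordinates this is the transpose of \<open>P_bar\<close>, see
  \<open>transpose_P_bar_mult\<close>.\<close>

definition skew_of :: "real^('d::{card2, linorder} lt_pair \<times> 'm::finite) \<Rightarrow> ('m, 'd) tuple" where
  "skew_of w = (\<chi> i p q. if p < q then w $ (Abs_lt_pair (p, q), i)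
     else if q < p then - w $ (Abs_lt_pair (q, p), i) else 0)"

text \<open>Indexed like the columns of \<open>kron (mat 1) (L_perm C S)\<close>.\<close>

definition columns_vec :: "('m::finite, 'd::finite) tuple \<Rightarrow> real^('d \<times> ('d \<times> 'm))" where
  "columns_vec \<Omega> = (\<chi> c. \<Omega> $ snd (snd c) $ fst (snd c) $ fst c)"

lemma Rep_lt_pair_less: "fst (Rep_lt_pair rs) < snd (Rep_lt_pair rs)"
  using Rep_lt_pair[of rs] by (simp add: split_def)

lemma lt_pair_eq_Abs_iff: "p < q \<Longrightarrow> rs = Abs_lt_pair (p, q) \<longleftrightarrow> Rep_lt_pair rs = (p, q)"
  by (metis Abs_lt_pair_inverse Rep_lt_pair_inverse case_prodI mem_Collect_eq)

lemma P_bar_nth: "P_bar $ (rs, i) $ (q, (p, j)) =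
    (if i = j then (if p < q then (if rs = Abs_lt_pair (p, q) then 1 else 0)
       else if q < p then (if rs = Abs_lt_pair (q, p) then - 1 else 0) else 0) else 0)"
  by (cases "Rep_lt_pair rs") (auto simp: P_bar_def lt_pair_eq_Abs_iff)

lemma transpose_P_bar_mult: "transpose P_bar *v w = columns_vec (skew_of w)"
proof -
  have "(transpose P_bar *v w) $ (q, (p, j)) = columns_vec (skew_of w) $ (q, (p, j))" for q p j
  proof -
    have "(transpose P_bar *v w) $ (q, (p, j)) = (\<Sum>rs\<in>UNIV. P_bar $ (rs, j) $ (q, (p, j)) * w $ (rs, j))"
      by (simp add: matrix_vector_mult_def transpose_def sum_prod_UNIV P_bar_nth
          if_distrib[of "\<lambda>x. x * _"] cong: if_cong)
    also have "\<dots> = columns_vec (skew_of w) $ (q, (p, j))"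
      by (simp add: P_bar_nth columns_vec_def skew_of_def if_distrib[of "\<lambda>x. x * _"] cong: if_cong)
    finally show ?thesis .
  qed
  then show ?thesis by (simp add: vec_eq_iff)
qed

lemma P_mat_conj_nth: "(P_mat ** A ** transpose P_mat) $ (p, i) $ (s, j) = A $ (i, p) $ (j, s)"
proof -
  have P: "P_mat $ (p, i) $ c = (if c = (i, p) then 1 else 0)" for p i c
    by (cases c) (auto simp: P_mat_def)
  have 1: "(P_mat ** A) $ (p, i) $ c = A $ (i, p) $ c" for c
    by (simp add: matrix_matrix_mult_def P if_distrib[of "\<lambda>x. x * _"] cong: if_cong)
  have "(P_mat ** A ** transpose P_mat) $ (p, i) $ (s, j) = (\<Sum>c\<in>UNIV. (P_mat ** A) $ (p, i) $ c * P_mat $ (s, j) $ c)"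
    by (simp add: matrix_matrix_mult_def[of "P_mat ** A"] transpose_def)
  also have "\<dots> = A $ (i, p) $ (j, s)"
    unfolding 1 P by (simp add: if_distrib[of "\<lambda>x. _ * x"] cong: if_cong)
  finally show ?thesis .
qed

lemma kron_mult_columns_vec:
  "kron (mat 1) (P_mat ** A ** transpose P_mat) *v columns_vec \<Omega> = columns_vec (block_op A \<Omega>)"
proof -
  have "(kron (mat 1) (P_mat ** A ** transpose P_mat) *v columns_vec \<Omega>) $ (q, (p, i))
      = columns_vec (block_op A \<Omega>) $ (q, (p, i))" for q p i
  proof -
    have "(kron (mat 1) (P_mat ** A ** transpose P_mat) *v columns_vec \<Omega>) $ (q, (p, i))
      = (\<Sum>q'\<in>UNIV. \<Sum>s\<in>UNIV. \<Sum>j\<in>UNIV. (if q = q' then 1 else 0) * A $ (i, p) $ (j, s) * \<Omega> $ j $ s $ q')"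
      by (simp add: matrix_vector_mult_def kron_def sum_prod_UNIV P_mat_conj_nth columns_vec_def mat_def)
    also have "\<dots> = (\<Sum>q'\<in>UNIV. if q = q' then \<Sum>s\<in>UNIV. \<Sum>j\<in>UNIV. A $ (i, p) $ (j, s) * \<Omega> $ j $ s $ q' else 0)"
      by (rule sum.cong) auto
    also have "\<dots> = (\<Sum>s\<in>UNIV. \<Sum>j\<in>UNIV. A $ (i, p) $ (j, s) * \<Omega> $ j $ s $ q)" by simp
    also have "\<dots> = columns_vec (block_op A \<Omega>) $ (q, (p, i))"
      by (simp add: columns_vec_def block_op_nth) (rule sum.swap)
    finally show ?thesis .
  qed
  then show ?thesis by (simp add: vec_eq_iff)
qed

lemma inner_columns_vec: "columns_vec V \<bullet> columns_vec W = V \<bullet> W"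
proof -
  have "columns_vec V \<bullet> columns_vec W = (\<Sum>q\<in>UNIV. \<Sum>p\<in>UNIV. \<Sum>i\<in>UNIV. V $ i $ p $ q * W $ i $ p $ q)"
    by (simp add: inner_vec_def columns_vec_def sum_prod_UNIV)
  also have "\<dots> = (\<Sum>q\<in>UNIV. \<Sum>i\<in>UNIV. \<Sum>p\<in>UNIV. V $ i $ p $ q * W $ i $ p $ q)"
    by (rule sum.cong[OF refl], rule sum.swap)
  also have "\<dots> = (\<Sum>i\<in>UNIV. \<Sum>q\<in>UNIV. \<Sum>p\<in>UNIV. V $ i $ p $ q * W $ i $ p $ q)"
    by (rule sum.swap)
  also have "\<dots> = (\<Sum>i\<in>UNIV. \<Sum>p\<in>UNIV. \<Sum>q\<in>UNIV. V $ i $ p $ q * W $ i $ p $ q)"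
    by (rule sum.cong[OF refl], rule sum.swap)
  finally show ?thesis by (simp add: inner_vec_def)
qed

text \<open>\<open>P_bar\<close> moves to the other side as \<open>skew_of\<close>, the Kronecker
  product with the identity lets \<open>L_perm\<close> act on each column separately, and
  \<open>P_mat\<close> only reorders coordinates.\<close>

lemma LL_mat_form: "(LL_mat C S *v w) \<bullet> w' = L_op C S (skew_of w) \<bullet> skew_of w'"
proof -
  have "LL_mat C S *v w = P_bar *v columns_vec (L_op C S (skew_of w))"
    by (simp only: LL_mat_def L_perm_def matrix_vector_mul_assoc[symmetric] transpose_P_bar_mult
        kron_mult_columns_vec block_op_L_mat)
  then show ?thesis
    by (simp only: inner_matrix_transpose[of P_bar] transpose_P_bar_mult inner_columns_vec)
qed

lemma sum_lt_pair: "(\<Sum>rs\<in>UNIV. g (Rep_lt_pair rs)) = (\<Sum>p\<in>UNIV. \<Sum>q\<in>UNIV. if p < q then g (p, q) else 0)"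
  for g :: "'d::{card2, linorder} \<times> 'd \<Rightarrow> 'c::comm_monoid_add"
proof -
  have inj: "inj (Rep_lt_pair :: 'd lt_pair \<Rightarrow> _)" by (simp add: inj_def Rep_lt_pair_inject)
  have "(\<Sum>rs\<in>UNIV. g (Rep_lt_pair rs)) = (\<Sum>pq\<in>{(r, s). r < s}. g pq)"
    using sum.reindex[OF inj, of g] by (simp add: o_def type_definition.Rep_range[OF type_definition_lt_pair])
  also have "\<dots> = (\<Sum>pq\<in>UNIV. if fst pq < snd pq then g pq else 0)"
    by (simp add: sum.If_cases split_def)
  finally show ?thesis by (simp add: sum_prod_UNIV)
qed

text \<open>Each entry above the diagonal occurs again, negated, below it.\<close>

lemma inner_skew_of: "skew_of w \<bullet> skew_of w' = 2 * (w \<bullet> w')"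
  for w w' :: "real^('d::{card2, linorder} lt_pair \<times> 'm::finite)"
proof -
  define g where "g i pq = w $ (Abs_lt_pair pq, i) * w' $ (Abs_lt_pair pq, i)" for i and pq :: "'d \<times> 'd"
  have gs: "(\<Sum>p\<in>UNIV. \<Sum>q\<in>UNIV. if p < q then g i (p, q) else 0) = (\<Sum>rs\<in>UNIV. w $ (rs, i) * w' $ (rs, i))" for i
    unfolding sum_lt_pair[symmetric] by (simp add: g_def Rep_lt_pair_inverse)
  have "skew_of w \<bullet> skew_of w'
     = (\<Sum>i\<in>UNIV. \<Sum>p\<in>UNIV. \<Sum>q\<in>UNIV. (if p < q then g i (p, q) else 0) + (if q < p then g i (q, p) else 0))"
    by (simp add: inner_vec_def skew_of_def g_def, intro sum.cong refl) (auto simp: g_def)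
  also have "\<dots> = (\<Sum>i\<in>UNIV. (\<Sum>p\<in>UNIV. \<Sum>q\<in>UNIV. if p < q then g i (p, q) else 0)
      + (\<Sum>p\<in>UNIV. \<Sum>q\<in>UNIV. if q < p then g i (q, p) else 0))"
    by (simp add: sum.distrib)
  also have "\<dots> = (\<Sum>i\<in>UNIV. 2 * (\<Sum>rs\<in>UNIV. w $ (rs, i) * w' $ (rs, i)))"
  proof (rule sum.cong[OF refl])
    fix i
    have "(\<Sum>p\<in>UNIV. \<Sum>q\<in>UNIV. if q < p then g i (q, p) else 0) = (\<Sum>rs\<in>UNIV. w $ (rs, i) * w' $ (rs, i))"
      unfolding gs[symmetric] by (rule sum.swap)
    then show "(\<Sum>p\<in>UNIV. \<Sum>q\<in>UNIV. if p < q then g i (p, q) else 0)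
        + (\<Sum>p\<in>UNIV. \<Sum>q\<in>UNIV. if q < p then g i (q, p) else 0) = 2 * (\<Sum>rs\<in>UNIV. w $ (rs, i) * w' $ (rs, i))"
      by (simp add: gs)
  qed
  also have "\<dots> = 2 * (\<Sum>rs\<in>UNIV. \<Sum>i\<in>UNIV. w $ (rs, i) * w' $ (rs, i))"
    by (simp add: sum_distrib_left[symmetric]) (rule sum.swap)
  also have "\<dots> = 2 * (w \<bullet> w')" by (simp add: inner_vec_def sum_prod_UNIV)
  finally show ?thesis .
qed

lemma skew_of_skew: "skew_of w \<in> skew_tuples"
  by (auto simp: skew_tuples_iff skew_def transpose_def vec_eq_iff skew_of_def)

lemma skew_of_surj:
  fixes \<Omega> :: "('m::finite, 'd::{card2, linorder}) tuple"
  assumes "\<Omega> \<in> skew_tuples"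
  obtains w where "skew_of w = \<Omega>"
proof
  have t: "\<Omega> $ i $ q $ p = - \<Omega> $ i $ p $ q" for i p q
  proof -
    have "transpose (\<Omega> $ i) = - \<Omega> $ i" using assms by (simp add: skew_tuples_iff skew_def)
    from arg_cong[OF this, of "\<lambda>M. M $ p $ q"] show ?thesis by (simp add: transpose_def)
  qed
  have t0: "\<Omega> $ i $ p $ p = 0" for i p using t[of i p p] by simp
  let ?w = "\<chi> c. \<Omega> $ snd c $ fst (Rep_lt_pair (fst c)) $ snd (Rep_lt_pair (fst c))"
  have "skew_of ?w $ i $ p $ q = \<Omega> $ i $ p $ q" for i p q
    using t[of i q p] t0[of i p] by (cases p q rule: linorder_cases) (simp_all add: skew_of_def Abs_lt_pair_inverse)
  then show "skew_of ?w = \<Omega>" by (simp add: vec_eq_iff)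
qed

lemma card_lt_pair: "CARD('d::{card2, linorder} lt_pair) = CARD('d) * (CARD('d) - 1) div 2"
proof -
  have "CARD('d lt_pair) = card {(r :: 'd, s). r < s}"
    by (rule type_definition.card[OF type_definition_lt_pair])
  moreover have "card {(r :: 'd, s). s < r} = card {(r :: 'd, s). r < s}"
  proof -
    have "{(r :: 'd, s). s < r} = prod.swap ` {(r, s). r < s}" by (auto simp: image_iff)
    then show ?thesis by (simp add: card_image)
  qed
  moreover have "card {(r :: 'd, s). r = s} = CARD('d)"
  proof -
    have "{(r :: 'd, s). r = s} = (\<lambda>r. (r, r)) ` UNIV" by auto
    then show ?thesis by (simp add: card_image inj_on_def)
  qed
  moreover have "CARD('d) * CARD('d) = card ({(r :: 'd, s). r < s} \<union> ({(r, s). s < r} \<union> {(r, s). r = s}))"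
  proof -
    have "{(r :: 'd, s). r < s} \<union> ({(r, s). s < r} \<union> {(r, s). r = s}) = UNIV" by auto
    then show ?thesis by (simp add: card_prod)
  qed
  moreover have "card ({(r :: 'd, s). r < s} \<union> ({(r, s). s < r} \<union> {(r, s). r = s}))
      = card {(r :: 'd, s). r < s} + (card {(r :: 'd, s). s < r} + card {(r :: 'd, s). r = s})"
    by (subst card_Un_disjoint, simp, simp, force, subst card_Un_disjoint) auto
  ultimately have "CARD('d) * CARD('d) = 2 * CARD('d lt_pair) + CARD('d)" by simp
  then have "2 * CARD('d lt_pair) = CARD('d) * (CARD('d) - 1)"
    by (simp add: right_diff_distrib')
  then show ?thesis by (metis nonzero_mult_div_cancel_left zero_neq_numeral)
qed

section \<open>The extreme eigenvalues\<close>

context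
  fixes C :: "('k::finite option, 'd::{card2, linorder}) block_mat" and S :: "('k option, 'd) tuple"
  assumes C: "transpose C = C" and S: "S \<in> orthogonal_tuples" and nd: "nondegenerate C S"
begin

text \<open>One cross term vanishes by \<open>L_op_bcast\<close>, the other by self-adjointness,
  which relies on the first-order condition at \<open>S\<close>.\<close>

lemma L_form_add_bcast: "L_form C S (\<Omega> + bcast B) = L_form C S \<Omega>"
proof -
  have "bcast B \<bullet> L_op C S \<Omega> = 0"
    using nondegenerate_L_op_selfadjoint[OF C S nd, of "bcast B" \<Omega>] by (simp add: L_op_bcast)
  then show ?thesis
    by (simp add: L_form_def linear_add[OF linear_L_op] L_op_bcast inner_add_left)
qed

lemma skew_decomposition:
  fixes \<Omega> :: "('k option, 'd) tuple"
  assumes "\<Omega> \<in> skew_tuples"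
  obtains \<Omega>' B where "\<Omega> = \<Omega>' + bcast B" "\<Omega>' \<in> skew_tuples" "(\<Sum>v\<in>UNIV. \<Omega>' $ v) = 0"
proof
  let ?m = "real CARD('k option)"
  let ?B = "(1 / ?m) *\<^sub>R (\<Sum>v\<in>UNIV. \<Omega> $ v)"
  let ?\<Omega> = "\<Omega> - bcast ?B"
  show "\<Omega> = ?\<Omega> + bcast ?B" by simp
  have "bcast ?B = (1 / ?m) *\<^sub>R tsum \<Omega>" by (simp add: bcast_def tsum_def vec_eq_iff)
  then show "?\<Omega> \<in> skew_tuples"
    using assms by (metis subspace_diff subspace_scale subspace_skew_tuples tsum_skew)
  have "(\<Sum>v\<in>UNIV. ?\<Omega> $ v) = (\<Sum>v\<in>UNIV. \<Omega> $ v) - ?m *\<^sub>R ?B"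
    by (simp add: sum_subtractf bcast_def sum_constant_scaleR del: sum_constant card_option scaleR_scaleR)
  also have "\<dots> = 0" using zero_less_card_finite[where 'a = "'k option"] by (simp del: card_option)
  finally show "(\<Sum>v\<in>UNIV. ?\<Omega> $ v) = 0" .
qed

lemma L_form_nonneg: "\<Omega> \<in> skew_tuples \<Longrightarrow> 0 \<le> L_form C S \<Omega>"
  and L_form_eq_0_imp_bcast: "\<Omega> \<in> skew_tuples \<Longrightarrow> L_form C S \<Omega> = 0 \<Longrightarrow> \<exists>B. \<Omega> = bcast B"
proof -
  assume sk: "\<Omega> \<in> skew_tuples"
  obtain \<Omega>' B where d: "\<Omega> = \<Omega>' + bcast B" "\<Omega>' \<in> skew_tuples" "(\<Sum>v\<in>UNIV. \<Omega>' $ v) = 0"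
    using skew_decomposition[OF sk] by blast
  have e: "L_form C S \<Omega> = L_form C S \<Omega>'" unfolding d(1) by (rule L_form_add_bcast)
  have pos: "\<Omega>' \<noteq> 0 \<Longrightarrow> 0 < L_form C S \<Omega>'"
    by (rule nondegenerate_L_form_pos[OF C S nd d(2,3)])
  show "0 \<le> L_form C S \<Omega>"
    unfolding e using pos by (cases "\<Omega>' = 0") (simp_all add: L_form_def)
  show "\<exists>B. \<Omega> = bcast B" if "L_form C S \<Omega> = 0"
    using that pos d(1) unfolding e by force
qed

lemma LL_mat_symmetric: "transpose (LL_mat C S) = LL_mat C S"
proof -
  have "(transpose (LL_mat C S) *v w) \<bullet> w' = (LL_mat C S *v w) \<bullet> w'" for w w'
  proof -
    have "(transpose (LL_mat C S) *v w) \<bullet> w' = (LL_mat C S *v w') \<bullet> w"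
      by (metis inner_matrix_transpose inner_commute)
    also have "\<dots> = (LL_mat C S *v w) \<bullet> w'"
      unfolding LL_mat_form using nondegenerate_L_op_selfadjoint[OF C S nd] by (metis inner_commute)
    finally show ?thesis .
  qed
  then have "transpose (LL_mat C S) *v w = LL_mat C S *v w" for w
    using vector_eq_rdot by blast
  then show ?thesis by (simp add: matrix_eq)
qed

lemma LL_mat_L_form: "w \<bullet> (LL_mat C S *v w) = L_form C S (skew_of w)"
  by (metis LL_mat_form L_form_def inner_commute)

text \<open>A vector annihilated by \<open>LL_mat\<close> has zero form, and the form is positive
  off the constant tuples; conversely \<open>L_op\<close> annihilates constant tuples.\<close>

lemma LL_mat_kernel: "LL_mat C S *v w = 0 \<longleftrightarrow> (\<exists>B. skew_of w = bcast B)"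
proof
  assume "LL_mat C S *v w = 0"
  then have "L_form C S (skew_of w) = 0" by (simp add: LL_mat_L_form[symmetric])
  then show "\<exists>B. skew_of w = bcast B" by (rule L_form_eq_0_imp_bcast[OF skew_of_skew])
next
  assume "\<exists>B. skew_of w = bcast B"
  then have "(LL_mat C S *v w) \<bullet> (LL_mat C S *v w) = 0"
    unfolding LL_mat_form by (auto simp: L_op_bcast)
  then show "LL_mat C S *v w = 0" by simp
qed

lemma dim_LL_mat_kernel: "dim (eigenspace (LL_mat C S) 0) = CARD('d) * (CARD('d) - 1) div 2"
proof -
  \<comment> \<open>\<open>K\<close> repeats one strictly upper triangular pattern in every view;
    its range is the kernel.\<close>
  define K :: "real^'d lt_pair \<Rightarrow> real^('d lt_pair \<times> 'k option)" where "K x = (\<chi> c. x $ fst c)" for x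
  have linK: "linear K" by (simp add: linear_iff K_def vec_eq_iff)
  have injK: "inj K" by (auto simp: inj_def K_def vec_eq_iff)
  have "w \<in> range K \<longleftrightarrow> (\<exists>B. skew_of w = bcast B)" for w :: "real^('d lt_pair \<times> 'k option)"
  proof
    assume "w \<in> range K"
    then obtain x where "w = K x" by blast
    then have "skew_of w = bcast (\<chi> p q. if p < q then x $ Abs_lt_pair (p, q)
        else if q < p then - x $ Abs_lt_pair (q, p) else 0)"
      by (simp add: skew_of_def bcast_def K_def cong: if_cong)
    then show "\<exists>B. skew_of w = bcast B" by blast
  next
    assume "\<exists>B. skew_of w = bcast B"
    then obtain B where B: "skew_of w = bcast B" by blast
    have "w $ (rs, i) = B $ fst (Rep_lt_pair rs) $ snd (Rep_lt_pair rs)" for rs i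
    proof -
      have "skew_of w $ i $ fst (Rep_lt_pair rs) $ snd (Rep_lt_pair rs) = w $ (rs, i)"
        using Rep_lt_pair_less[of rs] by (simp add: skew_of_def Rep_lt_pair_inverse)
      then show ?thesis by (simp add: B bcast_def)
    qed
    then have "w = K (\<chi> rs. B $ fst (Rep_lt_pair rs) $ snd (Rep_lt_pair rs))"
      by (simp add: K_def vec_eq_iff)
    then show "w \<in> range K" by blast
  qed
  then have "eigenspace (LL_mat C S) 0 = range K"
    by (auto simp: eigenspace_def LL_mat_kernel)
  then have "dim (eigenspace (LL_mat C S) 0) = dim (UNIV :: (real^'d lt_pair) set)"
    using dim_image_eq[OF linK, of UNIV] injK by simp
  then show ?thesis by (simp add: card_lt_pair)
qed

text \<open>The kernel consists of the constant skew tuples, and \<open>bcast B\<close> pairs with a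
  tuple as \<open>B\<close> pairs with its sum; testing with the sum itself gives the forward
  direction.\<close>

lemma orthogonal_kernel_iff:
  "(\<forall>u. LL_mat C S *v u = 0 \<longrightarrow> u \<bullet> w = 0) \<longleftrightarrow> (\<Sum>v\<in>UNIV. skew_of w $ v) = 0"
proof -
  have bc: "bcast B \<bullet> \<Omega> = B \<bullet> (\<Sum>v\<in>UNIV. \<Omega> $ v)" for B and \<Omega> :: "('k option, 'd) tuple"
    by (simp add: inner_tuple bcast_def inner_sum_right)
  show ?thesis
  proof (intro iffI allI impI)
    assume h: "\<forall>u. LL_mat C S *v u = 0 \<longrightarrow> u \<bullet> w = 0"
    let ?B = "\<Sum>v\<in>UNIV. skew_of w $ v"
    have "(bcast ?B :: ('k option, 'd) tuple) = tsum (skew_of w)" by (simp add: bcast_def tsum_def)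
    then have "(bcast ?B :: ('k option, 'd) tuple) \<in> skew_tuples" by (simp add: tsum_skew skew_of_skew)
    then obtain u :: "real^('d lt_pair \<times> 'k option)" where u: "skew_of u = bcast ?B"
      using skew_of_surj by blast
    then have "u \<bullet> w = 0" using h LL_mat_kernel by blast
    then have "bcast ?B \<bullet> skew_of w = 0" using inner_skew_of[of u w] by (simp add: u)
    then show "?B = 0" by (simp add: bc)
  next
    fix u assume z: "(\<Sum>v\<in>UNIV. skew_of w $ v) = 0" and "LL_mat C S *v u = 0"
    then obtain B where "skew_of u = bcast B" using LL_mat_kernel by blast
    then show "u \<bullet> w = 0" using inner_skew_of[of u w] by (simp add: bc z)
  qed
qed

text \<open>The eigenvalue facts are transported by \<open>skew_of\<close>, which doubles squared
  norms. The tuples attaining the bounds are recorded so that the eigenvalues can be compared with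
  each other and with those at \<open>right_mult S Q\<close>.\<close>

lemma
  shows lambda_minus_pos: "0 < lambda_minus C S"
    and lambda_minus_bound: "\<Omega> \<in> skew_tuples \<Longrightarrow> (\<Sum>v\<in>UNIV. \<Omega> $ v) = 0 \<Longrightarrow>
      lambda_minus C S * (norm \<Omega>)\<^sup>2 \<le> 2 * L_form C S \<Omega>"
    and lambda_minus_attained: "\<exists>\<Omega>. \<Omega> \<in> skew_tuples \<and> (\<Sum>v\<in>UNIV. \<Omega> $ v) = 0 \<and> \<Omega> \<noteq> 0 \<and>
      2 * L_form C S \<Omega> = lambda_minus C S * (norm \<Omega>)\<^sup>2"
    and lambda_plus_bound: "\<Omega> \<in> skew_tuples \<Longrightarrow> 2 * L_form C S \<Omega> \<le> lambda_plus C S * (norm \<Omega>)\<^sup>2"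
    and lambda_plus_attained: "\<exists>\<Omega>. \<Omega> \<in> skew_tuples \<and> \<Omega> \<noteq> 0 \<and>
      2 * L_form C S \<Omega> = lambda_plus C S * (norm \<Omega>)\<^sup>2"
proof -
  let ?A = "LL_mat C S" and ?N = "CARD('d) * (CARD('d) - 1) div 2"
  have n2: "(norm (skew_of w))\<^sup>2 = 2 * (w \<bullet> w)" for w :: "real^('d lt_pair \<times> 'k option)"
    by (simp add: power2_norm_eq_inner inner_skew_of)
  have Npos: "0 < ?N" using card_lt_pair[where 'd = 'd] zero_less_card_finite[where 'a = "'d lt_pair"] by linarith
  have cardA: "CARD('d lt_pair \<times> 'k option) = ?N * CARD('k option)"
    by (simp add: card_prod card_lt_pair)
  \<comment> \<open>There are at least two views, so an eigenvalue number \<open>?N + 1\<close>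
    exists.\<close>
  have "?N * 1 < ?N * CARD('k option)" using Npos by (intro mult_strict_left_mono) simp_all
  then have less: "?N < CARD('d lt_pair \<times> 'k option)" unfolding cardA by simp
  have psd: "0 \<le> w \<bullet> (?A *v w)" for w
    unfolding LL_mat_L_form by (rule L_form_nonneg[OF skew_of_skew])
  have lm: "lambda_minus C S = eig (?N + 1) ?A" by (simp add: lambda_minus_def)
  obtain v where v: "0 < eig (?N + 1) ?A" "norm v = 1" "?A *v v = eig (?N + 1) ?A *\<^sub>R v"
    "\<And>u. ?A *v u = 0 \<Longrightarrow> u \<bullet> v = 0"
    "\<And>w. (\<And>u. ?A *v u = 0 \<Longrightarrow> u \<bullet> w = 0) \<Longrightarrow> eig (?N + 1) ?A * (w \<bullet> w) \<le> w \<bullet> (?A *v w)"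
    using eig_after_kernel[OF LL_mat_symmetric psd dim_LL_mat_kernel less] by blast
  show "0 < lambda_minus C S" using v(1) by (simp add: lm)
  show "lambda_minus C S * (norm \<Omega>)\<^sup>2 \<le> 2 * L_form C S \<Omega>"
    if sk: "\<Omega> \<in> skew_tuples" and z: "(\<Sum>v\<in>UNIV. \<Omega> $ v) = 0"
  proof -
    obtain w :: "real^('d lt_pair \<times> 'k option)" where w: "skew_of w = \<Omega>" using skew_of_surj[OF sk] by blast
    have "lambda_minus C S * (w \<bullet> w) \<le> L_form C S \<Omega>"
      using v(5)[of w] orthogonal_kernel_iff[of w] z by (simp add: lm LL_mat_L_form w)
    then show ?thesis using n2[of w] by (simp add: w)
  qed
  have v0: "skew_of v \<noteq> 0" if "norm v = 1" for v :: "real^('d lt_pair \<times> 'k option)"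
    using n2[of v] that by (auto simp: norm_eq_1)
  show "\<exists>\<Omega>. \<Omega> \<in> skew_tuples \<and> (\<Sum>v\<in>UNIV. \<Omega> $ v) = 0 \<and> \<Omega> \<noteq> 0 \<and>
      2 * L_form C S \<Omega> = lambda_minus C S * (norm \<Omega>)\<^sup>2"
    using v(2-4) orthogonal_kernel_iff[of v] v0[OF v(2)] LL_mat_L_form[of v]
    by (intro exI[of _ "skew_of v"]) (simp add: skew_of_skew n2 lm)
  have lp: "lambda_plus C S = eig CARD('d lt_pair \<times> 'k option) ?A"
  proof -
    \<comment> \<open>Division by 2 is exact, so it may be moved past the number of views.\<close>
    have even: "even (CARD('d) * (CARD('d) - 1))" by (cases "even CARD('d)") auto
    have "CARD('k option) * CARD('d) * (CARD('d) - 1) div 2 = ?N * CARD('k option)"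
      using div_mult_swap[OF even, of "CARD('k option)"] by (simp only: mult_ac)
    then show ?thesis unfolding lambda_plus_def cardA by simp
  qed
  obtain u where u: "norm u = 1" "?A *v u = eig CARD('d lt_pair \<times> 'k option) ?A *\<^sub>R u"
    "\<And>w. w \<bullet> (?A *v w) \<le> eig CARD('d lt_pair \<times> 'k option) ?A * (w \<bullet> w)"
    using eig_last[OF LL_mat_symmetric] by blast
  show "2 * L_form C S \<Omega> \<le> lambda_plus C S * (norm \<Omega>)\<^sup>2" if sk: "\<Omega> \<in> skew_tuples"
  proof -
    obtain w :: "real^('d lt_pair \<times> 'k option)" where w: "skew_of w = \<Omega>" using skew_of_surj[OF sk] by blast
    show ?thesis using u(3)[of w] n2[of w] by (simp add: lp LL_mat_L_form w)
  qed
  show "\<exists>\<Omega>. \<Omega> \<in> skew_tuples \<and> \<Omega> \<noteq> 0 \<and> 2 * L_form C S \<Omega> = lambda_plus C S * (norm \<Omega>)\<^sup>2"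
    using u(1,2) v0[OF u(1)] LL_mat_L_form[of u]
    by (intro exI[of _ "skew_of u"]) (simp add: skew_of_skew n2 lp)
qed

lemma lambda_minus_le_plus: "lambda_minus C S \<le> lambda_plus C S"
proof -
  obtain \<Omega> where \<Omega>: "\<Omega> \<in> skew_tuples" "\<Omega> \<noteq> 0" "2 * L_form C S \<Omega> = lambda_minus C S * (norm \<Omega>)\<^sup>2"
    using lambda_minus_attained by blast
  then have "lambda_minus C S * (norm \<Omega>)\<^sup>2 \<le> lambda_plus C S * (norm \<Omega>)\<^sup>2"
    using lambda_plus_bound by metis
  then show ?thesis using \<Omega>(2) by simp
qed

end

section \<open>Passage to another representative, and the final bounds\<close>

lemma right_mult_orthogonal:
  "S \<in> orthogonal_tuples \<Longrightarrow> orthogonal_matrix Q \<Longrightarrow> right_mult S Q \<in> orthogonal_tuples"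
  by (simp add: right_mult_eq orthogonal_tuples_tmul bcast_orthogonal)

lemma quot_map_right_mult:
  fixes S :: "('k::finite option, 'd::finite) tuple"
  assumes "orthogonal_matrix Q"
  shows "quot_map (right_mult S Q) = quot_map S"
proof -
  have "A ** Q ** (transpose Q ** B) = A ** B" for A B :: "real^'d^'d"
    using assms
    by (metis matrix_mul_assoc matrix_mul_rid orthogonal_matrix_def)
  then show ?thesis by (simp add: quot_map_def right_mult_def matrix_transpose_mul)
qed

lemma nondegenerate_right_mult: "orthogonal_matrix Q \<Longrightarrow> nondegenerate C (right_mult S Q) = nondegenerate C S"
  by (simp add: nondegenerate_def quot_map_right_mult)

lemma right_mult_transpose: "orthogonal_matrix Q \<Longrightarrow> right_mult (right_mult S Q) (transpose Q) = S"
  by (simp add: right_mult_def matrix_mul_assoc[symmetric] orthogonal_matrix_def)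

lemma conj_tuple_norm: "orthogonal_matrix Q \<Longrightarrow> norm (conj_tuple Q A) = norm A"
  by (simp add: norm_eq_sqrt_inner conj_tuple_inner)

lemma conj_tuple_inverse: "orthogonal_matrix Q \<Longrightarrow> conj_tuple (transpose Q) (conj_tuple Q A) = A"
  by (simp add: conj_tuple_eq bcast_simps tmul_assoc orthogonal_tuples_cancel[OF bcast_orthogonal])

text \<open>Conjugating an extremal tuple at \<open>S\<close> gives a test tuple at
  \<open>right_mult S Q\<close> with the same form and norm. The reverse inequalities come from the
  same argument for \<open>right_mult S Q\<close> and \<open>transpose Q\<close>.\<close>

lemma
  fixes C :: "('k::finite option, 'd::{card2, linorder}) block_mat" and S :: "('k option, 'd) tuple"
  assumes C: "transpose C = C" and S: "S \<in> orthogonal_tuples" and nd: "nondegenerate C S"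
    and Q: "orthogonal_matrix Q"
  shows lambda_minus_right_mult_le: "lambda_minus C (right_mult S Q) \<le> lambda_minus C S"
    and lambda_plus_right_mult_ge: "lambda_plus C S \<le> lambda_plus C (right_mult S Q)"
proof -
  note SQ = right_mult_orthogonal[OF S Q]
  have ndQ: "nondegenerate C (right_mult S Q)" using nd by (simp add: nondegenerate_right_mult[OF Q])
  obtain \<Omega> where \<Omega>: "\<Omega> \<in> skew_tuples" "(\<Sum>v\<in>UNIV. \<Omega> $ v) = 0" "\<Omega> \<noteq> 0"
      "2 * L_form C S \<Omega> = lambda_minus C S * (norm \<Omega>)\<^sup>2"
    using lambda_minus_attained[OF C S nd] by blast
  have "lambda_minus C (right_mult S Q) * (norm (conj_tuple Q \<Omega>))\<^sup>2 \<le> 2 * L_form C (right_mult S Q) (conj_tuple Q \<Omega>)"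
    by (rule lambda_minus_bound[OF C SQ ndQ conj_tuple_skew[OF \<Omega>(1)]]) (simp add: sum_conj_tuple \<Omega>(2))
  then show "lambda_minus C (right_mult S Q) \<le> lambda_minus C S"
    using \<Omega>(3,4) by (simp add: conj_tuple_norm[OF Q] L_form_right_mult[OF Q] conj_tuple_inverse[OF Q])
  obtain \<Omega> where \<Omega>: "\<Omega> \<in> skew_tuples" "\<Omega> \<noteq> 0" "2 * L_form C S \<Omega> = lambda_plus C S * (norm \<Omega>)\<^sup>2"
    using lambda_plus_attained[OF C S nd] by blast
  have "2 * L_form C (right_mult S Q) (conj_tuple Q \<Omega>) \<le> lambda_plus C (right_mult S Q) * (norm (conj_tuple Q \<Omega>))\<^sup>2"
    by (rule lambda_plus_bound[OF C SQ ndQ conj_tuple_skew[OF \<Omega>(1)]])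
  then show "lambda_plus C S \<le> lambda_plus C (right_mult S Q)"
    using \<Omega>(2,3) by (simp add: conj_tuple_norm[OF Q] L_form_right_mult[OF Q] conj_tuple_inverse[OF Q])
qed

lemma
  fixes C :: "('k::finite option, 'd::{card2, linorder}) block_mat" and S :: "('k option, 'd) tuple"
  assumes C: "transpose C = C" and S: "S \<in> orthogonal_tuples" and nd: "nondegenerate C S"
    and Q: "orthogonal_matrix Q"
  shows lambda_minus_right_mult: "lambda_minus C (right_mult S Q) = lambda_minus C S"
    and lambda_plus_right_mult: "lambda_plus C (right_mult S Q) = lambda_plus C S"
proof -
  have ndQ: "nondegenerate C (right_mult S Q)" using nd by (simp add: nondegenerate_right_mult[OF Q])
  have Qt: "orthogonal_matrix (transpose Q)" using Q by simp
  note 1 = lambda_minus_right_mult_le[OF C right_mult_orthogonal[OF S Q] ndQ Qt]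
    and 2 = lambda_plus_right_mult_ge[OF C right_mult_orthogonal[OF S Q] ndQ Qt]
  show "lambda_minus C (right_mult S Q) = lambda_minus C S"
    using 1 lambda_minus_right_mult_le[OF C S nd Q] by (simp add: right_mult_transpose[OF Q])
  show "lambda_plus C (right_mult S Q) = lambda_plus C S"
    using 2 lambda_plus_right_mult_ge[OF C S nd Q] by (simp add: right_mult_transpose[OF Q])
qed

text \<open>The orthogonal group is compact, so the infimum is a minimum.\<close>

lemma INF_orthogonal_attained:
  fixes R S :: "('m::finite, 'd::finite) tuple"
  assumes "(INF Q\<in>{Q. orthogonal_matrix Q}. norm (R - right_mult S Q)) \<le> e"
  obtains Q where "orthogonal_matrix Q" "norm (R - right_mult S Q) \<le> e"
proof -
  let ?K = "{Q :: real^'d^'d. orthogonal_matrix Q}" and ?f = "\<lambda>Q. norm (R - right_mult S Q)"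
  have lin: "linear (right_mult S)"
    by (simp add: linear_iff right_mult_def matrix_matrix_mult_def vec_eq_iff sum.distrib algebra_simps sum_distrib_left)
  have "continuous_on UNIV (\<lambda>Q :: real^'d^'d. transpose Q ** Q)"
  proof -
    have "continuous_on UNIV (\<lambda>Q :: real^'d^'d. \<chi> i j. \<Sum>k\<in>UNIV. Q $ k $ i * Q $ k $ j)"
      by (intro continuous_intros)
    then show ?thesis by (simp add: matrix_matrix_mult_def transpose_def)
  qed
  then have "closed ((\<lambda>Q :: real^'d^'d. transpose Q ** Q) -` {mat 1})"
    by (intro continuous_closed_vimage) (simp_all add: continuous_on_eq_continuous_at)
  moreover have "(\<lambda>Q :: real^'d^'d. transpose Q ** Q) -` {mat 1} = ?K"
    by (auto simp: orthogonal_matrix)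
  ultimately have "closed ?K" by simp
  moreover have "bounded ?K"
  proof (rule boundedI)
    fix Q :: "real^'d^'d" assume "Q \<in> ?K"
    then have "Q \<bullet> Q = (mat 1 :: real^'d^'d) \<bullet> mat 1"
      using inner_matrix_mult(2)[of "mat 1" Q Q] by (simp add: orthogonal_matrix_def)
    then show "norm Q \<le> norm (mat 1 :: real^'d^'d)" by (simp add: norm_eq_sqrt_inner)
  qed
  ultimately have "compact ?K" by (simp add: compact_eq_bounded_closed)
  moreover have "?K \<noteq> {}" using orthogonal_matrix_id by blast
  moreover have "continuous_on ?K ?f"
    using lin by (intro continuous_intros linear_continuous_on) (simp add: linear_conv_bounded_linear)
  ultimately obtain Q where Q: "Q \<in> ?K" "\<forall>P\<in>?K. ?f Q \<le> ?f P"
    using continuous_attains_inf by blast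
  then have "?f Q \<le> (INF Q\<in>?K. ?f Q)"
    by (intro cINF_greatest) auto
  then show ?thesis using that Q(1) assms by auto
qed

text \<open>\<open>S\<close> is replaced by a \<open>right_mult S Q\<close> within the given
  distance of \<open>R\<close>, again non-degenerate with the same constants. That
  \<open>\<Omega>\<close> is skew of sum zero does not depend on the base point, so the eigenvalue
  bounds there apply to the velocity of the lift at \<open>R\<close>, and the perturbation estimate
  carries them over.\<close>

lemma hess_bounds_symmetric:
  fixes C :: "('k::finite option, 'd::{card2, linorder}) block_mat" and R S :: "('k option, 'd) tuple"
  assumes C: "transpose C = C" and S: "S \<in> orthogonal_tuples" and nd: "nondegenerate C S"
    and R: "R \<in> orthogonal_tuples" and \<zeta>: "0 < \<zeta>"
    and near: "(INF Q\<in>{Q. orthogonal_matrix Q}. norm (R - right_mult S Q)) \<le> \<zeta> * delta C S"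
    and Z: "Z \<in> tangent_space orthogonal_tuples (quot_map R)"
  shows "(1 - \<zeta>) * lambda_minus C S * g_quot (quot_map R) Z Z
      \<le> g_quot (quot_map R) (hess_F_quot C (quot_map R) Z) Z"
    and "g_quot (quot_map R) (hess_F_quot C (quot_map R) Z) Z
      \<le> (lambda_plus C S + \<zeta> * lambda_minus C S) * g_quot (quot_map R) Z Z"
proof -
  let ?T = "quot_map R" and ?P = "R $ None"
  have T: "?T \<in> orthogonal_tuples" by (rule quot_map_orthogonal[OF R])
  obtain a where a: "a \<in> skew_tuples" "Z = ?T \<odot> a"
    using Z unfolding tangent_space_orthogonal_tuples[OF T] by blast
  have P: "orthogonal_matrix ?P" using R by (simp add: orthogonal_tuples_def)
  define \<Omega> where "\<Omega> = conj_tuple ?P (lift_skew a)"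
  have \<Omega>: "\<Omega> \<in> skew_tuples" "(\<Sum>v\<in>UNIV. \<Omega> $ v) = 0"
    by (simp_all add: \<Omega>_def conj_tuple_skew lift_skew_skew a sum_conj_tuple sum_lift_skew)
  have g: "g_quot ?T Z Z = (norm \<Omega>)\<^sup>2"
    by (simp add: a(2) g_quot_tangent[OF T a(1) a(1)] \<Omega>_def power2_norm_eq_inner conj_tuple_inner[OF P] inner_lift_skew)
  have h: "g_quot ?T (hess_F_quot C ?T Z) Z = 2 * L_form C R \<Omega>"
  proof -
    have "g_quot ?T (hess_F_quot C ?T Z) Z = 2 * L_form C (with_identity ?T) (lift_skew a)"
      using hess_F_quot_form[OF C T a(1) a(1)] by (simp add: a(2) hess_form_eq_L_form[OF C a(1)])
    also have "L_form C (with_identity ?T) (lift_skew a) = L_form C (right_mult (with_identity ?T) ?P) \<Omega>"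
      by (simp add: L_form_right_mult[OF P] \<Omega>_def conj_tuple_inverse[OF P])
    finally show ?thesis by (simp add: with_identity_quot_map[OF R])
  qed
  obtain Q where Q: "orthogonal_matrix Q" "norm (R - right_mult S Q) \<le> \<zeta> * delta C S"
    using INF_orthogonal_attained[OF near] by blast
  let ?S = "right_mult S Q"
  have S': "?S \<in> orthogonal_tuples" by (rule right_mult_orthogonal[OF S Q(1)])
  have nd': "nondegenerate C ?S" using nd by (simp add: nondegenerate_right_mult[OF Q(1)])
  define c where "c = c1 C + c2 C S + 2 * c3 C S"
  have c0: "0 \<le> c" using c1_nonneg[of C] c2_nonneg[of C S] c3_nonneg[of C S] by (simp add: c_def)
  note lpos = lambda_minus_pos[OF C S nd]
  have "\<bar>L_form C R \<Omega> - L_form C ?S \<Omega>\<bar> \<le> c * norm (R - ?S) * (norm \<Omega>)\<^sup>2"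
    using L_form_perturbation[OF S' R, of C \<Omega>] by (simp add: c_def c2_right_mult[OF Q(1)] c3_right_mult[OF Q(1)])
  also have "\<dots> \<le> (\<zeta> * lambda_minus C S / 2) * (norm \<Omega>)\<^sup>2"
  proof (rule mult_right_mono)
    have "c * norm (R - ?S) \<le> c * (\<zeta> * delta C S)" by (rule mult_left_mono[OF Q(2) c0])
    also have "\<dots> \<le> \<zeta> * lambda_minus C S / 2"
    \<comment> \<open>For \<open>c = 0\<close> the left side is zero. Otherwise \<open>c\<close>
      cancels against the denominator of \<open>delta\<close>, whose factor 2 is used up by the 2 in
      front of \<open>L_form\<close>.\<close>
    proof (cases "c = 0")
      case True
      then show ?thesis using \<zeta> lpos by simp
    next
      case False
      then show ?thesis by (simp add: delta_def c_def[symmetric])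
    qed
    finally show "c * norm (R - ?S) \<le> \<zeta> * lambda_minus C S / 2" .
  qed simp
  finally have "2 * \<bar>L_form C R \<Omega> - L_form C ?S \<Omega>\<bar> \<le> \<zeta> * lambda_minus C S * (norm \<Omega>)\<^sup>2" by simp
  moreover have "2 * \<bar>u - v\<bar> = \<bar>2 * u - 2 * v\<bar>" for u v :: real by (simp add: abs_if)
  ultimately have close: "\<bar>2 * L_form C R \<Omega> - 2 * L_form C ?S \<Omega>\<bar> \<le> \<zeta> * lambda_minus C S * (norm \<Omega>)\<^sup>2"
    by (simp only:)
  have lower: "lambda_minus C S * (norm \<Omega>)\<^sup>2 \<le> 2 * L_form C ?S \<Omega>"
    using lambda_minus_bound[OF C S' nd' \<Omega>] by (simp add: lambda_minus_right_mult[OF C S nd Q(1)])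
  have upper: "2 * L_form C ?S \<Omega> \<le> lambda_plus C S * (norm \<Omega>)\<^sup>2"
    using lambda_plus_bound[OF C S' nd' \<Omega>(1)] by (simp add: lambda_plus_right_mult[OF C S nd Q(1)])
  show "(1 - \<zeta>) * lambda_minus C S * g_quot ?T Z Z \<le> g_quot ?T (hess_F_quot C ?T Z) Z"
    using close lower unfolding g h by (simp add: algebra_simps)
  show "g_quot ?T (hess_F_quot C ?T Z) Z \<le> (lambda_plus C S + \<zeta> * lambda_minus C S) * g_quot ?T Z Z"
    using close upper unfolding g h by (simp add: algebra_simps)
qed

theorem proposition3p13:
  fixes E :: "('n::finite \<times> 'k::finite option) set"
    and x :: "'n \<Rightarrow> 'k option \<Rightarrow> (real, 'd::{card2, linorder}) vec"
    and S :: "('k option, 'd) tuple"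
    and C :: "('k option, 'd) block_mat"
    and \<zeta> :: real
  defines "C \<equiv> patch_stress E x"
  assumes "graph_connected E"
    and "S \<in> orthogonal_tuples"
    and "nondegenerate C S"
    and "0 < \<zeta>" and "\<zeta> < 1"
  shows "lambda_minus C S > 0 \<and> lambda_plus C S > 0 \<and>
    (\<forall>Q. orthogonal_matrix Q \<longrightarrow>
       c2 C (right_mult S Q) = c2 C S \<and> c3 C (right_mult S Q) = c3 C S \<and>
       lambda_minus C (right_mult S Q) = lambda_minus C S \<and>
       lambda_plus C (right_mult S Q) = lambda_plus C S) \<and>
    (\<forall>R\<in>orthogonal_tuples.
       (INF Q\<in>{Q. orthogonal_matrix Q}. norm (R - right_mult S Q)) \<le> \<zeta> * delta C S \<longrightarrow>
       (\<forall>Z\<in>tangent_space orthogonal_tuples (quot_map R).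
          (1 - \<zeta>) * lambda_minus C S * g_quot (quot_map R) Z Z
            \<le> g_quot (quot_map R) (hess_F_quot C (quot_map R) Z) Z \<and>
          g_quot (quot_map R) (hess_F_quot C (quot_map R) Z) Z
            \<le> (lambda_plus C S + \<zeta> * lambda_minus C S) * g_quot (quot_map R) Z Z))"
proof -
  have C: "transpose C = C" unfolding C_def by (rule transpose_patch_stress)
  note S = assms(3) and nd = assms(4)
  show ?thesis
  proof (intro conjI allI impI ballI)
    show "lambda_minus C S > 0" by (rule lambda_minus_pos[OF C S nd])
    then show "lambda_plus C S > 0" using lambda_minus_le_plus[OF C S nd] by simp
  next
    fix Q :: "((real, 'd) vec, 'd) vec" assume Q: "orthogonal_matrix Q"
    show "c2 C (right_mult S Q) = c2 C S" by (rule c2_right_mult[OF Q])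
    show "c3 C (right_mult S Q) = c3 C S" by (rule c3_right_mult[OF Q])
    show "lambda_minus C (right_mult S Q) = lambda_minus C S" by (rule lambda_minus_right_mult[OF C S nd Q])
    show "lambda_plus C (right_mult S Q) = lambda_plus C S" by (rule lambda_plus_right_mult[OF C S nd Q])
  next
    fix R Z
    assume "R \<in> orthogonal_tuples"
      and "(INF Q\<in>{Q. orthogonal_matrix Q}. norm (R - right_mult S Q)) \<le> \<zeta> * delta C S"
      and "Z \<in> tangent_space orthogonal_tuples (quot_map R)"
    note hess_bounds_symmetric[OF C S nd this(1) assms(5) this(2,3)]
    then show "(1 - \<zeta>) * lambda_minus C S * g_quot (quot_map R) Z Z
          \<le> g_quot (quot_map R) (hess_F_quot C (quot_map R) Z) Z"
      and "g_quot (quot_map R) (hess_F_quot C (quot_map R) Z) Z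
          \<le> (lambda_plus C S + \<zeta> * lambda_minus C S) * g_quot (quot_map R) Z Z"
      by blast+
  qed
qed

end
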